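(* Let $Q$ be a near-quadrangulation with a simple closed boundary such that all internal vertices have degree at least $4$. Then the distances between boundary vertices determine $Q$. That is: if $Q_1$ and $Q_2$ are two near-quadrangulations with simple closed boundary, in each of which all internal vertices have degree at least $4$, and $\varphi$ is a bijection from the set of boundary vertices of $Q_1$ to the set of boundary vertices of $Q_2$ such that $d_{Q_1}(u,v)=d_{Q_2}(\varphi(u),\varphi(v))$ for all boundary vertices $u,v$ of $Q_1$, then $\varphi$ extends to a graph isomorphism from $Q_1$ to $Q_2$ which carries the boundary cycle of $Q_1$ to that of $Q_2$ and internal faces of $Q_1$ to internal faces of $Q_2$.
   Context: Graphs are finite and simple. A near-quadrangulation with a simple closed boundary is a plane graph whose outer face is bounded by a (simple) cycle, the boundary, and every other face (internal face) is a quadrangle, i.e. bounded by a $4$-cycle. Vertices on the boundary cycle are boundary vertices; all other vertices are internal. $d_G$ denotes graph distance in $G$. The cyclic order of the boundary vertices is not part of the given information; only the set of boundary vertices and their pairwise distances in the graph are given. *)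

theory Defs
  imports "HOL-Analysis.Analysis" "HOL-Library.Extended_Nat"
begin

text \<open>
  A plane graph is a pair of finite sets: points of the plane (vertices) and arcs between
  them (edges).  An edge is the point set of an arc, including its two end points; the ends of
  an edge are recovered as the vertices lying on it.
\<close>

record plane_graph =
  verts :: "complex set"
  edges :: "complex set set"

definition ends :: "plane_graph \<Rightarrow> complex set \<Rightarrow> complex set" where
  "ends G e = e \<inter> verts G"

text \<open>
  In \<open>is_plane_graph\<close>, the equation for \<^term>\<open>ends G e\<close> says that the end points of the arc are
  vertices and that its interior contains no vertex.  The next conjunct then says
  that the interior of an edge contains no point of another edge, and the last one excludes
  parallel edges.  Loops are excluded because an \<^const>\<open>arc\<close> has distinct end points.
\<close>

definition is_plane_graph :: "plane_graph \<Rightarrow> bool" where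
  "is_plane_graph G \<longleftrightarrow>
     finite (verts G) \<and> finite (edges G) \<and>
     (\<forall>e\<in>edges G. \<exists>g. arc g \<and> path_image g = e \<and> ends G e = {pathstart g, pathfinish g}) \<and>
     (\<forall>e\<in>edges G. \<forall>e'\<in>edges G. e \<noteq> e' \<longrightarrow> e \<inter> e' \<subseteq> verts G) \<and>
     (\<forall>e\<in>edges G. \<forall>e'\<in>edges G. ends G e = ends G e' \<longrightarrow> e = e')"

definition adj :: "plane_graph \<Rightarrow> complex \<Rightarrow> complex \<Rightarrow> bool" where
  "adj G u v \<longleftrightarrow> (\<exists>e\<in>edges G. ends G e = {u, v})"

definition vdegree :: "plane_graph \<Rightarrow> complex \<Rightarrow> nat" where
  "vdegree G v = card {u \<in> verts G. adj G v u}"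

text \<open>The least length of a walk from \<open>u\<close> to \<open>v\<close>, and \<open>\<infinity>\<close> if there is none.\<close>

definition gdist :: "plane_graph \<Rightarrow> complex \<Rightarrow> complex \<Rightarrow> enat" where
  "gdist G u v = (INF n \<in> {n. (adj G ^^ n) u v}. enat n)"

definition is_cycle :: "plane_graph \<Rightarrow> complex list \<Rightarrow> bool" where
  "is_cycle G vs \<longleftrightarrow>
     length vs \<ge> 3 \<and> distinct vs \<and> set vs \<subseteq> verts G \<and>
     (\<forall>i<length vs. adj G (vs ! i) (vs ! (Suc i mod length vs)))"

definition cycle_edges :: "plane_graph \<Rightarrow> complex list \<Rightarrow> complex set set" where
  "cycle_edges G vs =
     {e \<in> edges G. \<exists>i<length vs. ends G e = {vs ! i, vs ! (Suc i mod length vs)}}"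

definition support :: "plane_graph \<Rightarrow> complex set" where
  "support G = verts G \<union> \<Union> (edges G)"

definition faces :: "plane_graph \<Rightarrow> complex set set" where
  "faces G = components (- support G)"

text \<open>
  The complement of a compact subset of the plane has exactly one unbounded component, which
  is what \<^const>\<open>outside\<close> denotes.
\<close>

definition outer_face :: "plane_graph \<Rightarrow> complex set" where
  "outer_face G = outside (support G)"

definition internal_faces :: "plane_graph \<Rightarrow> complex set set" where
  "internal_faces G = faces G - {outer_face G}"

definition bounded_by_cycle :: "plane_graph \<Rightarrow> complex set \<Rightarrow> complex list \<Rightarrow> bool" where
  "bounded_by_cycle G F vs \<longleftrightarrow> is_cycle G vs \<and> frontier F = \<Union> (cycle_edges G vs)"

definition near_quadrangulation :: "plane_graph \<Rightarrow> bool" where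
  "near_quadrangulation G \<longleftrightarrow>
     is_plane_graph G \<and>
     (\<exists>vs. bounded_by_cycle G (outer_face G) vs) \<and>
     (\<forall>F\<in>internal_faces G. \<exists>vs. length vs = 4 \<and> bounded_by_cycle G F vs)"

definition boundary_verts :: "plane_graph \<Rightarrow> complex set" where
  "boundary_verts G = verts G \<inter> frontier (outer_face G)"

definition internal_verts :: "plane_graph \<Rightarrow> complex set" where
  "internal_verts G = verts G - boundary_verts G"

text \<open>
  The edges bounding a face, each given by its pair of ends so that they can be transported
  along a map of vertices.  For the outer face this is the boundary cycle.
\<close>

definition face_boundary :: "plane_graph \<Rightarrow> complex set \<Rightarrow> complex set set" where
  "face_boundary G F = ends G ` {e \<in> edges G. e \<subseteq> frontier F}"

definition boundary_cycle :: "plane_graph \<Rightarrow> complex set set" where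
  "boundary_cycle G = face_boundary G (outer_face G)"

definition graph_iso :: "plane_graph \<Rightarrow> plane_graph \<Rightarrow> (complex \<Rightarrow> complex) \<Rightarrow> bool" where
  "graph_iso G H f \<longleftrightarrow>
     bij_betw f (verts G) (verts H) \<and>
     (\<forall>u\<in>verts G. \<forall>v\<in>verts G. adj G u v \<longleftrightarrow> adj H (f u) (f v))"

definition carries_boundary_cycle ::
    "plane_graph \<Rightarrow> plane_graph \<Rightarrow> (complex \<Rightarrow> complex) \<Rightarrow> bool" where
  "carries_boundary_cycle G H f \<longleftrightarrow> (`) f ` boundary_cycle G = boundary_cycle H"

text \<open>
  The map of internal faces induced by \<open>f\<close> matches the bounding edges and is a bijection.
\<close>

definition carries_internal_faces ::
    "plane_graph \<Rightarrow> plane_graph \<Rightarrow> (complex \<Rightarrow> complex) \<Rightarrow> bool" where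
  "carries_internal_faces G H f \<longleftrightarrow>
     (\<exists>h. bij_betw h (internal_faces G) (internal_faces H) \<and>
          (\<forall>F\<in>internal_faces G. (`) f ` face_boundary G F = face_boundary H (h F)))"

end

theory Submission
  imports Defs
begin

text \<open>
  Both graphs are rebuilt from the boundary by peeling.  If \<open>v\<close> is a vertex farthest from a fixed
  boundary vertex \<open>u\<close>, then all neighbours of \<open>v\<close> are closer to \<open>u\<close>; the quadrangle condition
  and the absence of a corner of a cube leave at most two of them, so \<open>v\<close> and its neighbours lie on
  the boundary and \<open>v\<close> is recognised from boundary distances.  If \<open>v\<close> has two neighbours \<open>a\<close> and
  \<open>b\<close>, the vertex \<open>w\<close> opposite to \<open>v\<close> in their square satisfies
  \<open>d x w + d x v = d x a + d x b\<close>, so \<open>v\<close> may be deleted and \<open>w\<close> declared to be a boundary vertex.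

  The quadrangle condition follows from a discrete Gauss-Bonnet inequality: for every cycle \<open>C\<close>
  the sum of \<open>3 - deg x\<close> over its vertices, with degrees taken in the closed disc of \<open>C\<close>, is at
  least 4.  It is proved by cutting the disc along a chord (theta curve theorem), where the
  hypothesis on internal degrees controls the contribution of the chord.  It also makes every
  4-cycle a face.  Hence two vertices have at most two common neighbours and there is no corner of
  a cube: the squares involved would be faces forming a closed surface without the outer face.
\<close>

section \<open>Rigidity by peeling\<close>

text \<open>After a peeling the remaining graph need not be bounded by a cycle, so
  near-quadrangulations are not closed under the induction. What survives is metric: parity,
  descent, the quadrangle condition, at most two common neighbours, no corner of a cube. The role of
  being internal is taken over by \<open>rich\<close>: an edge at a vertex outside \<open>B\<close>
  lies on two squares. Deleting a farthest vertex leaves an isometric subgraph, and the vertices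
  that lose a square end up in the new \<open>B\<close>.

  The constants of the inequality come from giving every face right angles. A vertex of degree
  \<open>k\<close> in a disc on whose boundary it lies sees \<open>k - 1\<close> right angles, so
  the boundary turns there by \<open>3 - k\<close> quarter turns; a full turn consists of 4. Inside
  vertices of degree at least 4 have nonpositive curvature, which leaves the boundary to supply all
  of the 4.

  No embeddings have to be compared at the end: internal faces are the same as 4-cycles, and
  boundary edges are those lying on at most one 4-cycle, so an isomorphism of abstract graphs
  respects both.\<close>

text \<open>
  Only the distance function is kept, and adjacency means distance 1.  Peeling then restricts \<open>d\<close>
  to fewer points without recomputing it.
\<close>

locale peelable =
  fixes V :: "'a set" and d :: "'a \<Rightarrow> 'a \<Rightarrow> nat" and B :: "'a set"
  assumes fin: "finite V" and BV: "B \<subseteq> V"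
    and zero: "x \<in> V \<Longrightarrow> y \<in> V \<Longrightarrow> d x y = 0 \<longleftrightarrow> x = y"
    and sym: "x \<in> V \<Longrightarrow> y \<in> V \<Longrightarrow> d x y = d y x"
    and step: "\<lbrakk>x \<in> V; a \<in> V; b \<in> V; d a b = 1\<rbrakk> \<Longrightarrow> d x a = Suc (d x b) \<or> d x b = Suc (d x a)"
    and descend: "\<lbrakk>x \<in> V; y \<in> V; x \<noteq> y\<rbrakk> \<Longrightarrow> \<exists>z\<in>V. d y z = 1 \<and> d x y = Suc (d x z)"
    and quad: "\<lbrakk>x \<in> V; y \<in> V; a \<in> V; b \<in> V; a \<noteq> b; d y a = 1; d y b = 1;
        d x y = Suc (d x a); d x y = Suc (d x b)\<rbrakk>
      \<Longrightarrow> \<exists>w\<in>V. d a w = 1 \<and> d b w = 1 \<and> d x a = Suc (d x w)"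
    and K23: "\<lbrakk>a \<in> V; b \<in> V; x \<in> V; y \<in> V; z \<in> V; a \<noteq> b; d a x = 1; d b x = 1; d a y = 1; d b y = 1;
        d a z = 1; d b z = 1\<rbrakk> \<Longrightarrow> x = y \<or> x = z \<or> y = z"
    and cube: "\<lbrakk>v \<in> V; a \<in> V; b \<in> V; c \<in> V; p \<in> V; q \<in> V; r \<in> V; a \<noteq> b; b \<noteq> c; a \<noteq> c;
        d v a = 1; d v b = 1; d v c = 1; p \<noteq> v; q \<noteq> v; r \<noteq> v; d a p = 1; d b p = 1;
        d b q = 1; d c q = 1; d a r = 1; d c r = 1\<rbrakk> \<Longrightarrow> False"
    and rich: "\<lbrakk>x \<in> V; y \<in> V; x \<notin> B; d x y = 1\<rbrakk> \<Longrightarrow>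
        \<exists>z\<in>V. \<exists>t\<in>V. \<exists>z'\<in>V. \<exists>t'\<in>V. (z, t) \<noteq> (z', t') \<and> z \<noteq> x \<and> t \<noteq> y \<and> z' \<noteq> x \<and> t' \<noteq> y \<and>
          d y z = 1 \<and> d z t = 1 \<and> d t x = 1 \<and> d y z' = 1 \<and> d z' t' = 1 \<and> d t' x = 1"
begin

text \<open>A set rather than a vertex: it is empty if \<open>v\<close> has at most one neighbour,
  and for a farthest \<open>v\<close> with two neighbours it turns out to be a singleton.\<close>

definition opposite :: "'a \<Rightarrow> 'a set" where
  "opposite v = {w \<in> V. w \<noteq> v \<and>
     (\<exists>a\<in>V. \<exists>b\<in>V. a \<noteq> b \<and> d v a = 1 \<and> d v b = 1 \<and> d a w = 1 \<and> d b w = 1)}"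

definition peel :: "'a \<Rightarrow> 'a set" where
  "peel v = (B - {v}) \<union> opposite v"

section \<open>One peeling step at a farthest vertex\<close>

context
  fixes u v
  assumes u: "u \<in> V" and v: "v \<in> V" and far: "\<And>x. x \<in> V \<Longrightarrow> d u x \<le> d u v"
begin

lemma nbr_down: "x \<in> V \<Longrightarrow> d v x = 1 \<Longrightarrow> d u v = Suc (d u x)"
  using step[OF u v, of x] far[of x] by auto

text \<open>The vertex supplied by \<open>quad\<close> is two levels nearer to \<open>u\<close> than
  \<open>v\<close>, hence different from \<open>v\<close>.\<close>

lemma nbr_square:
  assumes "a \<in> V" "b \<in> V" "a \<noteq> b" "d v a = 1" "d v b = 1"
  obtains w where "w \<in> V" "w \<noteq> v" "d a w = 1" "d b w = 1" "d u a = Suc (d u w)"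
proof -
  obtain w where w: "w \<in> V" "d a w = 1" "d b w = 1" "d u a = Suc (d u w)"
    using quad[OF u v assms(1-5)] nbr_down[of a] nbr_down[of b] assms by auto
  moreover have "w \<noteq> v" using w nbr_down[of a] assms by auto
  ultimately show ?thesis using that by blast
qed

text \<open>Three neighbours of \<open>v\<close> would have, pair by pair, further common neighbours
  nearer to \<open>u\<close>; together with \<open>v\<close> this is the configuration excluded by
  \<open>cube\<close>.\<close>

lemma few_nbrs:
  assumes "a \<in> V" "b \<in> V" "c \<in> V" "d v a = 1" "d v b = 1" "d v c = 1"
  shows "a = b \<or> b = c \<or> a = c"
proof (rule ccontr)
  assume n: "\<not> ?thesis"
  obtain p where p: "p \<in> V" "p \<noteq> v" "d a p = 1" "d b p = 1"
    using nbr_square[of a b] assms n by metis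
  obtain q where q: "q \<in> V" "q \<noteq> v" "d b q = 1" "d c q = 1"
    using nbr_square[of b c] assms n by metis
  obtain r where r: "r \<in> V" "r \<noteq> v" "d a r = 1" "d c r = 1"
    using nbr_square[of a c] assms n by metis
  show False
    using cube[OF v assms(1-3) p(1) q(1) r(1)] p q r assms n by auto
qed

text \<open>By \<open>few_nbrs\<close> the vertices \<open>a\<close> and \<open>b\<close> are the
  only pair that can define \<open>w\<close>, and a second candidate would give them three common
  neighbours, one of them being \<open>v\<close>.\<close>

lemma opposite_unique:
  assumes w: "w \<in> opposite v" and "a \<in> V" "b \<in> V" "a \<noteq> b" "d v a = 1" "d v b = 1"
  shows "d a w = 1" "d b w = 1" "\<And>z. \<lbrakk>z \<in> V; z \<noteq> v; d a z = 1; d b z = 1\<rbrakk> \<Longrightarrow> z = w"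
proof -
  obtain a' b' where ab: "a' \<in> V" "b' \<in> V" "a' \<noteq> b'" "d v a' = 1" "d v b' = 1" "d a' w = 1" "d b' w = 1"
    and wv: "w \<in> V" "w \<noteq> v"
    using w unfolding opposite_def by blast
  have "{a, b} = {a', b'}"
    using few_nbrs[of a b a'] few_nbrs[of a b b'] assms ab by auto
  then show aw: "d a w = 1" "d b w = 1" using ab by (auto simp: doubleton_eq_iff)
  fix z assume "z \<in> V" "z \<noteq> v" "d a z = 1" "d b z = 1"
  then show "z = w"
    using K23[OF \<open>a \<in> V\<close> \<open>b \<in> V\<close> \<open>z \<in> V\<close> wv(1) v \<open>a \<noteq> b\<close>] aw wv sym v assms by auto
qed

text \<open>Two squares on the edge from \<open>v\<close> to \<open>x\<close> leave \<open>v\<close>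
  by the same second edge, because \<open>v\<close> has at most two neighbours, and
  \<open>K23\<close> then identifies their fourth corners. But \<open>rich\<close> supplies two
  different squares at a vertex outside \<open>B\<close>.\<close>

lemma far_in_B: "v \<in> B"
  if "x \<in> V" "d v x = 1" for x
proof (rule ccontr)
  assume "v \<notin> B"
  from rich[OF v that(1) this that(2)] obtain z t z' t' where
    *: "z \<in> V" "t \<in> V" "z' \<in> V" "t' \<in> V" "(z, t) \<noteq> (z', t')" "z \<noteq> v" "t \<noteq> x" "z' \<noteq> v" "t' \<noteq> x"
    "d x z = 1" "d z t = 1" "d t v = 1" "d x z' = 1" "d z' t' = 1" "d t' v = 1" by blast
  have "t = t'" using few_nbrs[of x t t'] * that sym v by auto
  moreover have "z = z'"
    using K23[OF that(1) *(2) *(1) *(3) v] * that sym v \<open>t = t'\<close> by auto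
  ultimately show False using * by simp
qed

text \<open>The argument of \<open>far_in_B\<close> with the edge read from \<open>x\<close>: both
  squares pass through the second neighbour of \<open>v\<close> and so coincide. Consequently
  boundary distances reveal all neighbours of \<open>v\<close>.\<close>

lemma nbr_in_B: "x \<in> B" if "x \<in> V" "d v x = 1"
proof (rule ccontr)
  assume "x \<notin> B"
  from rich[OF that(1) v this] that sym v obtain z t z' t' where
    *: "z \<in> V" "t \<in> V" "z' \<in> V" "t' \<in> V" "(z, t) \<noteq> (z', t')" "z \<noteq> x" "t \<noteq> v" "z' \<noteq> x" "t' \<noteq> v"
    "d v z = 1" "d z t = 1" "d t x = 1" "d v z' = 1" "d z' t' = 1" "d t' x = 1" by metis
  have "z = z'" using few_nbrs[of x z z'] * that by auto
  moreover have "t = t'"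
    using K23[OF that(1) *(1) *(2) *(4) v] * that sym v \<open>z = z'\<close> by auto
  ultimately show False using * by simp
qed

text \<open>Distances are merely restricted, and a witness equal to \<open>v\<close> can be
  exchanged or is impossible. The corners of the square lost with \<open>v\<close> are its
  neighbours, which already lie in \<open>B\<close>, and the opposite vertex, which
  \<open>peel\<close> adds.\<close>

lemma peel_peelable: "peelable (V - {v}) d (peel v)"
proof
  show "finite (V - {v})" using fin by simp
  show "peel v \<subseteq> V - {v}" using BV by (auto simp: peel_def opposite_def)
  show "\<exists>z\<in>V - {v}. d y z = 1 \<and> d x y = Suc (d x z)"
    if "x \<in> V - {v}" "y \<in> V - {v}" "x \<noteq> y" for x y
  proof -
    have xy: "x \<in> V" "y \<in> V" "x \<noteq> v" "y \<noteq> v" "x \<noteq> y" using that by auto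
    obtain z where z: "z \<in> V" "d y z = 1" "d x y = Suc (d x z)"
      using descend[OF xy(1,2,5)] by blast
    show ?thesis
    proof (cases "z = v")
      case True
      \<comment> \<open>If \<open>y\<close> descends to \<open>x\<close> only through
        \<open>v\<close>, the path is led around the square on the neighbours \<open>y\<close> and
        \<open>b\<close> of \<open>v\<close>; the fourth corner is on the same level as
        \<open>v\<close>.\<close>
      obtain b where b: "b \<in> V" "d v b = 1" "d x v = Suc (d x b)"
        using descend[OF xy(1) v xy(3)] by blast
      have "y \<noteq> b" using z b True by auto
      then obtain w where w: "w \<in> V" "w \<noteq> v" "d y w = 1" "d b w = 1"
        using nbr_square[of y b] xy b z sym v True by metis
      have "d x y = Suc (d x w)"
        using step[OF xy(1) b(1) w(1) w(4)] step[OF xy(1,2) w(1) w(3)] b(3) z(3)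
        unfolding True by linarith
      then show ?thesis using w by auto
    qed (use z in auto)
  qed
  show "\<exists>w\<in>V - {v}. d a w = 1 \<and> d b w = 1 \<and> d x a = Suc (d x w)"
    if "x \<in> V - {v}" "y \<in> V - {v}" "a \<in> V - {v}" "b \<in> V - {v}" "a \<noteq> b" "d y a = 1" "d y b = 1"
        "d x y = Suc (d x a)" "d x y = Suc (d x b)" for x y a b
  proof -
    note hyps = that
    obtain w where w: "w \<in> V" "d a w = 1" "d b w = 1" "d x a = Suc (d x w)"
      using quad[of x y a b] hyps by blast
    \<comment> \<open>If \<open>w\<close> were \<open>v\<close>, it would have the two neighbours
      \<open>a\<close> and \<open>b\<close> farther from \<open>x\<close> and a third one nearer to
      \<open>x\<close>.\<close>
    have "w \<noteq> v"
    proof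
      assume "w = v"
      moreover obtain c where "c \<in> V" "d v c = 1" "d x v = Suc (d x c)"
        using descend[of x v] hyps v by blast
      ultimately show False using few_nbrs[of a b c] w hyps sym v by auto
    qed
    then show ?thesis using w by auto
  qed
  show "\<exists>z\<in>V - {v}. \<exists>t\<in>V - {v}. \<exists>z'\<in>V - {v}. \<exists>t'\<in>V - {v}. (z, t) \<noteq> (z', t') \<and> z \<noteq> x \<and> t \<noteq> y \<and>
      z' \<noteq> x \<and> t' \<noteq> y \<and> d y z = 1 \<and> d z t = 1 \<and> d t x = 1 \<and> d y z' = 1 \<and> d z' t' = 1 \<and> d t' x = 1"
    if "x \<in> V - {v}" "y \<in> V - {v}" "x \<notin> peel v" "d x y = 1" for x y
  proof -
    note hyps = that
    have nB: "x \<notin> B" "x \<notin> opposite v" using that by (auto simp: peel_def)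
    \<comment> \<open>A square on this edge passing through \<open>v\<close> would make
      \<open>x\<close> a neighbour of \<open>v\<close> or the vertex opposite to it, and both kinds
      belong to \<open>peel v\<close>.\<close>
    have "z \<noteq> v \<and> t \<noteq> v" if zt: "z \<in> V" "t \<in> V" "z \<noteq> x" "t \<noteq> y" "d y z = 1" "d z t = 1" "d t x = 1" for z t
    proof -
      have "t \<noteq> v" using nbr_in_B[of x] nB zt(7) hyps(1) by auto
      moreover have "z \<noteq> v"
      proof
        assume "z = v"
        have "d v y = 1" "d v t = 1" "d y x = 1"
          using zt hyps \<open>z = v\<close> sym[of x y] sym[of y v] v by auto
        then have "x \<in> opposite v" unfolding opposite_def
          using zt hyps by blast
        then show False using nB by simp
      qed
      ultimately show ?thesis by blast
    qed
    note avoid = this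
    have "x \<in> V" "y \<in> V" using hyps by auto
    from rich[OF this nB(1) hyps(4)] obtain z t z' t' where *:
      "z \<in> V" "t \<in> V" "z' \<in> V" "t' \<in> V" "(z, t) \<noteq> (z', t')" "z \<noteq> x" "t \<noteq> y" "z' \<noteq> x" "t' \<noteq> y"
      "d y z = 1" "d z t = 1" "d t x = 1" "d y z' = 1" "d z' t' = 1" "d t' x = 1" by blast
    moreover have "z \<in> V - {v}" "t \<in> V - {v}" using avoid[of z t] * by simp_all
    moreover have "z' \<in> V - {v}" "t' \<in> V - {v}" using avoid[of z' t'] * by simp_all
    ultimately show ?thesis by blast
  qed
  show "d x y = 0 \<longleftrightarrow> x = y" if "x \<in> V - {v}" "y \<in> V - {v}" for x y
    using zero that by simp
  show "d x y = d y x" if "x \<in> V - {v}" "y \<in> V - {v}" for x y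
    using sym that by simp
  show "d x a = Suc (d x b) \<or> d x b = Suc (d x a)"
    if "x \<in> V - {v}" "a \<in> V - {v}" "b \<in> V - {v}" "d a b = 1" for x a b
    using step that by simp
  show "x = y \<or> x = z \<or> y = z"
    if "a \<in> V - {v}" "b \<in> V - {v}" "x \<in> V - {v}" "y \<in> V - {v}" "z \<in> V - {v}" "a \<noteq> b"
      "d a x = 1" "d b x = 1" "d a y = 1" "d b y = 1" "d a z = 1" "d b z = 1" for a b x y z
    by (rule K23[of a b]) (use that in simp_all)
  show False
    if "v' \<in> V - {v}" "a \<in> V - {v}" "b \<in> V - {v}" "c \<in> V - {v}" "p \<in> V - {v}" "q \<in> V - {v}"
      "r \<in> V - {v}" "a \<noteq> b" "b \<noteq> c" "a \<noteq> c" "d v' a = 1" "d v' b = 1" "d v' c = 1" "p \<noteq> v'"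
      "q \<noteq> v'" "r \<noteq> v'" "d a p = 1" "d b p = 1" "d b q = 1" "d c q = 1" "d a r = 1" "d c r = 1"
    for v' a b c p q r
    by (rule cube[of v' a b c p q r]) (use that in simp_all)
qed

text \<open>Distances to \<open>x\<close> change by 1 along each side of the square. If
  \<open>a\<close> and \<open>b\<close> are equally far, both are nearer than \<open>v\<close>, and
  the quadrangle condition puts \<open>w\<close> one level below them; otherwise they differ by 2,
  and \<open>v\<close> and \<open>w\<close> share the level between. The identity computes distances
  to the new boundary vertex from old ones.\<close>

lemma dist_opposite:
  assumes w: "w \<in> opposite v" and ab: "a \<in> V" "b \<in> V" "a \<noteq> b" "d v a = 1" "d v b = 1"
    and x: "x \<in> V" "x \<noteq> v"
  shows "d x w + d x v = d x a + d x b"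
proof -
  have wV: "w \<in> V" "w \<noteq> v" using w by (auto simp: opposite_def)
  have aw: "d a w = 1" "d b w = 1" using opposite_unique[OF w ab] by auto
  obtain c where c: "c \<in> V" "d v c = 1" "d x v = Suc (d x c)"
    using descend[OF x(1) v x(2)] by blast
  have cab: "c = a \<or> c = b" using few_nbrs[of a b c] ab c by auto
  show ?thesis
  proof (cases "d x a = d x b")
    case True
    then have "d x v = Suc (d x a)" "d x v = Suc (d x b)" using c cab by auto
    then obtain z where z: "z \<in> V" "d a z = 1" "d b z = 1" "d x a = Suc (d x z)"
      using quad[OF x(1) v ab] by blast
    have "z = w" using opposite_unique(3)[OF w ab z(1) _ z(2,3)] z \<open>d x v = Suc (d x a)\<close> by force
    then show ?thesis using z True \<open>d x v = Suc (d x a)\<close> by auto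
  next
    case False
    then show ?thesis
      using step[OF x(1) v ab(1,4)] step[OF x(1) v ab(2,5)] step[OF x(1) ab(1) wV(1) aw(1)]
        step[OF x(1) ab(2) wV(1) aw(2)] by linarith
  qed
qed

end

text \<open>A vertex farthest from \<open>u\<close> in all of \<open>V\<close> lies in
  \<open>B\<close> by \<open>far_in_B\<close>, so the two maxima agree. Hence boundary data alone
  select the vertex to peel, in both graphs at once.\<close>

lemma far_over_B:
  assumes u: "u \<in> V" "u \<in> B" and v: "v \<in> B" and far: "\<And>x. x \<in> B \<Longrightarrow> d u x \<le> d u v"
  shows "x \<in> V \<Longrightarrow> d u x \<le> d u v"
proof -
  define m where "m = Max (d u ` V)"
  have ne: "V \<noteq> {}" and finV: "finite (d u ` V)" using u fin by auto
  have "m \<in> d u ` V" unfolding m_def by (rule Max_in[OF finV]) (use ne in simp)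
  then obtain y where y: "y \<in> V" "d u y = m" by auto
  have my: "d u x \<le> d u y" if "x \<in> V" for x using that y m_def Max_ge[OF finV] by auto
  have "y \<in> B"
  proof (cases "y = u")
    case False
    then obtain z where "z \<in> V" "d y z = 1" using descend[of u y] u y by auto
    then show ?thesis using far_in_B[OF u(1) y(1)] my by blast
  qed (use u in simp)
  then show "x \<in> V \<Longrightarrow> d u x \<le> d u v" using my far[of y] le_trans by blast
qed

end

text \<open>A farthest boundary vertex \<open>v\<close> and its image are peeled together, the
  bijection is adapted to the peeled boundaries, and \<open>v\<close> is put back afterwards. The
  base point \<open>u\<close> is kept through the whole induction, since the case
  \<open>v = u\<close> ends it.\<close>

theorem peelable_rigid:
  assumes "peelable V d B" "peelable V' d' B'" "u \<in> B" "bij_betw \<phi> B B'"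
    and "\<And>x y. x \<in> B \<Longrightarrow> y \<in> B \<Longrightarrow> d' (\<phi> x) (\<phi> y) = d x y"
  shows "\<exists>\<psi>. bij_betw \<psi> V V' \<and> (\<forall>x\<in>B. \<psi> x = \<phi> x) \<and>
    (\<forall>x\<in>V. \<forall>y\<in>V. d' (\<psi> x) (\<psi> y) = 1 \<longleftrightarrow> d x y = 1)"
  using assms
proof (induction "card V" arbitrary: V V' B B' \<phi> rule: less_induct)
  case less
  interpret P: peelable V d B by fact
  interpret Q: peelable V' d' B' by fact
  have \<phi>B: "\<phi> x \<in> B'" if "x \<in> B" for x using that less.prems(4) bij_betwE by blast
  have dB: "d' (\<phi> x) (\<phi> y) = d x y" if "x \<in> B" "y \<in> B" for x y using less.prems(5) that by blast
  have injB: "\<phi> x = \<phi> y \<Longrightarrow> x = y" if "x \<in> B" "y \<in> B" for x y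
    using that less.prems(4) by (auto simp: bij_betw_def inj_on_def)
  have surB: "\<exists>x\<in>B. \<phi> x = y" if "y \<in> B'" for y
    using that less.prems(4) by (auto simp: bij_betw_def)
  have uB: "u \<in> B" by fact
  then have u: "u \<in> V" using P.BV by auto
  have finB: "finite (d u ` B)" using P.fin P.BV finite_subset by blast
  have "Max (d u ` B) \<in> d u ` B" by (rule Max_in[OF finB]) (use uB in auto)
  then obtain v where v: "v \<in> B" "d u v = Max (d u ` B)" by auto
  then have vB: "\<And>x. x \<in> B \<Longrightarrow> d u x \<le> d u v" using Max_ge[OF finB] by auto
  have vV: "v \<in> V" using v P.BV by auto
  have far: "\<And>x. x \<in> V \<Longrightarrow> d u x \<le> d u v"
    using P.far_over_B[OF u uB v(1) vB] by blast
  define u' v' where "u' = \<phi> u" and "v' = \<phi> v"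
  have u'B: "u' \<in> B'" and v'B: "v' \<in> B'" using \<phi>B uB v by (auto simp: u'_def v'_def)
  then have u'V: "u' \<in> V'" and v'V: "v' \<in> V'" using Q.BV by auto
  have "\<And>x. x \<in> B' \<Longrightarrow> d' u' x \<le> d' u' v'"
    using surB vB dB uB v unfolding u'_def v'_def by metis
  then have far': "\<And>x. x \<in> V' \<Longrightarrow> d' u' x \<le> d' u' v'"
    using Q.far_over_B[OF u'V u'B v'B] by blast
  show ?case
  proof (cases "v = u")
    \<comment> \<open>All distances from \<open>u\<close> vanish here, so both graphs have a single
      vertex.\<close>
    case True
    have "x = u" if "x \<in> V" for x
    proof -
      have "d u x = 0" using far[OF that] P.zero[OF u u] True by simp
      then show ?thesis using P.zero[OF u that] by simp
    qed
    then have "V = {u}" using u by blast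
    have "v' = u'" using True unfolding u'_def v'_def by simp
    have "x = u'" if "x \<in> V'" for x
    proof -
      have "d' u' x = 0" using far'[OF that] Q.zero[OF u'V u'V] \<open>v' = u'\<close> by simp
      then show ?thesis using Q.zero[OF u'V that] by simp
    qed
    then have "V' = {u'}" using u'V by blast
    moreover have "B = {u}" using P.BV uB \<open>V = {u}\<close> by auto
    moreover note \<open>V = {u}\<close>
    ultimately show ?thesis
      using P.zero[of u u] Q.zero[of u' u'] by (intro exI[of _ \<phi>]) (auto simp: bij_betw_def u'_def)
  next
    case False
    have NB: "x \<in> B" if "x \<in> V" "d v x = 1" for x using P.nbr_in_B[OF u vV far that] .
    have NB': "x \<in> B'" if "x \<in> V'" "d' v' x = 1" for x using Q.nbr_in_B[OF u'V v'V far' that] .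
    define W W' where "W = P.opposite v" and "W' = Q.opposite v'"
    have W_sub: "w \<in> V \<and> w \<noteq> v" if "w \<in> W" for w using that unfolding W_def P.opposite_def by auto
    have W'_sub: "w \<in> V' \<and> w \<noteq> v'" if "w \<in> W'" for w using that unfolding W'_def Q.opposite_def by auto
    have vN: "d x v = d v x" if "x \<in> V" for x using P.sym that vV by auto
    have "\<exists>\<phi>1. bij_betw \<phi>1 (P.peel v) (Q.peel v') \<and> (\<forall>x\<in>B - {v}. \<phi>1 x = \<phi> x) \<and>
       (\<forall>x\<in>P.peel v. \<forall>y\<in>P.peel v. d' (\<phi>1 x) (\<phi>1 y) = d x y)"
    proof (cases "\<exists>a\<in>V. \<exists>b\<in>V. a \<noteq> b \<and> d v a = 1 \<and> d v b = 1")
      case True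
      then obtain a b where ab: "a \<in> V" "b \<in> V" "a \<noteq> b" "d v a = 1" "d v b = 1" by auto
      have abB: "a \<in> B" "b \<in> B" using NB ab by auto
      have ab': "\<phi> a \<in> V'" "\<phi> b \<in> V'" "\<phi> a \<noteq> \<phi> b" "d' v' (\<phi> a) = 1" "d' v' (\<phi> b) = 1"
        using \<phi>B abB Q.BV injB ab dB v unfolding v'_def by auto
      obtain w where w: "w \<in> V" "w \<noteq> v" "d a w = 1" "d b w = 1"
        using P.nbr_square[OF u vV far ab] by metis
      obtain w' where w': "w' \<in> V'" "w' \<noteq> v'" "d' (\<phi> a) w' = 1" "d' (\<phi> b) w' = 1"
        using Q.nbr_square[OF u'V v'V far' ab'] by metis
      have wW: "w \<in> W" unfolding W_def P.opposite_def using ab w by blast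
      have wW': "w' \<in> W'" unfolding W'_def Q.opposite_def using ab' w' by blast
      have uq: "x = w" if "x \<in> V" "x \<noteq> v" "d a x = 1" "d b x = 1" for x
        using P.opposite_unique(3)[OF u vV far _ ab, of w x] wW that unfolding W_def by blast
      have uq': "x = w'" if "x \<in> V'" "x \<noteq> v'" "d' (\<phi> a) x = 1" "d' (\<phi> b) x = 1" for x
        using Q.opposite_unique(3)[OF u'V v'V far' _ ab', of w' x] wW' that unfolding W'_def by blast
      have Weq: "W = {w}"
        using P.opposite_unique(1,2)[OF u vV far _ ab] W_sub uq wW unfolding W_def by blast
      have W'eq: "W' = {w'}"
        using Q.opposite_unique(1,2)[OF u'V v'V far' _ ab'] W'_sub uq' wW' unfolding W'_def by blast
      \<comment> \<open>The opposite vertex may already be a boundary vertex. Its distances to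
        \<open>a\<close> and \<open>b\<close> then force its image to be \<open>w'\<close>, so the
        update in \<open>\<phi>1\<close> changes nothing on \<open>B\<close>.\<close>
      have wB: "\<phi> w = w'" if "w \<in> B"
        using uq'[of "\<phi> w"] that \<phi>B Q.BV injB v dB abB w unfolding v'_def by auto
      have wB2: "w \<in> B" if wB': "w' \<in> B'"
      proof -
        obtain x where x: "x \<in> B" "\<phi> x = w'" using surB wB' by blast
        have "x \<noteq> v" using x w'(2) unfolding v'_def by metis
        moreover have "d a x = 1" using dB[OF abB(1) x(1)] w'(3) unfolding x(2) by simp
        moreover have "d b x = 1" using dB[OF abB(2) x(1)] w'(4) unfolding x(2) by simp
        ultimately have "x = w" using uq[of x] x(1) P.BV by blast
        then show ?thesis using x by simp
      qed
      define \<phi>1 where "\<phi>1 = \<phi>(w := w')"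
      have \<phi>1: "\<phi>1 x = \<phi> x" if "x \<in> B" for x using that wB by (auto simp: \<phi>1_def)
      have \<phi>1w: "\<phi>1 w = w'" by (simp add: \<phi>1_def)
      have pe: "P.peel v = insert w (B - {v})" "Q.peel v' = insert w' (B' - {v'})"
        using Weq W'eq unfolding P.peel_def Q.peel_def W_def W'_def by auto
      have "inj_on \<phi>1 (insert w (B - {v}))"
      proof (rule inj_onI)
        fix x y assume xy: "x \<in> insert w (B - {v})" "y \<in> insert w (B - {v})" "\<phi>1 x = \<phi>1 y"
        show "x = y"
        proof (cases "w \<in> B")
          case True then show ?thesis using xy \<phi>1 injB by auto
        next
          case False
          then have "w' \<notin> B'" using wB2 by blast
          then show ?thesis using xy \<phi>1 \<phi>1w injB \<phi>B by (metis Diff_iff insert_iff)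
        qed
      qed
      moreover have "\<phi>1 ` insert w (B - {v}) = insert w' (B' - {v'})"
      proof -
        have "\<phi>1 ` (B - {v}) = \<phi> ` (B - {v})" using \<phi>1 by auto
        also have "\<dots> = \<phi> ` B - {v'}" using injB v unfolding v'_def by blast
        also have "\<phi> ` B = B'" using less.prems(4) unfolding bij_betw_def by blast
        finally show ?thesis using \<phi>1w by simp
      qed
      moreover have "d' (\<phi>1 x) (\<phi>1 y) = d x y" if xy: "x \<in> insert w (B - {v})" "y \<in> insert w (B - {v})" for x y
      proof -
        \<comment> \<open>\<open>dist_opposite\<close>, used in both graphs, expresses the distances
          to \<open>w\<close> and to \<open>w'\<close> by the same boundary distances.\<close>
        have A: "d' (\<phi> x) w' = d x w" if x: "x \<in> B - {v}" for x
        proof -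
          have xV: "x \<in> V" "x \<noteq> v" using x P.BV by auto
          have x'V: "\<phi> x \<in> V'" "\<phi> x \<noteq> v'" using x \<phi>B Q.BV injB v unfolding v'_def by auto
          have "d x w + d x v = d x a + d x b"
            using P.dist_opposite[OF u vV far _ ab xV] wW unfolding W_def by blast
          moreover have "d' (\<phi> x) w' + d' (\<phi> x) v' = d' (\<phi> x) (\<phi> a) + d' (\<phi> x) (\<phi> b)"
            using Q.dist_opposite[OF u'V v'V far' _ ab' x'V] wW' unfolding W'_def by blast
          ultimately show ?thesis using dB x v abB unfolding v'_def by auto
        qed
        have A': "d' w' (\<phi> x) = d w x" if x: "x \<in> B - {v}" for x
        proof -
          have "x \<in> V" "\<phi> x \<in> V'" using x P.BV Q.BV \<phi>B by auto
          then show ?thesis using A[OF x] P.sym[of x w] Q.sym[of "\<phi> x" w'] w(1) w'(1) by simp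
        qed
        show ?thesis
          using xy A A' \<phi>1 \<phi>1w dB P.zero[of w w] Q.zero[of w' w'] w w' by auto
      qed
      ultimately show ?thesis unfolding pe bij_betw_def using \<phi>1 by (intro exI[of _ \<phi>1]) auto
    next
      case False
      \<comment> \<open>With at most one neighbour of \<open>v\<close> there is no square to open
        and no vertex to expose; the same then holds for \<open>v'\<close>.\<close>
      have "W = {}" using False unfolding W_def P.opposite_def by blast
      moreover have "W' = {}"
      proof -
        have False if ab: "a \<in> V'" "b \<in> V'" "a \<noteq> b" "d' v' a = 1" "d' v' b = 1" for a b
        proof -
          obtain x where x: "x \<in> B" "\<phi> x = a" using surB[OF NB'[OF ab(1,4)]] by blast
          obtain y where y: "y \<in> B" "\<phi> y = b" using surB[OF NB'[OF ab(2,5)]] by blast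
          have "d v x = 1" "d v y = 1"
            using dB[OF v(1) x(1)] dB[OF v(1) y(1)] ab x y unfolding v'_def by simp_all
          moreover have "x \<noteq> y" using ab x y by blast
          ultimately show False using False x y P.BV by blast
        qed
        then show ?thesis unfolding W'_def Q.opposite_def by blast
      qed
      ultimately have pe: "P.peel v = B - {v}" "Q.peel v' = B' - {v'}"
        unfolding W_def W'_def P.peel_def Q.peel_def by auto
      have "bij_betw \<phi> (B - {v}) (B' - {v'})"
        unfolding v'_def by (rule bij_betw_DiffI) (use less.prems(4) v in \<open>auto simp: bij_betw_def\<close>)
      then show ?thesis unfolding pe using dB by auto
    qed
    then obtain \<phi>1 where \<phi>1: "bij_betw \<phi>1 (P.peel v) (Q.peel v')" "\<And>x. x \<in> B - {v} \<Longrightarrow> \<phi>1 x = \<phi> x"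
       "\<And>x y. x \<in> P.peel v \<Longrightarrow> y \<in> P.peel v \<Longrightarrow> d' (\<phi>1 x) (\<phi>1 y) = d x y" by blast
    have "card (V - {v}) < card V" using P.fin vV by (meson card_Diff1_less)
    moreover have "u \<in> P.peel v" using uB False by (auto simp: P.peel_def)
    ultimately obtain \<psi> where \<psi>: "bij_betw \<psi> (V - {v}) (V' - {v'})" "\<forall>x\<in>P.peel v. \<psi> x = \<phi>1 x"
      "\<forall>x\<in>V - {v}. \<forall>y\<in>V - {v}. d' (\<psi> x) (\<psi> y) = 1 \<longleftrightarrow> d x y = 1"
      using less.hyps[OF _ P.peel_peelable[OF u vV far] Q.peel_peelable[OF u'V v'V far'] _ \<phi>1(1)] \<phi>1(3)
      by blast
    have \<psi>B: "\<psi> x = \<phi> x" if "x \<in> B - {v}" for x using that \<psi>(2) \<phi>1(2) by (auto simp: P.peel_def)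
    define \<theta> where "\<theta> = \<psi>(v := v')"
    have \<psi>V: "\<psi> x \<in> V' - {v'}" if "x \<in> V - {v}" for x using that \<psi>(1) bij_betwE by blast
    \<comment> \<open>All neighbours of \<open>v\<close> and of \<open>v'\<close> are boundary
      vertices, where \<open>\<psi>\<close> agrees with \<open>\<phi>\<close> and distances are
      preserved.\<close>
    have key: "d' v' (\<psi> x) = 1 \<longleftrightarrow> d v x = 1" if x: "x \<in> V - {v}" for x
    proof
      assume "d v x = 1"
      then have "x \<in> B - {v}" using NB x by auto
      then show "d' v' (\<psi> x) = 1" using \<psi>B dB v \<open>d v x = 1\<close> unfolding v'_def by auto
    next
      assume a: "d' v' (\<psi> x) = 1"
      then have "\<psi> x \<in> B'" using NB' \<psi>V x by auto
      then obtain y where y: "y \<in> B" "\<phi> y = \<psi> x" using surB by metis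
      have "y \<noteq> v" using y \<psi>V[OF x] unfolding v'_def by auto
      then have "\<psi> y = \<psi> x" "y \<in> V - {v}" using \<psi>B y P.BV by auto
      then have "x = y" using \<psi>(1) x unfolding bij_betw_def inj_on_def by blast
      then show "d v x = 1" using a y dB v unfolding v'_def by metis
    qed
    have "bij_betw \<theta> (insert v (V - {v})) (insert v' (V' - {v'}))"
    proof -
      have "bij_betw \<theta> (V - {v}) (V' - {v'})"
        using \<psi>(1) by (rule bij_betw_cong[THEN iffD1, rotated]) (auto simp: \<theta>_def)
      moreover have "\<theta> v = v'" by (simp add: \<theta>_def)
      ultimately show ?thesis
        using notIn_Un_bij_betw[of v "V - {v}" \<theta> "V' - {v'}"] by simp
    qed
    then have "bij_betw \<theta> V V'" using vV v'V by (simp add: insert_absorb)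
    moreover have "\<forall>x\<in>B. \<theta> x = \<phi> x" using \<psi>B by (auto simp: \<theta>_def v'_def)
    moreover have "\<forall>x\<in>V. \<forall>y\<in>V. d' (\<theta> x) (\<theta> y) = 1 \<longleftrightarrow> d x y = 1"
    proof (intro ballI)
      fix x y assume xy: "x \<in> V" "y \<in> V"
      show "d' (\<theta> x) (\<theta> y) = 1 \<longleftrightarrow> d x y = 1"
      proof (cases "x = v"; cases "y = v")
        assume "x = v" "y = v"
        then show ?thesis using P.zero[OF vV vV] Q.zero[OF v'V v'V] by (simp add: \<theta>_def)
      next
        assume "x = v" "y \<noteq> v"
        then show ?thesis using key[of y] xy by (simp add: \<theta>_def)
      next
        assume a: "x \<noteq> v" "y = v"
        then show ?thesis using key[of x] xy vN[of x] \<psi>V[of x] Q.sym[of "\<psi> x" v'] v'V by (simp add: \<theta>_def)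
      next
        assume "x \<noteq> v" "y \<noteq> v"
        then show ?thesis using \<psi>(3) xy by (simp add: \<theta>_def)
      qed
    qed
    ultimately show ?thesis by blast
  qed
qed

section \<open>Cycles of a plane graph and their discs\<close>

text \<open>The inverse of the parametrisation would embed a nonempty open set of the plane into the
  line, against invariance of dimension.\<close>

lemma interior_arc_image_empty:
  fixes g :: "real \<Rightarrow> complex"
  assumes "arc g"
  shows "interior (path_image g) = {}"
proof (rule ccontr)
  assume ne: "interior (path_image g) \<noteq> {}"
  obtain h where h: "homeomorphism {0..1} (path_image g) g h"
    using homeomorphism_arc assms by blast
  have "continuous_on (path_image g) h" "inj_on h (path_image g)"
    using h unfolding homeomorphism_def by (auto intro: inj_on_inverseI)
  then have "continuous_on (interior (path_image g)) h" "inj_on h (interior (path_image g))"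
    using continuous_on_subset[OF _ interior_subset] inj_on_subset[OF _ interior_subset] by auto
  then have "DIM(complex) \<le> DIM(real)"
    using invariance_of_dimension[of "interior (path_image g)" h] ne by simp
  then show False by simp
qed

lemma interior_Union_closed_empty:
  assumes "finite \<A>" "\<And>A. A \<in> \<A> \<Longrightarrow> closed A" "\<And>A. A \<in> \<A> \<Longrightarrow> interior A = {}"
  shows "interior (\<Union>\<A>) = {}"
  using assms
proof (induction \<A>)
  case (insert A \<A>)
  then have "interior (A \<union> \<Union>\<A>) = interior A"
    by (intro interior_closed_Un_empty_interior) auto
  then show ?case using insert by simp
qed simp

lemma connected_subset_inside_or_outside:
  assumes "connected F" "F \<inter> J = {}"
  shows "F \<subseteq> inside J \<or> F \<subseteq> outside J"
proof -
  have *: "inside J \<union> outside J = - J" "inside J \<inter> outside J = {}"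
    by (auto simp: inside_Un_outside inside_Int_outside)
  show ?thesis
  proof (rule ccontr)
    assume n: "\<not> ?thesis"
    then obtain x y where xy: "x \<in> F" "x \<notin> inside J" "y \<in> F" "y \<notin> outside J" by blast
    then have "x \<in> outside J" "y \<in> inside J" using * assms by blast+
    moreover have "connected_component (- J) x y"
      using assms xy by (intro connected_componentI[OF assms(1)]) auto
    ultimately have "x \<in> inside J" 
      by (metis connected_component_sym inside_same_component)
    then show False using xy by simp
  qed
qed

lemma successively_append_snoc:
  "successively R (xs @ y # ys) \<longleftrightarrow> successively R (xs @ [y]) \<and> successively R (y # ys)"
  by (induction xs rule: induct_list012) auto

section \<open>Edges of a plane graph as arcs\<close>

locale plane =
  fixes G :: plane_graph
  assumes pg: "is_plane_graph G"
begin

abbreviation "VG \<equiv> verts G"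
abbreviation "EG \<equiv> edges G"

text \<open>The open edge: since an edge contains no vertices besides its ends, removing all
  vertices removes exactly the two end points.\<close>

definition eint :: "complex set \<Rightarrow> complex set" where
  "eint e = e - VG"

lemma finite_V: "finite VG" and finite_E: "finite EG"
  using pg by (auto simp: is_plane_graph_def)

lemma edge_arc:
  assumes "e \<in> EG"
  obtains g where "arc g" "path_image g = e" "ends G e = {pathstart g, pathfinish g}"
proof -
  have "\<forall>e\<in>EG. \<exists>g. arc g \<and> path_image g = e \<and> ends G e = {pathstart g, pathfinish g}"
    using pg unfolding is_plane_graph_def by (elim conjE)
  from bspec[OF this assms] show ?thesis using that by (elim exE conjE)
qed

lemma edge_ends:
  assumes "e \<in> EG"
  obtains u v where "u \<in> VG" "v \<in> VG" "u \<noteq> v" "ends G e = {u, v}"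
proof -
  obtain g where g: "arc g" "path_image g = e" "ends G e = {pathstart g, pathfinish g}"
    using edge_arc assms by blast
  moreover have "ends G e \<subseteq> VG" by (auto simp: ends_def)
  ultimately show ?thesis using that arc_distinct_ends[of g] by auto
qed

lemma edge_compact: "e \<in> EG \<Longrightarrow> compact e"
  by (metis edge_arc compact_arc_image)

lemma edge_closed: "e \<in> EG \<Longrightarrow> closed e"
  using edge_compact compact_imp_closed by blast

lemma edge_interior: "e \<in> EG \<Longrightarrow> interior e = {}"
  by (metis edge_arc interior_arc_image_empty)

text \<open>The open edge is the image of the open unit interval. Its connectedness keeps it on one
  side of a cycle, and its closure gives back the edge, so containment in a closed set can be tested
  on it.\<close>

lemma eint_props:
  assumes "e \<in> EG"
  shows "connected (eint e)" "eint e \<noteq> {}" "closure (eint e) = e"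
proof -
  obtain g where g: "arc g" "path_image g = e" "ends G e = {pathstart g, pathfinish g}"
    using edge_arc assms by blast
  have inj: "inj_on g {0..1}" and cont: "continuous_on {0..1} g"
    using g(1) by (auto simp: arc_def path_def)
  have "eint e = e - ends G e" by (auto simp: eint_def ends_def)
  also have "\<dots> = g ` {0..1} - g ` {0, 1}"
    using g by (auto simp: path_image_def pathstart_def pathfinish_def)
  also have "\<dots> = g ` ({0..1} - {0, 1})"
    by (rule inj_on_image_set_diff[OF inj, symmetric]) auto
  also have "{0..1} - {0, 1} = {0<..<1::real}" by auto
  finally have eq: "eint e = g ` {0<..<1}" .
  have "{0<..<1} \<subseteq> {0..1::real}" by auto
  note cont' = continuous_on_subset[OF cont this]
  show "connected (eint e)" unfolding eq
    by (rule connected_continuous_image[OF cont']) simp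
  show "eint e \<noteq> {}" unfolding eq by (simp add: image_is_empty)
  have "g ` closure {0<..<1} \<subseteq> closure (g ` {0<..<1})"
  proof (rule image_closure_subset)
    show "continuous_on (closure {0<..<1}) g" using cont by simp
  qed (simp_all add: closure_subset)
  then have "e \<subseteq> closure (eint e)"
    using g(2) unfolding eq by (simp add: path_image_def)
  moreover have "closure (eint e) \<subseteq> e"
    by (rule closure_minimal) (use assms edge_closed in \<open>auto simp: eint_def\<close>)
  ultimately show "closure (eint e) = e" by blast
qed

lemma eint_sub: "eint e \<subseteq> e" by (auto simp: eint_def)

lemma edge_Int: "e \<in> EG \<Longrightarrow> e' \<in> EG \<Longrightarrow> e \<noteq> e' \<Longrightarrow> e \<inter> e' \<subseteq> VG"
proof -
  have "\<forall>e\<in>EG. \<forall>e'\<in>EG. e \<noteq> e' \<longrightarrow> e \<inter> e' \<subseteq> VG"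
    using pg unfolding is_plane_graph_def by (elim conjE)
  then show "e \<in> EG \<Longrightarrow> e' \<in> EG \<Longrightarrow> e \<noteq> e' \<Longrightarrow> e \<inter> e' \<subseteq> VG" by blast
qed

lemma eint_unique: "e \<in> EG \<Longrightarrow> e' \<in> EG \<Longrightarrow> x \<in> eint e \<Longrightarrow> x \<in> e' \<Longrightarrow> e = e'"
  using edge_Int unfolding eint_def by blast

lemma ends_iff: "x \<in> ends G e \<longleftrightarrow> x \<in> e \<and> x \<in> VG" by (auto simp: ends_def)

lemma ends_inj: "e \<in> EG \<Longrightarrow> e' \<in> EG \<Longrightarrow> ends G e = ends G e' \<Longrightarrow> e = e'"
proof -
  have "\<forall>e\<in>EG. \<forall>e'\<in>EG. ends G e = ends G e' \<longrightarrow> e = e'"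
    using pg unfolding is_plane_graph_def by (elim conjE)
  then show "e \<in> EG \<Longrightarrow> e' \<in> EG \<Longrightarrow> ends G e = ends G e' \<Longrightarrow> e = e'" by blast
qed

lemma eint_sub_Union: "e \<in> EG \<Longrightarrow> C \<subseteq> EG \<Longrightarrow> x \<in> eint e \<Longrightarrow> x \<in> \<Union>C \<Longrightarrow> e \<in> C"
  using eint_unique by blast

lemma Union_Int_verts: "C \<subseteq> EG \<Longrightarrow> D \<subseteq> EG \<Longrightarrow> C \<inter> D = {} \<Longrightarrow> \<Union>C \<inter> \<Union>D \<subseteq> VG"
  using edge_Int by blast

lemma Union_closed: "C \<subseteq> EG \<Longrightarrow> closed (\<Union>C)"
  using finite_subset[OF _ finite_E] edge_closed by (intro closed_Union) auto

lemma adj_sym: "adj G u v \<Longrightarrow> adj G v u"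
  by (auto simp: adj_def insert_commute)

lemma adj_ne: "adj G u v \<Longrightarrow> u \<noteq> v \<and> u \<in> VG \<and> v \<in> VG"
proof -
  assume "adj G u v"
  then obtain e where e: "e \<in> EG" "ends G e = {u, v}" by (auto simp: adj_def)
  obtain x y where xy: "x \<in> VG" "y \<in> VG" "x \<noteq> y" "ends G e = {x, y}" using edge_ends[OF e(1)] .
  then have "{u, v} = {x, y}" using e by simp
  then show ?thesis using xy(1-3) by (auto simp: doubleton_eq_iff)
qed

definition edg :: "complex \<Rightarrow> complex \<Rightarrow> complex set" where
  "edg u v = (THE e. e \<in> EG \<and> ends G e = {u, v})"

lemma edg_eq: "e \<in> EG \<Longrightarrow> ends G e = {u, v} \<Longrightarrow> edg u v = e"
  unfolding edg_def by (rule the_equality) (use ends_inj in auto)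

lemma edg: "adj G u v \<Longrightarrow> edg u v \<in> EG \<and> ends G (edg u v) = {u, v}"
  unfolding adj_def using edg_eq by blast

lemma edg_sym: "edg u v = edg v u"
  by (simp add: edg_def insert_commute)

lemma edg_inject: "adj G u v \<Longrightarrow> adj G x y \<Longrightarrow> edg u v = edg x y \<longleftrightarrow> {u, v} = {x, y}"
  using edg edg_eq by metis

lemma edge_edg:
  assumes "e \<in> EG"
  obtains u v where "adj G u v" "e = edg u v"
  using edge_ends[OF assms] edg_eq[OF assms] assms unfolding adj_def by metis

lemma edge_edg_at:
  assumes "e \<in> EG" "x \<in> e" "x \<in> VG"
  obtains y where "adj G x y" "e = edg x y"
proof -
  obtain u v where uv: "adj G u v" "e = edg u v" using edge_edg assms by blast
  then have "x \<in> {u, v}" using edg[of u v] assms ends_iff by blast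
  then show ?thesis using that uv adj_sym edg_sym by (cases "x = u") auto
qed

section \<open>Paths and cycles as sets of edges\<close>

fun pedges :: "complex list \<Rightarrow> complex set set" where
  "pedges (u # v # r) = insert (edg u v) (pedges (v # r))"
| "pedges _ = {}"

lemma pedges_append: "pedges (xs @ y # ys) = pedges (xs @ [y]) \<union> pedges (y # ys)"
  by (induction xs rule: pedges.induct) auto

lemma pedges_rev: "pedges (rev xs) = pedges xs"
proof (induction xs rule: pedges.induct)
  case (1 u v r)
  have "pedges (rev (u # v # r)) = pedges (rev r @ v # [u])" by simp
  also have "\<dots> = pedges (rev r @ [v]) \<union> pedges (v # [u])" by (rule pedges_append)
  finally show ?case using 1 edg_sym by auto
qed auto

definition gpath :: "complex \<Rightarrow> complex \<Rightarrow> complex list \<Rightarrow> bool" where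
  "gpath p q P \<longleftrightarrow> P \<noteq> [] \<and> hd P = p \<and> last P = q \<and> distinct P \<and> set P \<subseteq> VG \<and> successively (adj G) P"

lemma gpath_rev: "gpath p q P \<Longrightarrow> gpath q p (rev P)"
  using adj_sym unfolding gpath_def
  by (auto simp: hd_rev last_rev successively_rev intro: successively_mono)

lemma pedges_props:
  "successively (adj G) P \<Longrightarrow> e \<in> pedges P \<Longrightarrow> e \<in> EG \<and> ends G e \<subseteq> set P"
proof (induction P rule: pedges.induct)
  case (1 u v r)
  then show ?case using edg[of u v] by auto
qed auto

lemma pedges_sub: "successively (adj G) P \<Longrightarrow> pedges P \<subseteq> EG"
  using pedges_props by blast

lemma gpath_sub: "gpath p q P \<Longrightarrow> pedges P \<subseteq> EG"
  using pedges_sub by (simp add: gpath_def)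

lemma pedges_cover:
  "successively (adj G) P \<Longrightarrow> length P \<ge> 2 \<Longrightarrow> x \<in> set P \<Longrightarrow> \<exists>e\<in>pedges P. x \<in> ends G e"
proof (induction P rule: pedges.induct)
  case (1 u v r)
  show ?case
  proof (cases "x = u \<or> x = v")
    case True
    then show ?thesis using edg[of u v] 1 by auto
  next
    case False
    then have "r \<noteq> []" "x \<in> set (v # r)" using 1 by auto
    then show ?thesis using 1 by (cases r) auto
  qed
qed auto

lemma gpath_len: "gpath p q P \<Longrightarrow> p \<noteq> q \<Longrightarrow> length P \<ge> 2"
  unfolding gpath_def by (cases P; cases "tl P") auto

lemma gpath_verts:
  assumes "gpath p q P" "p \<noteq> q"
  shows "VG \<inter> \<Union>(pedges P) = set P"
proof -
  have s: "successively (adj G) P" "set P \<subseteq> VG" using assms by (auto simp: gpath_def)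
  show ?thesis
  proof (intro equalityI subsetI)
    fix x assume "x \<in> VG \<inter> \<Union>(pedges P)"
    then show "x \<in> set P" using pedges_props[OF s(1)] ends_iff by blast
  next
    fix x assume "x \<in> set P"
    then show "x \<in> VG \<inter> \<Union>(pedges P)"
      using pedges_cover[OF s(1) gpath_len[OF assms]] ends_iff by blast
  qed
qed

lemma edg_arc:
  assumes "adj G u v"
  obtains g where "arc g" "pathstart g = u" "pathfinish g = v" "path_image g = edg u v"
proof -
  obtain g where g: "arc g" "path_image g = edg u v" "{u, v} = {pathstart g, pathfinish g}"
    using edge_arc edg[OF assms] by metis
  then consider "pathstart g = u" "pathfinish g = v" | "pathstart g = v" "pathfinish g = u"
    by (auto simp: doubleton_eq_iff)
  then show ?thesis
    using that[of g] that[of "reversepath g"] g by cases (auto simp: arc_reversepath)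
qed

text \<open>The arcs of the edges are joined one after the other. A point common to the first edge
  and the rest of the path is an end of both, and as \<open>u\<close> does not recur it can only be
  \<open>v\<close>.\<close>

lemma gpath_arc:
  "gpath p q P \<Longrightarrow> p \<noteq> q \<Longrightarrow>
    \<exists>g. arc g \<and> pathstart g = p \<and> pathfinish g = q \<and> path_image g = \<Union>(pedges P)"
proof (induction P arbitrary: p rule: pedges.induct)
  case (1 u v r)
  then have uv: "adj G u v" "p = u" by (auto simp: gpath_def)
  obtain g where g: "arc g" "pathstart g = u" "pathfinish g = v" "path_image g = edg u v"
    using edg_arc uv by blast
  show ?case
  proof (cases "r = []")
    case True
    then show ?thesis using g uv 1 by (auto simp: gpath_def)
  next
    case False
    then have q: "v \<noteq> q" using 1(2) by (auto simp: gpath_def)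
    have gpr: "gpath v q (v # r)" using 1(2) False by (auto simp: gpath_def)
    then obtain h where h: "arc h" "pathstart h = v" "pathfinish h = q" "path_image h = \<Union>(pedges (v # r))"
      using 1(1) q by blast
    have "path_image g \<inter> path_image h \<subseteq> {v}"
    proof
      fix y assume y: "y \<in> path_image g \<inter> path_image h"
      then obtain e where e: "e \<in> pedges (v # r)" "y \<in> e" using h by auto
      have ee: "e \<in> EG" "ends G e \<subseteq> set (v # r)"
        using pedges_props[OF _ e(1)] gpr by (auto simp: gpath_def)
      have u: "u \<notin> set (v # r)" using 1(2) by (auto simp: gpath_def)
      then have "e \<noteq> edg u v" using ee edg[OF uv(1)] by auto
      then have "y \<in> VG" using edge_Int[of e "edg u v"] ee edg[OF uv(1)] y e g by auto
      then have "y \<in> ends G e" "y \<in> ends G (edg u v)" using ends_iff e y g by auto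
      then show "y \<in> {v}" using ee u edg[OF uv(1)] by auto
    qed
    then have "arc (g +++ h)" using g h by (intro arc_join) auto
    then show ?thesis using g h uv by (intro exI[of _ "g +++ h"]) (auto simp: path_image_join)
  qed
qed (auto simp: gpath_def)

text \<open>A cycle displayed as two paths between two of its vertices, the form that a theta curve
  requires. Disjointness of the edge sets excludes the degenerate case in which both paths are the
  single edge from \<open>p\<close> to \<open>q\<close>.\<close>

definition bigon :: "complex \<Rightarrow> complex \<Rightarrow> complex list \<Rightarrow> complex list \<Rightarrow> bool" where
  "bigon p q P Q \<longleftrightarrow> gpath p q P \<and> gpath p q Q \<and> p \<noteq> q \<and> set P \<inter> set Q = {p, q} \<and> pedges P \<inter> pedges Q = {}"

lemma bigon_sym: "bigon p q P Q \<Longrightarrow> bigon p q Q P"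
  by (auto simp: bigon_def)

lemma bigon_Int: 
  assumes "bigon p q P Q"
  shows "\<Union>(pedges P) \<inter> \<Union>(pedges Q) = {p, q}"
proof -
  have b: "gpath p q P" "gpath p q Q" "p \<noteq> q" "set P \<inter> set Q = {p, q}" "pedges P \<inter> pedges Q = {}"
    using assms by (auto simp: bigon_def)
  have "\<Union>(pedges P) \<inter> \<Union>(pedges Q) \<subseteq> VG"
    by (rule Union_Int_verts[OF gpath_sub[OF b(1)] gpath_sub[OF b(2)] b(5)])
  then show ?thesis using gpath_verts[OF b(1,3)] gpath_verts[OF b(2,3)] b(4) by blast
qed

text \<open>A cycle is kept as a set of edges, so that the choice of starting point and direction of
  a vertex list disappears.\<close>

definition cyc :: "complex set set \<Rightarrow> bool" where
  "cyc C \<longleftrightarrow> (\<exists>L. distinct L \<and> length L \<ge> 3 \<and> set L \<subseteq> VG \<and> successively (adj G) (L @ [hd L]) \<and>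
     C = pedges (L @ [hd L]))"

text \<open>The start \<open>p\<close> lies on the first edge only, so the edge from
  \<open>p\<close> to \<open>q\<close> must be that first edge, and with it the path has already
  arrived at its last vertex.\<close>

lemma pedges_hd_last:
  assumes "gpath p q P" "edg p q \<in> pedges P" "adj G p q"
  shows "P = [p, q]"
proof -
  obtain v r where P: "P = p # v # r"
    using assms by (auto simp: gpath_def neq_Nil_conv) (metis adj_ne gpath_len assms(1) assms(3) hd_Cons_tl length_0_conv list.size(3) not_numeral_le_zero pedges.simps(2) empty_iff pedges.simps(3) list.exhaust)
  have av: "adj G p v" using assms P by (auto simp: gpath_def)
  have "edg p q \<notin> pedges (v # r)"
  proof
    assume "edg p q \<in> pedges (v # r)"
    then have "ends G (edg p q) \<subseteq> set (v # r)"
      using pedges_props[of "v # r"] assms P by (auto simp: gpath_def)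
    then show False using edg[OF assms(3)] assms P by (auto simp: gpath_def)
  qed
  then have "edg p q = edg p v" using assms P by auto
  then have "v = q" using edg_inject[OF assms(3) av] by (auto simp: doubleton_eq_iff)
  then show ?thesis using assms P by (cases r) (auto simp: gpath_def split: if_splits)
qed

lemma bigonI:
  assumes "gpath p q P" "gpath p q Q" "p \<noteq> q" "set P \<inter> set Q = {p, q}" "length P + length Q \<ge> 5"
  shows "bigon p q P Q"
proof -
  have "pedges P \<inter> pedges Q = {}"
  proof (rule ccontr)
    assume "\<not> ?thesis"
    then obtain e where e: "e \<in> pedges P" "e \<in> pedges Q" by blast
    then have *: "e \<in> EG" "ends G e \<subseteq> {p, q}"
      using pedges_props[of P e] pedges_props[of Q e] assms by (auto simp: gpath_def)
    obtain u v where uv: "u \<noteq> v" "ends G e = {u, v}" using edge_ends[OF *(1)] .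
    then have "ends G e = {p, q}" using *(2) by auto
    then have "e = edg p q" "adj G p q" using edg_eq * unfolding adj_def by auto
    then have "P = [p, q]" "Q = [p, q]"
      using pedges_hd_last[OF assms(1)] pedges_hd_last[OF assms(2)] e by auto
    then show False using assms by simp
  qed
  then show ?thesis using assms by (simp add: bigon_def)
qed

lemma bigon_len: "bigon p q P Q \<Longrightarrow> length P + length Q \<ge> 5"
proof (rule ccontr)
  assume b: "bigon p q P Q" and "\<not> 5 \<le> length P + length Q"
  then have "length P = 2" "length Q = 2"
    using gpath_len[of p q P] gpath_len[of p q Q] by (auto simp: bigon_def)
  then have "P = [p, q]" "Q = [p, q]" using b
    by (auto simp: bigon_def gpath_def length_Suc_conv numeral_2_eq_2)
  then show False using b by (auto simp: bigon_def)
qed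

lemma bigon_shape:
  assumes "gpath p q P" "p \<noteq> q"
  obtains X where "P = p # X @ [q]"
proof -
  obtain r where r: "P = p # r" "r \<noteq> []" using assms by (cases P) (auto simp: gpath_def split: if_splits)
  then have "r = butlast r @ [q]" using assms by (metis append_butlast_last_id gpath_def last_ConsR)
  then show ?thesis using that r by auto
qed

lemma bigon_cyc:
  assumes "bigon p q P Q"
  shows "cyc (pedges P \<union> pedges Q)"
proof -
  have b: "gpath p q P" "gpath p q Q" "p \<noteq> q" "set P \<inter> set Q = {p, q}"
    using assms by (auto simp: bigon_def)
  obtain X where X: "P = p # X @ [q]" using bigon_shape b by blast
  obtain Y where Y: "Q = p # Y @ [q]" using bigon_shape b by blast
  define L where "L = p # X @ q # rev Y"
  have rQ: "rev Q = q # rev Y @ [p]" using Y by simp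
  have LL: "L @ [hd L] = (p # X) @ q # (rev Y @ [p])" by (simp add: L_def)
  have "length L \<ge> 3" using bigon_len[OF assms] X Y by (simp add: L_def)
  moreover have "distinct L" "set L \<subseteq> VG" using b X Y by (auto simp: L_def gpath_def)
  moreover have "successively (adj G) (L @ [hd L])"
  proof -
    have "successively (adj G) ((p # X) @ [q])" using b(1) unfolding X gpath_def by simp
    moreover have "successively (adj G) (q # (rev Y @ [p]))"
      using gpath_rev[OF b(2)] unfolding rQ gpath_def by simp
    ultimately show ?thesis unfolding LL successively_append_snoc[of _ "p # X" q "rev Y @ [p]"] by (rule conjI)
  qed
  moreover have "pedges (L @ [hd L]) = pedges P \<union> pedges Q"
    unfolding LL pedges_append[of "p # X" q "rev Y @ [p]"] using X rQ pedges_rev[of Q] by simp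
  ultimately show ?thesis unfolding cyc_def by (intro exI[of _ L]) auto
qed

lemma cyc_sub: "cyc C \<Longrightarrow> C \<subseteq> EG"
  unfolding cyc_def using pedges_sub by auto

lemma cyc_list_verts:
  assumes "distinct L" "length L \<ge> 3" "set L \<subseteq> VG" "successively (adj G) (L @ [hd L])"
  shows "VG \<inter> \<Union>(pedges (L @ [hd L])) = set L"
proof -
  have hd: "hd L \<in> set L" using assms by (cases L) auto
  have l: "length (L @ [hd L]) \<ge> 2" using assms by simp
  show ?thesis
  proof (intro equalityI subsetI)
    fix x assume "x \<in> VG \<inter> \<Union>(pedges (L @ [hd L]))"
    then obtain e where e: "e \<in> pedges (L @ [hd L])" "x \<in> ends G e" using ends_iff by blast
    then have "x \<in> set (L @ [hd L])" using pedges_props[OF assms(4) e(1)] by blast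
    then show "x \<in> set L" using hd by auto
  next
    fix x assume "x \<in> set L"
    then show "x \<in> VG \<inter> \<Union>(pedges (L @ [hd L]))"
      using pedges_cover[OF assms(4) l, of x] ends_iff by auto
  qed
qed

text \<open>The closed list is rotated to start at \<open>p\<close> and cut at \<open>q\<close>; its
  second half is read backwards.\<close>

lemma cyc_split:
  assumes "cyc C" "p \<in> VG" "q \<in> VG" "p \<in> \<Union>C" "q \<in> \<Union>C" "p \<noteq> q"
  obtains P Q where "bigon p q P Q" "C = pedges P \<union> pedges Q"
proof -
  obtain L where L: "distinct L" "length L \<ge> 3" "set L \<subseteq> VG" "successively (adj G) (L @ [hd L])"
     and C: "C = pedges (L @ [hd L])" using assms(1) by (auto simp: cyc_def)
  have "p \<in> set L" "q \<in> set L" using cyc_list_verts[OF L] assms C by auto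
  then obtain A B where AB: "L = A @ p # B" by (meson split_list)
  have "C = pedges (p # B @ A @ [p]) \<and> successively (adj G) (p # B @ A @ [p])"
  proof (cases A)
    case Nil
    then show ?thesis using C L AB by simp
  next
    case (Cons a A')
    have "L @ [hd L] = (a # A') @ p # (B @ [a])" using AB Cons by simp
    moreover have "p # B @ A @ [p] = (p # B) @ a # (A' @ [p])" using Cons by simp
    ultimately show ?thesis
      using C L(4) pedges_append[of "a # A'" p "B @ [a]"] pedges_append[of "p # B" a "A' @ [p]"]
        successively_append_snoc[of "adj G" "a # A'" p "B @ [a]"]
        successively_append_snoc[of "adj G" "p # B" a "A' @ [p]"] by auto
  qed
  note C' = this
  have "q \<in> set (B @ A)" using \<open>q \<in> set L\<close> AB assms by auto
  then obtain X Y where XY: "B @ A = X @ q # Y" by (meson split_list)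
  define P Q where "P = p # X @ [q]" and "Q = rev (q # Y @ [p])"
  have eq: "p # B @ A @ [p] = (p # X) @ q # (Y @ [p])" using XY by (metis append.assoc append_Cons)
  have "distinct (p # B @ A)" using L(1) AB by auto
  then have dist: "distinct (p # X @ q # Y)" unfolding XY .
  have sub: "set (p # X @ q # Y) \<subseteq> VG"
  proof -
    have "set L = set (p # B @ A)" using AB by auto
    then show ?thesis using L(3) XY by simp
  qed
  have s: "successively (adj G) P" "successively (adj G) (q # Y @ [p])"
    using C' unfolding eq successively_append_snoc[of _ "p # X" q "Y @ [p]"] by (simp_all add: P_def)
  have gP: "gpath p q P" using s dist sub by (auto simp: gpath_def P_def)
  have gQ: "gpath q p (q # Y @ [p])" using s dist sub by (auto simp: gpath_def)
  have gQ: "gpath p q Q" using gpath_rev[OF gQ] by (simp add: Q_def)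
  have "length L = length P + length Q - 2"
    using arg_cong[OF XY, of length] AB by (simp add: P_def Q_def)
  then have "length P + length Q \<ge> 5" using L(2) by simp
  moreover have "set P \<inter> set Q = {p, q}" using dist by (auto simp: P_def Q_def)
  ultimately have "bigon p q P Q" using bigonI gP gQ assms(6) by blast
  moreover have "C = pedges P \<union> pedges Q"
    using C' unfolding eq pedges_append[of "p # X" q "Y @ [p]"] by (simp only: P_def Q_def pedges_rev) simp
  ultimately show ?thesis using that by blast
qed

lemma cyc_two_verts:
  assumes "cyc C"
  obtains p q where "p \<in> VG" "q \<in> VG" "p \<in> \<Union>C" "q \<in> \<Union>C" "p \<noteq> q"
proof -
  obtain L where L: "distinct L" "length L \<ge> 3" "set L \<subseteq> VG" "successively (adj G) (L @ [hd L])"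
     and C: "C = pedges (L @ [hd L])" using assms(1) by (auto simp: cyc_def)
  obtain p q r where "L = p # q # r" using L(2) by (cases L; cases "tl L") auto
  then have "p \<in> set L" "q \<in> set L" "p \<noteq> q" using L(1) by auto
  moreover from this have "p \<in> VG \<inter> \<Union>C" "q \<in> VG \<inter> \<Union>C" unfolding C cyc_list_verts[OF L] by simp_all
  ultimately show ?thesis using that[of p q] by simp
qed

lemma cyc_bigon:
  assumes "cyc C"
  obtains p q P Q where "bigon p q P Q" "C = pedges P \<union> pedges Q"
  using cyc_two_verts[OF assms] cyc_split[OF assms] by metis

lemma cyc_loop:
  assumes "cyc C"
  obtains c where "simple_path c" "pathfinish c = pathstart c" "path_image c = \<Union>C"
proof -
  obtain p q P Q where b: "bigon p q P Q" and C: "C = pedges P \<union> pedges Q"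
    using cyc_bigon[OF assms] by blast
  obtain g where g: "arc g" "pathstart g = p" "pathfinish g = q" "path_image g = \<Union>(pedges P)"
    using gpath_arc b by (metis bigon_def)
  obtain h where h: "arc h" "pathstart h = p" "pathfinish h = q" "path_image h = \<Union>(pedges Q)"
    using gpath_arc b by (metis bigon_def)
  have "simple_path (g +++ reversepath h)"
    using g h bigon_Int[OF b] by (intro simple_path_join_loop) (auto simp: arc_reversepath)
  moreover have "path_image (g +++ reversepath h) = \<Union>C"
    using g h C by (subst path_image_join) auto
  ultimately show ?thesis using that g h by auto
qed

section \<open>Closed discs and theta curves\<close>

definition disc :: "complex set set \<Rightarrow> complex set" where
  "disc C = \<Union>C \<union> inside (\<Union>C)"

text \<open>The edges of the graph drawn in the closed disc. Their number is the measure for the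
  inductions over cycles.\<close>

definition region :: "complex set set \<Rightarrow> complex set set" where
  "region C = {e \<in> EG. e \<subseteq> disc C}"

lemma cyc_Jordan:
  assumes "cyc C"
  shows "inside (\<Union>C) \<noteq> {}" "open (inside (\<Union>C))" "connected (inside (\<Union>C))"
    "outside (\<Union>C) \<noteq> {}" "open (outside (\<Union>C))" "connected (outside (\<Union>C))"
    "bounded (inside (\<Union>C))" "\<not> bounded (outside (\<Union>C))"
    "frontier (inside (\<Union>C)) = \<Union>C" "frontier (outside (\<Union>C)) = \<Union>C"
proof -
  obtain c where c: "simple_path c" "pathfinish c = pathstart c" "path_image c = \<Union>C"
    using cyc_loop[OF assms] by blast
  show "inside (\<Union>C) \<noteq> {}" "open (inside (\<Union>C))" "connected (inside (\<Union>C))"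
    "outside (\<Union>C) \<noteq> {}" "open (outside (\<Union>C))" "connected (outside (\<Union>C))"
    "bounded (inside (\<Union>C))" "\<not> bounded (outside (\<Union>C))"
    "frontier (inside (\<Union>C)) = \<Union>C" "frontier (outside (\<Union>C)) = \<Union>C"
    using Jordan_inside_outside[OF c(1,2)] unfolding c(3) by auto
qed

lemma disc_closure: "cyc C \<Longrightarrow> disc C = closure (inside (\<Union>C))"
  using cyc_Jordan(9)[of C] closure_Un_frontier[of "inside (\<Union>C)"] by (auto simp: disc_def)

lemma disc_closed: "cyc C \<Longrightarrow> closed (disc C)"
  by (simp add: disc_closure)

lemma finite_region: "finite (region C)"
  using finite_E by (auto simp: region_def)

lemma cyc_region: "cyc C \<Longrightarrow> C \<subseteq> region C"
  using cyc_sub by (auto simp: region_def disc_def)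

lemma region_eint: 
  assumes "cyc C" "e \<in> EG" "eint e \<subseteq> disc C"
  shows "e \<in> region C"
proof -
  have "closure (eint e) \<subseteq> disc C"
    using assms disc_closed closure_minimal by blast
  then show ?thesis using eint_props assms by (simp add: region_def)
qed

text \<open>The arc of \<open>R\<close> divides the inside of the outer cycle into the two smaller
  insides. An edge of the disc off the three paths has a connected open edge avoiding all of them,
  so it falls into one half. A point of an edge in both closed halves lies on \<open>R\<close>
  unless it is a vertex, because the insides are disjoint and avoid the outer cycle.\<close>

lemma theta:
  assumes PQ: "bigon p q P Q" and PR: "bigon p q P R" and QR: "bigon p q Q R"
    and meets: "\<Union>(pedges R) \<inter> inside (\<Union>(pedges P \<union> pedges Q)) \<noteq> {}"
  shows "region (pedges P \<union> pedges Q) = region (pedges P \<union> pedges R) \<union> region (pedges Q \<union> pedges R)"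
    and "region (pedges P \<union> pedges R) \<inter> region (pedges Q \<union> pedges R) = pedges R"
    and "inside (\<Union>(pedges P \<union> pedges R)) \<subseteq> inside (\<Union>(pedges P \<union> pedges Q))"
    and "inside (\<Union>(pedges Q \<union> pedges R)) \<subseteq> inside (\<Union>(pedges P \<union> pedges Q))"
    and "\<Union>(pedges R) - {p, q} \<subseteq> inside (\<Union>(pedges P \<union> pedges Q))"
proof -
  define IP IQ I where "IP = inside (\<Union>(pedges P \<union> pedges R))" and "IQ = inside (\<Union>(pedges Q \<union> pedges R))"
    and "I = inside (\<Union>(pedges P \<union> pedges Q))"
  have gps: "gpath p q P" "gpath p q Q" "gpath p q R" "p \<noteq> q" using PQ QR by (auto simp: bigon_def)
  obtain f where f: "arc f" "pathstart f = p" "pathfinish f = q" "path_image f = \<Union>(pedges P)"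
    using gpath_arc gps by blast
  obtain g where g: "arc g" "pathstart g = p" "pathfinish g = q" "path_image g = \<Union>(pedges Q)"
    using gpath_arc gps by blast
  obtain h where h: "arc h" "pathstart h = p" "pathfinish h = q" "path_image h = \<Union>(pedges R)"
    using gpath_arc gps by blast
  have *: "IP \<inter> IQ = {} \<and> IP \<union> IQ \<union> (\<Union>(pedges R) - {p, q}) = I"
    using split_inside_simple_closed_curve[OF arc_imp_simple_path[OF f(1)] f(2,3)
       arc_imp_simple_path[OF g(1)] g(2,3) arc_imp_simple_path[OF h(1)] h(2,3) gps(4)]
      bigon_Int[OF PQ] bigon_Int[OF PR] bigon_Int[OF QR] meets
    unfolding f(4) g(4) h(4) IP_def IQ_def I_def by (auto simp: Union_Un_distrib)
  note cycs = bigon_cyc[OF PQ] bigon_cyc[OF PR] bigon_cyc[OF QR]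
  have dis: "I \<inter> \<Union>(pedges P \<union> pedges Q) = {}" unfolding I_def using inside_no_overlap by blast
  show IPs: "IP \<subseteq> I" and IQs: "IQ \<subseteq> I" and Rs: "\<Union>(pedges R) - {p, q} \<subseteq> I"
    using * by auto
  note fold = IP_def[symmetric] IQ_def[symmetric] I_def[symmetric]
  show "region (pedges P \<union> pedges Q) = region (pedges P \<union> pedges R) \<union> region (pedges Q \<union> pedges R)"
  proof
    have "{p, q} \<subseteq> \<Union>(pedges P)" using bigon_Int[OF PQ] by auto
    then have "disc (pedges P \<union> pedges R) \<subseteq> disc (pedges P \<union> pedges Q)"
      "disc (pedges Q \<union> pedges R) \<subseteq> disc (pedges P \<union> pedges Q)"
      unfolding disc_def fold using * by blast+
    then show "region (pedges P \<union> pedges R) \<union> region (pedges Q \<union> pedges R) \<subseteq> region (pedges P \<union> pedges Q)"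
      by (auto simp: region_def)
    show "region (pedges P \<union> pedges Q) \<subseteq> region (pedges P \<union> pedges R) \<union> region (pedges Q \<union> pedges R)"
    proof
      fix e assume e: "e \<in> region (pedges P \<union> pedges Q)"
      then have eE: "e \<in> EG" and ed: "e \<subseteq> \<Union>(pedges P \<union> pedges Q) \<union> I"
        by (auto simp: region_def disc_def I_def)
      show "e \<in> region (pedges P \<union> pedges R) \<union> region (pedges Q \<union> pedges R)"
      proof (cases "e \<in> pedges P \<union> pedges Q \<union> pedges R")
        case True
        then show ?thesis using cyc_region cycs by blast
      next
        case False
        have "x \<notin> \<Union>(pedges P \<union> pedges Q \<union> pedges R)" if "x \<in> eint e" for x
          using eint_sub_Union[OF eE _ that, of "pedges P \<union> pedges Q \<union> pedges R"] False gpath_sub gps by blast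
        then have sub: "eint e \<subseteq> IP \<union> IQ" using ed eint_sub * by blast
        have "open IP" "open IQ" unfolding IP_def IQ_def using cyc_Jordan cycs by blast+
        then have "eint e \<subseteq> IP \<or> eint e \<subseteq> IQ"
          using connectedD[OF eint_props(1)[OF eE], of IP IQ] sub * by blast
        then show ?thesis
          using region_eint[OF cycs(2) eE] region_eint[OF cycs(3) eE]
          unfolding disc_def fold by blast
      qed
    qed
  qed
  show "region (pedges P \<union> pedges R) \<inter> region (pedges Q \<union> pedges R) = pedges R"
  proof
    show "pedges R \<subseteq> region (pedges P \<union> pedges R) \<inter> region (pedges Q \<union> pedges R)"
      using cyc_region cycs by blast
    show "region (pedges P \<union> pedges R) \<inter> region (pedges Q \<union> pedges R) \<subseteq> pedges R"
    proof
      fix e assume "e \<in> region (pedges P \<union> pedges R) \<inter> region (pedges Q \<union> pedges R)"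
      then have eE: "e \<in> EG" and e1: "e \<subseteq> \<Union>(pedges P \<union> pedges R) \<union> IP"
        and e2: "e \<subseteq> \<Union>(pedges Q \<union> pedges R) \<union> IQ"
        by (auto simp: region_def disc_def IP_def IQ_def)
      obtain y where y: "y \<in> eint e" using eint_props[OF eE] by blast
      then have ye: "y \<in> e" "y \<notin> VG" by (auto simp: eint_def)
      have pqV: "p \<in> VG" "q \<in> VG"
        using gps(1) hd_in_set[of P] last_in_set[of P] unfolding gpath_def by auto
      have "y \<in> \<Union>(pedges R)"
      proof (rule ccontr)
        assume n: "y \<notin> \<Union>(pedges R)"
        have "y \<in> \<Union>(pedges P) \<union> IP" "y \<in> \<Union>(pedges Q) \<union> IQ" using e1 e2 n ye by auto
        moreover have "y \<notin> \<Union>(pedges P) \<inter> \<Union>(pedges Q)"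
          unfolding bigon_Int[OF PQ] using ye(2) pqV by blast
        ultimately show False using * dis IPs IQs by blast
      qed
      then show "e \<in> pedges R" using eint_sub_Union[OF eE _ y] gpath_sub gps by blast
    qed
  qed
qed

end

section \<open>Faces\<close>

context plane
begin

lemma support_alt: "support G = \<Union>(EG \<union> (\<lambda>v. {v}) ` VG)"
  by (auto simp: support_def)

lemma support_compact: "compact (support G)"
  unfolding support_alt using finite_V finite_E edge_compact by (intro compact_Union) auto

text \<open>It makes the faces dense in the plane, so that every point of the graph is a limit of
  points of faces.\<close>

lemma support_interior: "interior (support G) = {}"
  unfolding support_alt
  by (rule interior_Union_closed_empty) (use finite_V finite_E edge_closed edge_interior in auto)

lemma face_props:
  assumes "F \<in> faces G"
  shows "open F" "connected F" "F \<noteq> {}" "F \<inter> support G = {}"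
proof -
  have "open (- support G)" using support_compact compact_imp_closed by blast
  then show "open F" using assms open_components unfolding faces_def by blast
  show "connected F" "F \<noteq> {}" "F \<inter> support G = {}"
    using assms in_components_connected in_components_nonempty in_components_subset
    unfolding faces_def by blast+
qed

lemma faces_disjoint: "F \<in> faces G \<Longrightarrow> F' \<in> faces G \<Longrightarrow> F \<inter> F' \<noteq> {} \<Longrightarrow> F = F'"
  using components_eq unfolding faces_def by blast

lemma faces_Union: "\<Union>(faces G) = - support G"
  by (simp add: faces_def Union_components)

lemma outer_iff: "F \<in> faces G \<and> \<not> bounded F \<longleftrightarrow> F = outer_face G"
  unfolding faces_def outer_face_def
  by (rule bounded_unique_outside) (use support_compact compact_imp_bounded in auto)

lemma outer_faces: "outer_face G \<in> faces G"
  using outer_iff by blast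

lemma edge_support: "e \<in> EG \<Longrightarrow> e \<subseteq> support G"
  by (auto simp: support_def)

lemma cyc_support: "cyc C \<Longrightarrow> \<Union>C \<subseteq> support G"
  using cyc_sub edge_support by blast

lemma local_ball:
  assumes "e \<in> EG" "x \<in> eint e"
  obtains r where "r > 0" "ball x r \<inter> (VG \<union> \<Union>(EG - {e})) = {}"
proof -
  have "closed (VG \<union> \<Union>(EG - {e}))"
    using finite_V by (intro closed_Un finite_imp_closed Union_closed) auto
  moreover have "x \<notin> VG \<union> \<Union>(EG - {e})"
    using assms eint_unique by (auto simp: eint_def)
  ultimately obtain r where "r > 0" "ball x r \<subseteq> - (VG \<union> \<Union>(EG - {e}))"
    by (meson ComplI open_Compl open_contains_ball)
  then show ?thesis using that by blast
qed

text \<open>The cycle is cut at the ends of \<open>e\<close>; by \<open>pedges_hd_last\<close> the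
  side that contains \<open>e\<close> consists of \<open>e\<close> alone.\<close>

lemma cyc_edge_split:
  assumes "cyc C" "e \<in> C"
  obtains u v Q where "adj G u v" "e = edg u v" "bigon u v [u, v] Q" "C = {e} \<union> pedges Q"
proof -
  have eE: "e \<in> EG" using assms cyc_sub by blast
  obtain u v where uv: "adj G u v" "e = edg u v" using edge_edg[OF eE] .
  have uve: "u \<in> e" "v \<in> e" using edg[OF uv(1)] uv(2) ends_iff by blast+
  have V: "u \<in> VG" "v \<in> VG" "u \<noteq> v" using adj_ne[OF uv(1)] by auto
  have U: "u \<in> \<Union>C" "v \<in> \<Union>C" using uve assms(2) by blast+
  obtain P Q where PQ: "bigon u v P Q" "C = pedges P \<union> pedges Q"
    using cyc_split[OF assms(1) V(1,2) U V(3)] .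
  have *: "\<exists>Q. bigon u v [u, v] Q \<and> C = {e} \<union> pedges Q"
    if b: "bigon u v P Q" and C: "C = pedges P \<union> pedges Q" and e: "e \<in> pedges P" for P Q
  proof -
    have "P = [u, v]" using pedges_hd_last[of u v P] b e uv by (auto simp: bigon_def)
    then show ?thesis using b C uv by auto
  qed
  have "e \<in> pedges P \<or> e \<in> pedges Q" using PQ assms by blast
  then obtain Q' where "bigon u v [u, v] Q'" "C = {e} \<union> pedges Q'"
    using *[OF PQ] *[OF bigon_sym[OF PQ(1)]] PQ(2) by blast
  then show ?thesis using that uv by blast
qed

text \<open>
  Near an inner point of an edge \<open>e\<close> of a cycle, each side of the cycle lies in a single face:
  the cycle and the rest of the graph meet in the arc that remains when \<open>e\<close> is removed, so
  Janiszewski's theorem applies.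
\<close>

lemma side_connected:
  assumes C: "cyc C" "e \<in> C" and x: "x \<in> eint e" and r: "ball x r \<inter> (VG \<union> \<Union>(EG - {e})) = {}"
    and A: "A = inside (\<Union>C) \<or> A = outside (\<Union>C)"
    and yz: "y \<in> ball x r \<inter> A" "z \<in> ball x r \<inter> A"
  shows "connected_component (- support G) y z"
proof -
  define T where "T = VG \<union> \<Union>(EG - {e})"
  obtain u v Q where uv: "adj G u v" "e = edg u v" "bigon u v [u, v] Q" "C = {e} \<union> pedges Q"
    using cyc_edge_split[OF C] .
  have Q: "gpath u v Q" "u \<noteq> v" "e \<notin> pedges Q" using uv by (auto simp: bigon_def)
  have eE: "e \<in> EG" using C cyc_sub by blast
  have "\<Union>C \<inter> T = \<Union>(pedges Q)"
  proof
    show "\<Union>(pedges Q) \<subseteq> \<Union>C \<inter> T"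
      using uv Q gpath_sub unfolding T_def by blast
    show "\<Union>C \<inter> T \<subseteq> \<Union>(pedges Q)"
    proof
      fix y assume y: "y \<in> \<Union>C \<inter> T"
      show "y \<in> \<Union>(pedges Q)"
      proof (cases "y \<in> e")
        case True
        then have "y \<in> VG" using y edge_Int[OF eE] unfolding T_def by blast
        then have "y \<in> {u, v}" using True ends_iff edg[OF uv(1)] uv(2) by blast
        then show ?thesis using bigon_Int[OF uv(3)] by blast
      qed (use y uv in auto)
    qed
  qed
  moreover have "connected (\<Union>(pedges Q))"
    using gpath_arc[OF Q(1,2)] connected_arc_image by metis
  moreover have "closed T"
    using finite_V unfolding T_def by (intro closed_Un finite_imp_closed Union_closed) auto
  moreover have "compact (\<Union>C)"
    using C cyc_sub finite_E edge_compact finite_subset by (intro compact_Union) blast+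
  moreover have "connected_component (- \<Union>C) y z"
  proof (rule connected_componentI)
    show "connected A" using A cyc_Jordan[OF C(1)] by blast
    show "A \<subseteq> - \<Union>C" using A inside_no_overlap[of "\<Union>C"] outside_no_overlap[of "\<Union>C"] by blast
  qed (use yz in auto)
  moreover have "connected_component (- T) y z"
  proof (rule connected_componentI)
    show "connected (ball x r)" by simp
    show "ball x r \<subseteq> - T" using r unfolding T_def by blast
  qed (use yz in auto)
  ultimately have "connected_component (- (\<Union>C \<union> T)) y z"
    by (intro Janiszewski) auto
  moreover have "\<Union>C \<union> T = support G"
    using cyc_sub[OF C(1)] C(2) eE unfolding T_def support_def by blast
  ultimately show ?thesis by simp
qed

end

section \<open>Bounding cycles of faces\<close>

locale nquad = plane +
  assumes nq: "near_quadrangulation G"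
begin

lemma pedges_nth: "pedges xs = {edg (xs ! i) (xs ! Suc i) |i. Suc i < length xs}"
proof (induction xs rule: pedges.induct)
  case (1 u v r)
  have "{edg ((u # v # r) ! i) ((u # v # r) ! Suc i) |i. Suc i < length (u # v # r)} =
    insert (edg u v) {edg ((v # r) ! i) ((v # r) ! Suc i) |i. Suc i < length (v # r)}" (is "?l = insert _ ?r")
  proof (intro equalityI subsetI)
    fix e assume "e \<in> ?l"
    then obtain i where i: "e = edg ((u # v # r) ! i) ((u # v # r) ! Suc i)" "Suc i < length (u # v # r)"
      by blast
    show "e \<in> insert (edg u v) ?r"
    proof (cases i)
      case (Suc j)
      then have "e \<in> ?r" using i by auto
      then show ?thesis by blast
    qed (use i in simp)
  next
    fix e assume "e \<in> insert (edg u v) ?r"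
    then consider "e = edg u v" | i where "e = edg ((v # r) ! i) ((v # r) ! Suc i)" "Suc i < length (v # r)"
      by blast
    then show "e \<in> ?l"
    proof cases
      case 1
      then have "e = edg ((u # v # r) ! 0) ((u # v # r) ! Suc 0)" by simp
      then show ?thesis by fastforce
    next
      case (2 i)
      then have "e = edg ((u # v # r) ! Suc i) ((u # v # r) ! Suc (Suc i))" "Suc (Suc i) < length (u # v # r)"
        by auto
      then show ?thesis by blast
    qed
  qed
  then show ?case using 1 by simp
qed auto

text \<open>Appending the head to the list replaces the index arithmetic modulo the length.\<close>

lemma is_cycle_cyc:
  assumes vs: "is_cycle G vs"
  shows "cyc (cycle_edges G vs)" "VG \<inter> \<Union>(cycle_edges G vs) = set vs"
proof -
  define L where "L = vs @ [hd vs]"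
  have len: "length vs \<ge> 3" "distinct vs" "set vs \<subseteq> VG"
    and ad: "\<And>i. i < length vs \<Longrightarrow> adj G (vs ! i) (vs ! (Suc i mod length vs))"
    using vs by (auto simp: is_cycle_def)
  have Lnth: "L ! i = vs ! i" "L ! Suc i = vs ! (Suc i mod length vs)" if "i < length vs" for i
  proof -
    show "L ! i = vs ! i" using that by (simp add: L_def nth_append)
    show "L ! Suc i = vs ! (Suc i mod length vs)"
    proof (cases "Suc i = length vs")
      case True
      moreover have "hd vs = vs ! 0" using len by (intro hd_conv_nth) auto
      ultimately show ?thesis by (simp add: L_def nth_append)
    next
      case False
      then show ?thesis using that by (simp add: L_def nth_append)
    qed
  qed
  have succ: "successively (adj G) L"
    unfolding successively_conv_nth using Lnth ad by (auto simp: L_def)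
  have "pedges L = cycle_edges G vs"
  proof -
    have "pedges L = {edg (vs ! i) (vs ! (Suc i mod length vs)) |i. i < length vs}"
    proof -
      have "(e = edg (L ! i) (L ! Suc i) \<and> Suc i < length L) \<longleftrightarrow>
          (e = edg (vs ! i) (vs ! (Suc i mod length vs)) \<and> i < length vs)" for e i
        using Lnth[of i] by (auto simp: L_def)
      then show ?thesis unfolding pedges_nth by simp
    qed
    also have "\<dots> = cycle_edges G vs"
    proof (intro equalityI subsetI)
      fix e assume "e \<in> {edg (vs ! i) (vs ! (Suc i mod length vs)) |i. i < length vs}"
      then obtain i where "e = edg (vs ! i) (vs ! (Suc i mod length vs))" "i < length vs" by blast
      then show "e \<in> cycle_edges G vs" using edg[OF ad] unfolding cycle_edges_def by auto
    next
      fix e assume "e \<in> cycle_edges G vs"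
      then obtain i where "e \<in> EG" "i < length vs" "ends G e = {vs ! i, vs ! (Suc i mod length vs)}"
        unfolding cycle_edges_def by blast
      then show "e \<in> {edg (vs ! i) (vs ! (Suc i mod length vs)) |i. i < length vs}"
        using edg_eq by blast
    qed
    finally show ?thesis .
  qed
  then show "cyc (cycle_edges G vs)" "VG \<inter> \<Union>(cycle_edges G vs) = set vs"
    using len succ cyc_list_verts[of vs] unfolding cyc_def L_def by auto
qed

definition face_edges :: "complex set \<Rightarrow> complex set set" where
  "face_edges F = {e \<in> EG. e \<subseteq> frontier F}"

text \<open>An inner point of an edge lies on no other edge, so a set of edges can be recovered from
  its union.\<close>

lemma face_edges_eq:
  assumes "C \<subseteq> EG" "frontier F = \<Union>C"
  shows "face_edges F = C"
proof
  show "C \<subseteq> face_edges F" using assms by (auto simp: face_edges_def)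
  show "face_edges F \<subseteq> C"
  proof
    fix e assume "e \<in> face_edges F"
    then have e: "e \<in> EG" "e \<subseteq> \<Union>C" using assms by (auto simp: face_edges_def)
    obtain x where x: "x \<in> eint e" using eint_props[OF e(1)] by blast
    then show "e \<in> C" using eint_sub_Union[OF e(1) assms(1) x] e eint_sub by blast
  qed
qed

lemma face_list:
  assumes "F \<in> faces G"
  obtains vs where "is_cycle G vs" "frontier F = \<Union>(cycle_edges G vs)"
    "F \<in> internal_faces G \<longrightarrow> length vs = 4"
proof (cases "F = outer_face G")
  case True
  then have "F \<notin> internal_faces G" by (simp add: internal_faces_def)
  then show ?thesis using nq that True unfolding near_quadrangulation_def bounded_by_cycle_def by blast
next
  case False
  then have "F \<in> internal_faces G" using assms by (simp add: internal_faces_def)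
  then show ?thesis using nq that unfolding near_quadrangulation_def bounded_by_cycle_def by blast
qed

lemma face_cyc:
  assumes "F \<in> faces G"
  shows "cyc (face_edges F)" "frontier F = \<Union>(face_edges F)"
proof -
  obtain vs where vs: "is_cycle G vs" "frontier F = \<Union>(cycle_edges G vs)"
    using face_list[OF assms] .
  have c: "cyc (cycle_edges G vs)" by (rule is_cycle_cyc(1)[OF vs(1)])
  have "face_edges F = cycle_edges G vs" using face_edges_eq[OF cyc_sub[OF c] vs(2)] .
  then show "cyc (face_edges F)" "frontier F = \<Union>(face_edges F)" using c vs by auto
qed

lemma face_edges_sub: "face_edges F \<subseteq> EG" by (auto simp: face_edges_def)

lemma face_frontier_disj: "F \<in> faces G \<Longrightarrow> F \<inter> \<Union>(face_edges F) = {}"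
  using face_props(4)[of F] face_edges_sub[of F] edge_support by blast

lemma face_side:
  assumes F: "F \<in> faces G" and A: "connected A" "F \<inter> A \<noteq> {}" "A \<inter> \<Union>(face_edges F) = {}"
  shows "A \<subseteq> F"
  using connected_Int_frontier[OF A(1), of F] A face_cyc(2)[OF F] by blast

text \<open>A face is connected and misses its bounding cycle, so it lies on one side. That side is
  connected and misses the frontier of the face, so it cannot leave the face.\<close>

lemma face_inside_or_outside:
  assumes F: "F \<in> faces G" 
  shows "F = inside (\<Union>(face_edges F)) \<or> F = outside (\<Union>(face_edges F))"
proof -
  note J = cyc_Jordan[OF face_cyc(1)[OF F]]
  have d: "inside (\<Union>(face_edges F)) \<inter> \<Union>(face_edges F) = {}" "outside (\<Union>(face_edges F)) \<inter> \<Union>(face_edges F) = {}"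
    using inside_no_overlap outside_no_overlap by blast+
  have "F \<subseteq> inside (\<Union>(face_edges F)) \<or> F \<subseteq> outside (\<Union>(face_edges F))"
    using connected_subset_inside_or_outside face_props[OF F] face_frontier_disj[OF F] by blast
  then show ?thesis
  proof
    assume s: "F \<subseteq> inside (\<Union>(face_edges F))"
    then have "inside (\<Union>(face_edges F)) \<subseteq> F" using face_side[OF F J(3) _ d(1)] face_props(3)[OF F] by blast
    then show ?thesis using s by blast
  next
    assume s: "F \<subseteq> outside (\<Union>(face_edges F))"
    then have "outside (\<Union>(face_edges F)) \<subseteq> F" using face_side[OF F J(6) _ d(2)] face_props(3)[OF F] by blast
    then show ?thesis using s by blast
  qed
qed

lemma internal_bounded: "F \<in> internal_faces G \<Longrightarrow> F \<in> faces G \<and> bounded F"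
  using outer_iff by (auto simp: internal_faces_def)

lemma internal_inside:
  assumes "F \<in> internal_faces G"
  shows "F = inside (\<Union>(face_edges F))"
  using face_inside_or_outside internal_bounded[OF assms] cyc_Jordan(8) face_cyc(1) by metis

text \<open>An internal face is the inside of its bounding edges, and there are only finitely many
  sets of edges.\<close>

lemma faces_finite: "finite (faces G)"
proof -
  have "inj_on face_edges (internal_faces G)"
    using internal_inside by (metis inj_onI)
  moreover have "face_edges ` internal_faces G \<subseteq> Pow EG" using face_edges_sub by blast
  ultimately have "finite (internal_faces G)"
    using finite_E by (meson finite_Pow_iff inj_on_finite)
  then show ?thesis by (simp add: internal_faces_def)
qed

text \<open>The union of the faces is dense, and for finitely many faces its closure is the union of
  their closures; a point of the graph in the closure of a face is on its frontier.\<close>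

lemma point_on_face:
  assumes "x \<in> support G"
  obtains F where "F \<in> faces G" "x \<in> \<Union>(face_edges F)"
proof -
  have "closure (- support G) = UNIV" using support_interior by (simp add: closure_complement)
  then have "x \<in> closure (\<Union>(faces G))" by (simp add: faces_Union)
  also have "closure (\<Union>(faces G)) \<subseteq> \<Union>(closure ` faces G)"
  proof (rule closure_minimal)
    show "closed (\<Union>(closure ` faces G))" using faces_finite by (intro closed_Union) auto
  qed (use closure_subset in blast)
  finally obtain F where F: "F \<in> faces G" "x \<in> closure F" by blast
  moreover have "x \<notin> F" using face_props(4)[OF F(1)] assms by blast
  ultimately have "x \<in> frontier F" using face_props(1)[OF F(1)] by (simp add: frontier_def interior_open)
  then show ?thesis using that F face_cyc(2) by blast
qed

lemma face_touch:
  assumes "F \<in> faces G" "e \<in> EG" "x \<in> eint e" "x \<in> closure F"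
  shows "e \<in> face_edges F"
proof -
  have "x \<notin> F" using face_props(4)[OF assms(1)] assms edge_support eint_sub by blast
  then have "x \<in> frontier F" using assms(4) face_props(1)[OF assms(1)] by (simp add: frontier_def interior_open)
  then have "x \<in> \<Union>(face_edges F)" using face_cyc(2)[OF assms(1)] by simp
  then show ?thesis using eint_sub_Union[OF assms(2) face_edges_sub assms(3)] by blast
qed

lemma face_edges_closure: "F \<in> faces G \<Longrightarrow> e \<in> face_edges F \<Longrightarrow> e \<subseteq> closure F"
  by (auto simp: face_edges_def frontier_def)

text \<open>Near an inner point of \<open>e\<close> all points of \<open>A\<close> belong to one
  face, by \<open>side_connected\<close>. This face touches \<open>e\<close>, and every other
  candidate has points in the same small neighbourhood, so it is the same face.\<close>

lemma side_face_ex1: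
  assumes C: "cyc C" "e \<in> C" and A: "A = inside (\<Union>C) \<or> A = outside (\<Union>C)"
  shows "\<exists>!F. F \<in> faces G \<and> F \<subseteq> A \<and> e \<in> face_edges F"
proof -
  have eE: "e \<in> EG" using C cyc_sub by blast
  have A': "A \<inter> \<Union>C = {}" "connected A" "open A" "frontier A = \<Union>C"
    using A inside_no_overlap[of "\<Union>C"] outside_no_overlap[of "\<Union>C"] cyc_Jordan[OF C(1)] by blast+
  obtain x where x: "x \<in> eint e" using eint_props[OF eE] by blast
  obtain r where r: "r > 0" "ball x r \<inter> (VG \<union> \<Union>(EG - {e})) = {}" using local_ball[OF eE x] .
  have "x \<in> closure A" using A'(4) x C eint_sub frontier_closures by blast
  then have ne: "ball x s \<inter> A \<noteq> {}" if "s > 0" for s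
    using that by (metis Int_commute centre_in_ball closure_iff_nhds_not_empty open_ball order_refl)
  then obtain y where y: "y \<in> ball x r \<inter> A" using r by blast
  have conn: "connected_component (- support G) y z" if "z \<in> ball x r \<inter> A" for z
    using side_connected[OF C x r(2) A y that] .
  define F where "F = connected_component_set (- support G) y"
  have "y \<notin> support G" using connected_component_in[OF conn[OF y]] by blast
  then have F: "F \<in> faces G" unfolding F_def faces_def by (auto simp: components_def)
  have sub: "ball x r \<inter> A \<subseteq> F" using conn unfolding F_def by blast
  have "F \<inter> \<Union>C = {}" using cyc_support[OF C(1)] face_props(4)[OF F] by blast
  then have "F \<subseteq> inside (\<Union>C) \<or> F \<subseteq> outside (\<Union>C)"
    using connected_subset_inside_or_outside face_props(2)[OF F] by blast
  moreover have "y \<in> F" using y sub by blast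
  ultimately have FA: "F \<subseteq> A" using A y inside_Int_outside[of "\<Union>C"] by blast
  have "x \<in> closure F"
    unfolding closure_iff_nhds_not_empty
  proof (intro allI impI)
    fix T U assume TU: "U \<subseteq> T" "open U" "x \<in> U"
    then obtain s where s: "s > 0" "ball x s \<subseteq> U" by (meson open_contains_ball)
    have "min r s > 0" using r s by simp
    from ne[OF this] obtain z where "z \<in> ball x (min r s) \<inter> A" by blast
    then have "z \<in> ball x r \<inter> A" "z \<in> ball x s" by auto
    then have "z \<in> F" "z \<in> T" using sub s TU by blast+
    then show "F \<inter> T \<noteq> {}" by blast
  qed
  then have eF: "e \<in> face_edges F" using face_touch[OF F eE x] by blast
  show ?thesis
  proof (rule ex1I[of _ F])
    show "F \<in> faces G \<and> F \<subseteq> A \<and> e \<in> face_edges F" using F FA eF by blast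
    fix F' assume F': "F' \<in> faces G \<and> F' \<subseteq> A \<and> e \<in> face_edges F'"
    then have "x \<in> closure F'" using face_edges_closure x eint_sub by blast
    then obtain z where "z \<in> ball x r" "z \<in> F'"
      using r by (metis Int_iff centre_in_ball closure_iff_nhds_not_empty ex_in_conv open_ball order_refl)
    then show "F' = F" using faces_disjoint[of F' F] F F' sub by blast
  qed
qed

text \<open>\<open>side_face_ex1\<close> is applied to the bounding cycle of \<open>F\<close>
  itself: \<open>F\<close> fills one side, and the other side contains exactly one face at
  \<open>e\<close>.\<close>

lemma two_faces:
  assumes F: "F \<in> faces G" "e \<in> face_edges F"
  obtains F' where "F' \<in> faces G" "F' \<noteq> F" "e \<in> face_edges F'"
    "\<And>F''. F'' \<in> faces G \<Longrightarrow> e \<in> face_edges F'' \<Longrightarrow> F'' = F \<or> F'' = F'"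
proof -
  have c: "cyc (face_edges F)" using face_cyc[OF F(1)] by blast
  obtain B where B: "(F = inside (\<Union>(face_edges F)) \<and> B = outside (\<Union>(face_edges F))) \<or>
      (F = outside (\<Union>(face_edges F)) \<and> B = inside (\<Union>(face_edges F)))"
    using face_inside_or_outside[OF F(1)] by blast
  then have FB: "F \<inter> B = {}" using inside_Int_outside by blast
  have "\<exists>!F'. F' \<in> faces G \<and> F' \<subseteq> B \<and> e \<in> face_edges F'"
    by (rule side_face_ex1[OF c F(2)]) (use B in blast)
  then obtain F' where F': "F' \<in> faces G" "F' \<subseteq> B" "e \<in> face_edges F'"
    and uq: "\<And>F''. F'' \<in> faces G \<Longrightarrow> F'' \<subseteq> B \<Longrightarrow> e \<in> face_edges F'' \<Longrightarrow> F'' = F'" by blast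
  have "F'' = F \<or> F'' = F'" if F'': "F'' \<in> faces G" "e \<in> face_edges F''" for F''
  proof (cases "F'' = F")
    case False
    have "F'' \<inter> \<Union>(face_edges F) = {}"
      using face_props(4)[OF F''(1)] face_edges_sub edge_support by blast
    then have "F'' \<subseteq> inside (\<Union>(face_edges F)) \<or> F'' \<subseteq> outside (\<Union>(face_edges F))"
      using connected_subset_inside_or_outside face_props(2)[OF F''(1)] by blast
    moreover have "\<not> F'' \<subseteq> F"
      using False faces_disjoint[OF F''(1) F(1)] face_props(3)[OF F''(1)] by blast
    ultimately have "F'' \<subseteq> B" using B by blast
    then show ?thesis using uq F'' by blast
  qed simp
  moreover have "F' \<noteq> F" using F' FB face_props(3) F by blast
  ultimately show ?thesis using that F' by blast
qed

text \<open>Connectedness of the dual graph. The plane without the finitely many vertices is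
  connected; in it, the union \<open>U\<close> of the faces of \<open>S\<close> and their open
  bounding edges is open, and so is the complement of \<open>U\<close>, because near an inner point
  of an edge only this edge and faces bordering it are met.\<close>

lemma faces_spread:
  assumes S: "S \<subseteq> faces G" "S \<noteq> {}"
    and closed: "\<And>F F' e. F \<in> S \<Longrightarrow> F' \<in> faces G \<Longrightarrow> e \<in> face_edges F \<Longrightarrow> e \<in> face_edges F' \<Longrightarrow> F' \<in> S"
  shows "S = faces G"
proof -
  define U where "U = \<Union>S \<union> \<Union>(eint ` {e \<in> EG. \<exists>F\<in>S. e \<in> face_edges F})"
  define W where "W = - VG - U"
  have nbhd: "\<exists>N. open N \<and> x \<in> N \<and> (N \<subseteq> U \<or> N \<inter> U = {})" if x: "x \<notin> VG" for x
  proof (cases "x \<in> support G")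
    case False
    then obtain F where F: "F \<in> faces G" "x \<in> F" using faces_Union by blast
    have "F \<subseteq> U \<or> F \<inter> U = {}"
    proof (cases "F \<in> S")
      case False
      have "F \<inter> F' = {}" if "F' \<in> S" for F' using faces_disjoint[OF F(1), of F'] that S False by blast
      moreover have "F \<inter> eint e = {}" if "e \<in> EG" for e
        using face_props(4)[OF F(1)] edge_support[OF that] eint_sub by blast
      ultimately show ?thesis unfolding U_def by blast
    qed (auto simp: U_def)
    then show ?thesis using face_props(1)[OF F(1)] F(2) by blast
  next
    case True
    then obtain e where e: "e \<in> EG" "x \<in> eint e" using x by (auto simp: support_def eint_def)
    obtain r where r: "r > 0" "ball x r \<inter> (VG \<union> \<Union>(EG - {e})) = {}" using local_ball[OF e] .
    \<comment> \<open>A finite union of closed sets that avoids \<open>x\<close>; off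
      \<open>K\<close> the only faces met are those bordering \<open>e\<close>.\<close>
    define K where "K = \<Union>(closure ` {F \<in> faces G. e \<notin> face_edges F})"
    have "closed K" unfolding K_def using faces_finite by (intro closed_Union) auto
    moreover have "x \<notin> K" using face_touch[OF _ e] unfolding K_def by blast
    ultimately have "open (ball x r - K)" "x \<in> ball x r - K" using r by auto
    moreover have cov: "y \<in> eint e \<or> (\<exists>F\<in>faces G. y \<in> F \<and> e \<in> face_edges F)" if y: "y \<in> ball x r - K" for y
    proof (cases "y \<in> support G")
      case True
      then show ?thesis using r y e by (auto simp: support_def eint_def)
    next
      case False
      then obtain F where "F \<in> faces G" "y \<in> F" using faces_Union by blast
      then show ?thesis using y closure_subset unfolding K_def by blast
    qed
    have "ball x r - K \<subseteq> U \<or> (ball x r - K) \<inter> U = {}"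
    proof (cases "\<exists>F\<in>S. e \<in> face_edges F")
      case True
      then have "ball x r - K \<subseteq> U" using cov closed e unfolding U_def by blast
      then show ?thesis by blast
    next
      case False
      have "y \<notin> U" if y: "y \<in> ball x r - K" for y
      proof
        assume "y \<in> U"
        then consider F where "F \<in> S" "y \<in> F" | e' where "e' \<in> EG" "\<exists>F\<in>S. e' \<in> face_edges F" "y \<in> eint e'"
          unfolding U_def by blast
        then show False
        proof cases
          case (1 F)
          then have "F \<in> faces G" using S by blast
          have "y \<notin> eint e" using face_props(4)[OF \<open>F \<in> faces G\<close>] 1 edge_support[OF e(1)] eint_sub by blast
          then obtain F' where "F' \<in> faces G" "y \<in> F'" "e \<in> face_edges F'" using cov[OF y] by blast
          then show False using faces_disjoint[of F F'] \<open>F \<in> faces G\<close> 1 False by blast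
        next
          case (2 e')
          have "y \<in> eint e" using cov[OF y] face_props(4) edge_support[OF 2(1)] 2(3) eint_sub by blast
          then have "e = e'" using eint_unique[OF e(1) 2(1)] 2(3) eint_sub by blast
          then show False using False 2 by blast
        qed
      qed
      then show ?thesis by blast
    qed
    then show ?thesis using \<open>open (ball x r - K)\<close> \<open>x \<in> ball x r - K\<close> by blast
  qed
  have UV: "U \<subseteq> - VG"
    using S face_props(4) unfolding U_def eint_def support_def by blast
  have "open U"
    unfolding open_subopen[of U] using nbhd UV by blast
  moreover have "open W"
  proof -
    have oV: "open (- VG)" using finite_V by (simp add: finite_imp_closed open_Compl)
    show ?thesis unfolding open_subopen[of W]
    proof
      fix x assume x: "x \<in> W"
      then obtain N where "open N" "x \<in> N" "N \<inter> U = {}" using nbhd[of x] unfolding W_def by blast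
      then show "\<exists>T. open T \<and> x \<in> T \<and> T \<subseteq> W"
        using oV x by (intro exI[of _ "N \<inter> - VG"]) (auto simp: W_def)
    qed
  qed
  moreover have "connected (- VG)"
  proof -
    have "connected (UNIV - VG)"
      by (rule connected_open_diff_countable) (use finite_V countable_finite in auto)
    then show ?thesis by (simp add: Compl_eq_Diff_UNIV)
  qed
  moreover have "U \<noteq> {}" using S face_props(3) unfolding U_def by blast
  ultimately have "W = {}"
    using connectedD[of "- VG" U W] UV unfolding W_def by blast
  then have all: "- VG \<subseteq> U" unfolding W_def by blast
  have "F \<in> S" if F: "F \<in> faces G" for F
  proof -
    obtain y where y: "y \<in> F" using face_props(3)[OF F] by blast
    have ys: "y \<notin> support G" using y face_props(4)[OF F] by blast
    then have "y \<in> U" using all by (auto simp: support_def)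
    then obtain F' where "F' \<in> S" "y \<in> F'" using ys edge_support eint_sub unfolding U_def by blast
    then show ?thesis using faces_disjoint[OF F, of F'] y S by blast
  qed
  then show ?thesis using S by blast
qed

lemma face_verts_reach:
  assumes F: "F \<in> faces G" and x: "x \<in> VG \<inter> \<Union>(face_edges F)" "y \<in> VG \<inter> \<Union>(face_edges F)"
  shows "(adj G)\<^sup>*\<^sup>* x y"
proof -
  obtain vs where vs: "is_cycle G vs" "frontier F = \<Union>(cycle_edges G vs)" using face_list[OF F] .
  have st: "VG \<inter> \<Union>(face_edges F) = set vs" using is_cycle_cyc(2)[OF vs(1)] vs(2) face_cyc(2)[OF F] by simp
  have r: "i < length vs \<Longrightarrow> (adj G)\<^sup>*\<^sup>* (vs ! 0) (vs ! i)" for i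
  proof (induction i)
    case (Suc i)
    then have "adj G (vs ! i) (vs ! Suc i)" using vs(1) unfolding is_cycle_def
      by (metis Suc_lessD mod_less)
    then show ?case using Suc by auto
  qed simp
  have "symp (adj G)" using adj_sym by (auto simp: symp_def)
  then have s: "symp (adj G)\<^sup>*\<^sup>*" by (rule symp_rtranclp)
  obtain i j where "i < length vs" "x = vs ! i" "j < length vs" "y = vs ! j"
    using x st by (metis in_set_conv_nth)
  then show ?thesis using r[of i] r[of j] sympD[OF s] rtranclp_trans by metis
qed

text \<open>The vertices of a face are linked along its cycle and faces with a common edge share its
  ends, so reachability spreads to every face. The graph is thus connected because of the shape of
  its faces.\<close>

lemma reachable:
  assumes "u \<in> VG" "v \<in> VG"
  shows "(adj G)\<^sup>*\<^sup>* u v"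
proof -
  define S where "S = {F \<in> faces G. \<exists>w \<in> VG \<inter> \<Union>(face_edges F). (adj G)\<^sup>*\<^sup>* u w}"
  have *: "\<exists>F\<in>faces G. x \<in> \<Union>(face_edges F)" if "x \<in> VG" for x
    using point_on_face[of x] that by (metis UnI1 support_def)
  have "S \<noteq> {}" using *[OF assms(1)] assms unfolding S_def by blast
  moreover have "F' \<in> S" if "F \<in> S" "F' \<in> faces G" "e \<in> face_edges F" "e \<in> face_edges F'" for F F' e
  proof -
    have eE: "e \<in> EG" using that face_edges_sub by blast
    obtain a b where ab: "a \<in> VG" "ends G e = {a, b}" using edge_ends[OF eE] by metis
    then have "a \<in> e" using ends_iff by blast
    then have "a \<in> VG \<inter> \<Union>(face_edges F)" "a \<in> VG \<inter> \<Union>(face_edges F')" using that ab by auto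
    moreover obtain w where "w \<in> VG \<inter> \<Union>(face_edges F)" "(adj G)\<^sup>*\<^sup>* u w" "F \<in> faces G" using \<open>F \<in> S\<close> S_def by blast
    ultimately have "(adj G)\<^sup>*\<^sup>* u a" using face_verts_reach[of F w a] by (meson rtranclp_trans)
    then show ?thesis unfolding S_def using that \<open>a \<in> VG \<inter> \<Union>(face_edges F')\<close> by blast
  qed
  ultimately have "S = faces G" by (intro faces_spread) (auto simp: S_def)
  moreover obtain F where F: "F \<in> faces G" "v \<in> \<Union>(face_edges F)" using *[OF assms(2)] by blast
  ultimately obtain w where "w \<in> VG \<inter> \<Union>(face_edges F)" "(adj G)\<^sup>*\<^sup>* u w" unfolding S_def by blast
  then show ?thesis using face_verts_reach[OF F(1), of w v] F assms by (meson IntI rtranclp_trans)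
qed

end

section \<open>A Gauss-Bonnet inequality\<close>

context plane
begin

definition deg :: "complex set set \<Rightarrow> complex \<Rightarrow> nat" where
  "deg C x = card {e \<in> C. x \<in> e}"

text \<open>A labelled 4-cycle. Adjacency separates consecutive corners, and the two inequations
  separate opposite ones.\<close>

definition square :: "complex \<Rightarrow> complex \<Rightarrow> complex \<Rightarrow> complex \<Rightarrow> bool" where
  "square a b c d \<longleftrightarrow> adj G a b \<and> adj G b c \<and> adj G c d \<and> adj G d a \<and> a \<noteq> c \<and> b \<noteq> d"

definition square_edges :: "complex \<Rightarrow> complex \<Rightarrow> complex \<Rightarrow> complex \<Rightarrow> complex set set" where
  "square_edges a b c d = {edg a b, edg b c, edg c d, edg d a}"

lemma square_rotate: "square a b c d \<Longrightarrow> square b c d a"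
  by (auto simp: square_def)

lemma square_flip: "square a b c d \<Longrightarrow> square b a d c"
  using adj_sym by (auto simp: square_def)

lemma square_edges_flip: "square_edges b a d c = square_edges a b c d"
  by (auto simp: square_edges_def edg_sym)

lemma edg_mem: "adj G u v \<Longrightarrow> x \<in> VG \<Longrightarrow> x \<in> edg u v \<longleftrightarrow> x = u \<or> x = v"
  using edg[of u v] ends_iff[of x "edg u v"] by auto

lemma square_cyc:
  assumes "square a b c d"
  shows "cyc (square_edges a b c d)" "VG \<inter> \<Union>(square_edges a b c d) = {a, b, c, d}"
proof -
  have L: "distinct [a, b, c, d]" "length [a, b, c, d] \<ge> 3" "set [a, b, c, d] \<subseteq> VG"
    "successively (adj G) ([a, b, c, d] @ [hd [a, b, c, d]])"
    using assms adj_ne unfolding square_def by auto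
  have e: "square_edges a b c d = pedges ([a, b, c, d] @ [hd [a, b, c, d]])" by (auto simp: square_edges_def)
  show "cyc (square_edges a b c d)" unfolding cyc_def using L e by blast
  show "VG \<inter> \<Union>(square_edges a b c d) = {a, b, c, d}" using cyc_list_verts[OF L] e by simp
qed

lemma square_at:
  assumes "square a b c d"
  shows "{e \<in> square_edges a b c d. a \<in> e} = {edg a b, edg a d}" "edg a b \<noteq> edg a d"
proof -
  have ad: "adj G a b" "adj G b c" "adj G c d" "adj G d a" "a \<noteq> c" "b \<noteq> d" using assms by (auto simp: square_def)
  have n: "a \<in> VG" "a \<noteq> b" "a \<noteq> d" using ad adj_ne by auto
  show "{e \<in> square_edges a b c d. a \<in> e} = {edg a b, edg a d}"
    using edg_mem[OF ad(1) n(1)] edg_mem[OF ad(2) n(1)] edg_mem[OF ad(3) n(1)] edg_mem[OF ad(4) n(1)]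
      ad n unfolding square_edges_def by (auto simp: edg_sym)
  show "edg a b \<noteq> edg a d"
    using edg_inject[OF ad(1) adj_sym[OF ad(4)]] ad by (auto simp: doubleton_eq_iff)
qed

lemma square_deg:
  assumes "square a b c d" "x \<in> {a, b, c, d}"
  shows "deg (square_edges a b c d) x = 2"
proof -
  have *: "deg (square_edges a b c d) a = 2" if "square a b c d" for a b c d
    using square_at[OF that] by (simp add: deg_def)
  note r = square_rotate[OF assms(1)]
  note r2 = square_rotate[OF r]
  note r3 = square_rotate[OF r2]
  have q: "square_edges b c d a = square_edges a b c d" "square_edges c d a b = square_edges a b c d" "square_edges d a b c = square_edges a b c d"
    by (auto simp: square_edges_def)
  show ?thesis using assms(2) *[OF assms(1)] *[OF r] *[OF r2] *[OF r3] unfolding q by blast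
qed

text \<open>Rotating and reflecting the labels brings any chosen edge to the front, in either
  direction.\<close>

lemma square_with_edge:
  assumes "square a b c d" "edg x y \<in> square_edges a b c d" "adj G x y"
  obtains z t where "square x y z t" "square_edges x y z t = square_edges a b c d"
proof -
  have *: "\<exists>z t. square x y z t \<and> square_edges x y z t = square_edges a b c d"
    if s: "square a b c d" and e: "edg x y = edg a b" for a b c d
  proof -
    have "adj G a b" using s by (simp add: square_def)
    then have "{x, y} = {a, b}" using edg_inject[OF assms(3)] e by blast
    then consider "x = a" "y = b" | "x = b" "y = a" by (auto simp: doubleton_eq_iff)
    then show ?thesis
    proof cases
      case 1 then show ?thesis using s by blast
    next
      case 2 then show ?thesis using square_flip[OF s] square_edges_flip by blast
    qed
  qed
  note r = square_rotate[OF assms(1)]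
  note r2 = square_rotate[OF r]
  note r3 = square_rotate[OF r2]
  have q: "square_edges b c d a = square_edges a b c d" "square_edges c d a b = square_edges a b c d" "square_edges d a b c = square_edges a b c d"
    by (auto simp: square_edges_def)
  have "edg x y = edg a b \<or> edg x y = edg b c \<or> edg x y = edg c d \<or> edg x y = edg d a"
    using assms(2) by (simp add: square_edges_def)
  then have "\<exists>z t. square x y z t \<and> square_edges x y z t = square_edges a b c d"
    using *[OF assms(1)] *[OF r] *[OF r2] *[OF r3] unfolding q by blast
  then show ?thesis using that by blast
qed

lemma edge_not_singleton: "e \<in> EG \<Longrightarrow> ends G e \<subseteq> {x} \<Longrightarrow> False"
  using edge_ends[of e] by (metis insert_subset singletonD)

lemma gpath_deg_hd:
  assumes "gpath p q R" "p \<noteq> q"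
  shows "deg (pedges R) p = 1"
proof -
  obtain X where X: "R = p # X @ [q]" using bigon_shape[OF assms] .
  then obtain v r where R: "R = p # v # r" by (cases X) auto
  have g: "successively (adj G) (v # r)" "p \<notin> set (v # r)" "adj G p v" "p \<in> VG"
    using assms R by (auto simp: gpath_def)
  have "p \<notin> e" if "e \<in> pedges (v # r)" for e
    using pedges_props[OF g(1) that] g(2,4) ends_iff by blast
  then have "{e \<in> pedges R. p \<in> e} = {edg p v}"
    using R edg_mem[OF g(3,4)] by auto
  then show ?thesis by (simp add: deg_def)
qed

lemma gpath_deg_last:
  assumes "gpath p q R" "p \<noteq> q"
  shows "deg (pedges R) q = 1"
  using gpath_deg_hd[OF gpath_rev[OF assms(1)]] assms(2) by (simp add: pedges_rev)

lemma gpath_deg_mid: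
  assumes R: "gpath p q R" and x: "x \<in> set R" "x \<noteq> p" "x \<noteq> q"
  shows "deg (pedges R) x = 2"
proof -
  obtain X Y where XY: "R = X @ x # Y" using x by (meson split_list)
  have X: "X \<noteq> []" "Y \<noteq> []" using XY x R by (auto simp: gpath_def)
  have s: "successively (adj G) (X @ [x])" "successively (adj G) (x # Y)"
    using R XY successively_append_snoc[of "adj G" X x Y] by (auto simp: gpath_def)
  have hl: "hd (X @ [x]) = p" "last (x # Y) = q" using XY X R by (auto simp: gpath_def)
  have g: "gpath p x (X @ [x])" "gpath x q (x # Y)"
    using s R XY X hl by (auto simp: gpath_def)
  have "{e \<in> pedges R. x \<in> e} = {e \<in> pedges (X @ [x]). x \<in> e} \<union> {e \<in> pedges (x # Y). x \<in> e}"
    unfolding XY pedges_append[of X x Y] by blast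
  moreover have "{e \<in> pedges (X @ [x]). x \<in> e} \<inter> {e \<in> pedges (x # Y). x \<in> e} = {}"
  proof -
    have False if e: "e \<in> pedges (X @ [x])" "e \<in> pedges (x # Y)" for e
    proof -
      have "set (X @ [x]) \<inter> set (x # Y) = {x}" using R XY by (auto simp: gpath_def)
      then have "ends G e \<subseteq> {x}" "e \<in> EG"
        using pedges_props[OF s(1) e(1)] pedges_props[OF s(2) e(2)] by blast+
      then show False using edge_not_singleton by blast
    qed
    then show ?thesis by blast
  qed
  moreover have "finite (pedges L)" for L by (induction L rule: pedges.induct) auto
  ultimately have "deg (pedges R) x = deg (pedges (X @ [x])) x + deg (pedges (x # Y)) x"
    unfolding deg_def by (simp add: card_Un_disjoint)
  then show ?thesis using gpath_deg_last[OF g(1)] gpath_deg_hd[OF g(2)] x by simp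
qed

lemma vdegree_eq:
  assumes "x \<in> VG"
  shows "vdegree G x = deg EG x"
proof -
  have "bij_betw (edg x) {u \<in> VG. adj G x u} {e \<in> EG. x \<in> e}"
    unfolding bij_betw_def
  proof
    show "inj_on (edg x) {u \<in> VG. adj G x u}"
      using edg_inject by (auto simp: inj_on_def doubleton_eq_iff)
    show "edg x ` {u \<in> VG. adj G x u} = {e \<in> EG. x \<in> e}"
    proof
      show "edg x ` {u \<in> VG. adj G x u} \<subseteq> {e \<in> EG. x \<in> e}"
        using edg edg_mem[OF _ assms] by auto
      show "{e \<in> EG. x \<in> e} \<subseteq> edg x ` {u \<in> VG. adj G x u}"
        using edge_edg_at assms adj_ne by blast
    qed
  qed
  then show ?thesis unfolding vdegree_def deg_def by (rule bij_betw_same_card)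
qed

lemma finite_pedges: "finite (pedges L)"
  by (induction L rule: pedges.induct) auto

lemma card_pedges:
  "successively (adj G) L \<Longrightarrow> distinct L \<Longrightarrow> card (pedges L) = length L - 1"
proof (induction L rule: pedges.induct)
  case (1 u v r)
  have "edg u v \<notin> pedges (v # r)"
    using pedges_props[of "v # r" "edg u v"] 1(2,3) edg[of u v] by auto
  then show ?case using 1 finite_pedges by simp
qed auto

text \<open>Inclusion and exclusion: the halves cover the edges of the disc and have exactly those
  of \<open>R\<close> in common.\<close>

lemma theta_deg:
  assumes "bigon p q P Q" "bigon p q P R" "bigon p q Q R"
    and "\<Union>(pedges R) \<inter> inside (\<Union>(pedges P \<union> pedges Q)) \<noteq> {}"
  shows "deg (region (pedges P \<union> pedges R)) x + deg (region (pedges Q \<union> pedges R)) x =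
    deg (region (pedges P \<union> pedges Q)) x + deg (pedges R) x"
proof -
  note t = theta[OF assms]
  have f: "finite {e \<in> region C. x \<in> e}" for C using finite_region by simp
  have eqs: "{e \<in> region (pedges P \<union> pedges R). x \<in> e} \<union> {e \<in> region (pedges Q \<union> pedges R). x \<in> e} =
     {e \<in> region (pedges P \<union> pedges Q). x \<in> e}"
    "{e \<in> region (pedges P \<union> pedges R). x \<in> e} \<inter> {e \<in> region (pedges Q \<union> pedges R). x \<in> e} =
     {e \<in> pedges R. x \<in> e}"
    using t(1,2) by blast+
  show ?thesis unfolding deg_def by (subst card_Un_Int[OF f f]) (simp only: eqs)
qed

text \<open>An inner vertex of \<open>P\<close> is on the outer cycle and hence not inside it, while
  the half bounded by \<open>Q\<close> and \<open>R\<close> consists of these two paths and of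
  points inside the outer cycle.\<close>

lemma theta_deg_far:
  assumes "bigon p q P Q" "bigon p q P R" "bigon p q Q R"
    and "\<Union>(pedges R) \<inter> inside (\<Union>(pedges P \<union> pedges Q)) \<noteq> {}"
    and x: "x \<in> set P" "x \<noteq> p" "x \<noteq> q"
  shows "deg (region (pedges Q \<union> pedges R)) x = 0"
proof -
  have g: "gpath p q P" "gpath p q Q" "gpath p q R" "p \<noteq> q" "set P \<inter> set Q = {p, q}" "set P \<inter> set R = {p, q}"
    using assms by (auto simp: bigon_def)
  have xV: "x \<in> VG" "x \<in> \<Union>(pedges P)" using gpath_verts[OF g(1,4)] x by auto
  have "x \<notin> \<Union>(pedges Q)" "x \<notin> \<Union>(pedges R)"
    using gpath_verts[OF g(2,4)] gpath_verts[OF g(3,4)] xV g x by blast+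
  moreover have "x \<notin> inside (\<Union>(pedges Q \<union> pedges R))"
    using theta(4)[OF assms(1-4)] xV(2) inside_no_overlap[of "\<Union>(pedges P \<union> pedges Q)"] by blast
  ultimately have "x \<notin> disc (pedges Q \<union> pedges R)" by (auto simp: disc_def)
  then have "{e \<in> region (pedges Q \<union> pedges R). x \<in> e} = {}" by (auto simp: region_def)
  then show ?thesis unfolding deg_def by (simp only: card.empty)
qed

lemma bigon_verts:
  assumes "bigon p q P Q"
  shows "VG \<inter> \<Union>(pedges P \<union> pedges Q) = set P \<union> set Q"
proof -
  have g: "gpath p q P" "gpath p q Q" "p \<noteq> q" using assms by (auto simp: bigon_def)
  show ?thesis using gpath_verts[OF g(1,3)] gpath_verts[OF g(2,3)] by blast
qed

text \<open>An open edge that ends at an inside vertex comes arbitrarily close to it and does not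
  cross the cycle, so it stays inside. Degrees in the disc are therefore full degrees at inside
  vertices.\<close>

lemma inside_star:
  assumes "cyc C" "x \<in> VG" "x \<in> inside (\<Union>C)" "e \<in> EG" "x \<in> e"
  shows "e \<in> region C"
proof (rule region_eint[OF assms(1,4)])
  have "e \<notin> C" using assms(3,5) inside_no_overlap by blast
  then have d: "eint e \<inter> \<Union>C = {}" using eint_sub_Union[OF assms(4) cyc_sub[OF assms(1)]] by blast
  have "x \<in> closure (eint e)" using eint_props assms by blast
  then have "eint e \<inter> inside (\<Union>C) \<noteq> {}"
    using cyc_Jordan(2)[OF assms(1)] assms(3) by (metis Int_commute closure_iff_nhds_not_empty order_refl)
  moreover have "eint e \<subseteq> inside (\<Union>C) \<or> eint e \<subseteq> outside (\<Union>C)"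
    using connected_subset_inside_or_outside[OF eint_props(1)[OF assms(4)] d] .
  ultimately have "eint e \<subseteq> inside (\<Union>C)" using inside_Int_outside[of "\<Union>C"] by blast
  then show "eint e \<subseteq> disc C" by (auto simp: disc_def)
qed

text \<open>The outside of \<open>C\<close> is connected, unbounded and misses \<open>C'\<close>, so
  it lies outside \<open>C'\<close> and the discs are nested. Equal regions would make the discs and
  hence the outsides equal, and the frontier of the outside determines the cycle.\<close>

lemma region_smaller:
  assumes "cyc C" "cyc C'" "C' \<subseteq> region C" "C' \<noteq> C"
  shows "card (region C') < card (region C)"
proof -
  have disc_out: "disc C = - outside (\<Union>C)" for C
    unfolding disc_def using inside_Un_outside[of "\<Union>C"] inside_Int_outside[of "\<Union>C"] outside_no_overlap[of "\<Union>C"] by blast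
  have sub: "disc C' \<subseteq> disc C" if "cyc C" "cyc C'" "C' \<subseteq> region C" for C C'
  proof -
    have "\<Union>C' \<subseteq> disc C" using that(3) by (auto simp: region_def)
    then have "outside (\<Union>C) \<inter> \<Union>C' = {}" unfolding disc_out by blast
    then have "outside (\<Union>C) \<subseteq> inside (\<Union>C') \<or> outside (\<Union>C) \<subseteq> outside (\<Union>C')"
      using connected_subset_inside_or_outside cyc_Jordan(6)[OF that(1)] by blast
    then have "outside (\<Union>C) \<subseteq> outside (\<Union>C')"
      using cyc_Jordan(7)[OF that(2)] cyc_Jordan(8)[OF that(1)] bounded_subset by blast
    then show ?thesis unfolding disc_out by blast
  qed
  have sub1: "disc C' \<subseteq> disc C" using sub assms by blast
  then have "region C' \<subseteq> region C" by (auto simp: region_def)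
  moreover have "region C' \<noteq> region C"
  proof
    assume "region C' = region C"
    then have "C \<subseteq> region C'" using cyc_region[OF assms(1)] by simp
    then have "disc C = disc C'" using sub[OF assms(2,1)] sub1 by blast
    then have "outside (\<Union>C) = outside (\<Union>C')" unfolding disc_out by simp
    then have U: "\<Union>C = \<Union>C'" by (metis cyc_Jordan(10) assms(1,2))
    have *: "D \<subseteq> D'" if D: "D \<subseteq> EG" "D' \<subseteq> EG" "\<Union>D = \<Union>D'" for D D'
    proof
      fix e assume e: "e \<in> D"
      then have eE: "e \<in> EG" using D(1) by blast
      obtain x where x: "x \<in> eint e" using eint_props(2)[OF eE] by blast
      then have "x \<in> \<Union>D'" using e eint_sub[of e] D(3) by blast
      then show "e \<in> D'" using eint_sub_Union[OF eE D(2) x] by blast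
    qed
    have "C = C'"
      using *[OF cyc_sub[OF assms(1)] cyc_sub[OF assms(2)] U]
        *[OF cyc_sub[OF assms(2)] cyc_sub[OF assms(1)] U[symmetric]] by (rule equalityI)
    then show False using assms by simp
  qed
  ultimately show ?thesis using finite_region psubset_card_mono by blast
qed

end

section \<open>Cutting discs into faces\<close>

context nquad
begin

text \<open>The unbounded outer face lies outside \<open>C\<close>, and its closure cannot reach the
  open inside.\<close>

lemma inside_internal:
  assumes "cyc C" "x \<in> VG" "x \<in> inside (\<Union>C)"
  shows "x \<in> internal_verts G"
proof -
  have "outer_face G \<inter> \<Union>C = {}" using face_props(4)[OF outer_faces] cyc_support[OF assms(1)] by blast
  then have "outer_face G \<subseteq> inside (\<Union>C) \<or> outer_face G \<subseteq> outside (\<Union>C)"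
    using connected_subset_inside_or_outside face_props(2)[OF outer_faces] by blast
  moreover have "\<not> bounded (outer_face G)" using outer_iff by blast
  ultimately have "outer_face G \<inter> inside (\<Union>C) = {}"
    using cyc_Jordan(7)[OF assms(1)] bounded_subset inside_Int_outside[of "\<Union>C"] by blast
  then have "closure (outer_face G) \<inter> inside (\<Union>C) = {}"
    using cyc_Jordan(2)[OF assms(1)] open_Int_closure_eq_empty by blast
  then have "x \<notin> frontier (outer_face G)" using assms(3) by (auto simp: frontier_def)
  then show ?thesis using assms(2) by (auto simp: internal_verts_def boundary_verts_def)
qed

lemma internal_sq:
  assumes "F \<in> internal_faces G"
  obtains a b c d where "square a b c d" "face_edges F = square_edges a b c d"
proof -
  have F: "F \<in> faces G" using assms internal_bounded by blast
  obtain vs where vs: "is_cycle G vs" "frontier F = \<Union>(cycle_edges G vs)" "length vs = 4"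
    using face_list[OF F] assms by metis
  obtain a b c d where abcd: "vs = [a, b, c, d]"
    using vs(3) by (auto simp: numeral_eq_Suc length_Suc_conv)
  have i: "i < 4 \<longleftrightarrow> i = 0 \<or> i = Suc 0 \<or> i = Suc (Suc 0) \<or> i = Suc (Suc (Suc 0))" for i :: nat by auto
  have al: "(\<forall>i<length vs. P i) \<longleftrightarrow> P 0 \<and> P (Suc 0) \<and> P (Suc (Suc 0)) \<and> P (Suc (Suc (Suc 0)))" for P
    using vs(3) i by auto
  have ex: "(\<exists>i<length vs. P i) \<longleftrightarrow> P 0 \<or> P (Suc 0) \<or> P (Suc (Suc 0)) \<or> P (Suc (Suc (Suc 0)))" for P
    using vs(3) i by auto
  have s: "square a b c d" using vs(1) unfolding is_cycle_def al square_def by (simp add: abcd)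
  have ed: "e \<in> EG \<and> ends G e = {x, y} \<longleftrightarrow> e = edg x y" if "adj G x y" for e x y
    using edg[OF that] edg_eq by blast
  have ad: "adj G a b" "adj G b c" "adj G c d" "adj G d a" using s by (simp_all add: square_def)
  have "e \<in> cycle_edges G vs \<longleftrightarrow> e \<in> square_edges a b c d" for e
  proof -
    have "e \<in> cycle_edges G vs \<longleftrightarrow> (e \<in> EG \<and> ends G e = {a, b}) \<or> (e \<in> EG \<and> ends G e = {b, c}) \<or>
        (e \<in> EG \<and> ends G e = {c, d}) \<or> (e \<in> EG \<and> ends G e = {d, a})"
      unfolding cycle_edges_def mem_Collect_eq ex conj_disj_distribL by (simp add: abcd)
    then show ?thesis
      unfolding ed[OF ad(1)] ed[OF ad(2)] ed[OF ad(3)] ed[OF ad(4)] square_edges_def insert_iff empty_iff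
      by simp
  qed
  then have "cycle_edges G vs = square_edges a b c d" by blast
  then have "face_edges F = square_edges a b c d" using face_edges_eq[OF cyc_sub[OF is_cycle_cyc(1)[OF vs(1)]] vs(2)] by simp
  then show ?thesis using that s by blast
qed

lemma inner_face_internal:
  assumes "cyc C" "F \<in> faces G" "F \<subseteq> inside (\<Union>C)"
  shows "F \<in> internal_faces G" "face_edges F \<subseteq> region C"
proof -
  have "bounded F" using assms cyc_Jordan(7) bounded_subset by blast
  then show "F \<in> internal_faces G" using outer_iff assms(2) by (auto simp: internal_faces_def)
  have "closure F \<subseteq> disc C" using assms disc_closure closure_mono by metis
  then show "face_edges F \<subseteq> region C"
    using face_edges_closure[OF assms(2)] face_edges_sub[of F] unfolding region_def by blast
qed

text \<open>The inside of \<open>C\<close> is connected and avoids the frontier of \<open>F\<close>,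
  so \<open>F\<close> fills it.\<close>

lemma inner_face_full:
  assumes C: "cyc C" and F: "F \<in> faces G" "F \<subseteq> inside (\<Union>C)" "face_edges F \<subseteq> C"
  shows "face_edges F = C"
proof -
  have "inside (\<Union>C) \<inter> \<Union>(face_edges F) = {}" using F(3) inside_no_overlap[of "\<Union>C"] by blast
  then have "inside (\<Union>C) \<subseteq> F"
    using face_side[OF F(1) cyc_Jordan(3)[OF C]] F(2) face_props(3)[OF F(1)] by blast
  then have "F = inside (\<Union>C)" using F(2) by blast
  then have "frontier F = \<Union>C" using cyc_Jordan(9)[OF C] by simp
  then show ?thesis using face_edges_eq[OF cyc_sub[OF C]] by blast
qed

lemma face_region:
  assumes "F \<in> internal_faces G"
  shows "region (face_edges F) = face_edges F"
proof
  have F: "F \<in> faces G" using assms internal_bounded by blast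
  show "face_edges F \<subseteq> region (face_edges F)" using cyc_region[OF face_cyc(1)[OF F]] .
  show "region (face_edges F) \<subseteq> face_edges F"
  proof
    fix e assume "e \<in> region (face_edges F)"
    then have e: "e \<in> EG" "e \<subseteq> \<Union>(face_edges F) \<union> F"
      using internal_inside[OF assms] by (auto simp: region_def disc_def)
    have "e \<inter> F = {}" using face_props(4)[OF F] edge_support[OF e(1)] by blast
    then have "e \<subseteq> \<Union>(face_edges F)" using e by blast
    moreover obtain x where "x \<in> eint e" using eint_props[OF e(1)] by blast
    ultimately show "e \<in> face_edges F" using eint_sub_Union[OF e(1) face_edges_sub] eint_sub by blast
  qed
qed

text \<open>The rest of the square, \<open>b\<close>, \<open>c\<close>, \<open>d\<close>,
  \<open>a\<close>, is a path in the disc between two vertices of \<open>C\<close>; a piece of it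
  between consecutive visits to \<open>C\<close> that is not an edge of \<open>C\<close> is the
  chord. The cases are which of \<open>c\<close> and \<open>d\<close> lie on
  \<open>C\<close>.\<close>

lemma chord_exists:
  assumes C: "cyc C" and s: "square a b c d" "square_edges a b c d \<subseteq> region C" "edg a b \<in> C" "\<not> square_edges a b c d \<subseteq> C"
  obtains p q R where "gpath p q R" "p \<noteq> q" "p \<in> \<Union>C" "q \<in> \<Union>C" "(set R - {p, q}) \<inter> \<Union>C = {}"
    "pedges R \<subseteq> region C" "pedges R \<inter> C = {}"
proof -
  have ad: "adj G a b" "adj G b c" "adj G c d" "adj G d a" "a \<noteq> c" "b \<noteq> d" using s by (auto simp: square_def)
  have n: "a \<in> VG" "b \<in> VG" "c \<in> VG" "d \<in> VG" "a \<noteq> b" "b \<noteq> c" "c \<noteq> d" "d \<noteq> a" using ad adj_ne by auto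
  have mem: "u \<in> edg u v" "v \<in> edg u v" if "adj G u v" for u v using edg[OF that] ends_iff by blast+
  have ab: "a \<in> \<Union>C" "b \<in> \<Union>C" using mem[OF ad(1)] s(3) by blast+
  have reg: "edg b c \<in> region C" "edg c d \<in> region C" "edg d a \<in> region C" using s(2) by (auto simp: square_edges_def)
  have nC: "edg u v \<notin> C" if "adj G u v" "u \<notin> \<Union>C \<or> v \<notin> \<Union>C" for u v
    using mem[OF that(1)] that(2) by blast
  show ?thesis
  proof (cases "c \<in> \<Union>C"; cases "d \<in> \<Union>C")
    assume cd: "c \<in> \<Union>C" "d \<in> \<Union>C"
    obtain x y where xy: "adj G x y" "edg x y \<in> region C" "edg x y \<notin> C" "x \<in> \<Union>C" "y \<in> \<Union>C"
      using s(3,4) reg ad cd ab unfolding square_edges_def by blast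
    show ?thesis by (rule that[of x y "[x, y]"]) (use xy adj_ne in \<open>auto simp: gpath_def\<close>)
  next
    assume "c \<in> \<Union>C" "d \<notin> \<Union>C"
    then show ?thesis using nC[of c d] nC[of d a] ab n ad reg
      by (intro that[of c a "[c, d, a]"]) (auto simp: gpath_def)
  next
    assume "c \<notin> \<Union>C" "d \<in> \<Union>C"
    then show ?thesis using nC[of c d] nC[of b c] ab n ad reg
      by (intro that[of b d "[b, c, d]"]) (auto simp: gpath_def)
  next
    assume "c \<notin> \<Union>C" "d \<notin> \<Union>C"
    then show ?thesis using nC[of c d] nC[of b c] nC[of d a] ab n ad reg
      by (intro that[of b a "[b, c, d, a]"]) (auto simp: gpath_def)
  qed
qed

text \<open>Every cycle arises from bounding cycles of internal faces by gluing along paths. The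
  face inside \<open>C\<close> at one of its edges is either the whole inside or yields a chord, and
  each half lacks the edges of the opposite side of \<open>C\<close>.\<close>

lemma cyc_induct [consumes 1, case_names face chord]:
  assumes "cyc C"
    and face: "\<And>F. F \<in> internal_faces G \<Longrightarrow> \<Phi> (face_edges F)"
    and chord: "\<And>p q P Q R. \<lbrakk>bigon p q P Q; bigon p q P R; bigon p q Q R;
       \<Union>(pedges R) \<inter> inside (\<Union>(pedges P \<union> pedges Q)) \<noteq> {};
       \<Phi> (pedges P \<union> pedges R); \<Phi> (pedges Q \<union> pedges R)\<rbrakk> \<Longrightarrow> \<Phi> (pedges P \<union> pedges Q)"
  shows "\<Phi> C"
  using assms(1)
proof (induction "card (region C)" arbitrary: C rule: less_induct)
  case less
  obtain p where "p \<in> \<Union>C" using cyc_two_verts[OF less.prems] by metis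
  then obtain e where e: "e \<in> C" by blast
  obtain F where F: "F \<in> faces G" "F \<subseteq> inside (\<Union>C)" "e \<in> face_edges F"
    using side_face_ex1[OF less.prems e disjI1[OF refl]] by blast
  note Fi = inner_face_internal[OF less.prems F(1,2)]
  show ?case
  proof (cases "face_edges F \<subseteq> C")
    case True
    then show ?thesis using inner_face_full[OF less.prems F(1,2) True] face[OF Fi(1)] by simp
  next
    case False
    obtain a b c d where "square a b c d" "face_edges F = square_edges a b c d" using internal_sq[OF Fi(1)] .
    moreover obtain u v where uv: "adj G u v" "e = edg u v"
      using edge_edg cyc_sub[OF less.prems] e by blast
    ultimately obtain z t where s: "square u v z t" "square_edges u v z t = face_edges F"
      using square_with_edge[of a b c d u v] F(3) by metis
    obtain p q R where R: "gpath p q R" "p \<noteq> q" "p \<in> \<Union>C" "q \<in> \<Union>C" "(set R - {p, q}) \<inter> \<Union>C = {}"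
      "pedges R \<subseteq> region C" "pedges R \<inter> C = {}"
      using chord_exists[OF less.prems s(1)] s(2) Fi(2) e uv False by metis
    have pq: "p \<in> VG" "q \<in> VG" "{p, q} \<subseteq> set R" using R(1) hd_in_set[of R] last_in_set[of R] by (auto simp: gpath_def)
    obtain P Q where PQ: "bigon p q P Q" "C = pedges P \<union> pedges Q"
      using cyc_split[OF less.prems pq(1,2) R(3,4,2)] .
    have PQs: "set P \<subseteq> \<Union>C" "set Q \<subseteq> \<Union>C" using bigon_verts[OF PQ(1)] PQ(2) by blast+
    have bg: "gpath p q P" "gpath p q Q" "set P \<inter> set Q = {p, q}" "pedges P \<inter> pedges Q = {}" using PQ by (auto simp: bigon_def)
    have "set P \<inter> set R = {p, q}" "set Q \<inter> set R = {p, q}" using PQs R(5) pq bg by blast+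
    then have b: "bigon p q P R" "bigon p q Q R" using R PQ(2) bg by (auto simp: bigon_def)
    obtain e' where e': "e' \<in> pedges R" using gpath_verts[OF R(1,2)] pq by blast
    then have e'E: "e' \<in> EG" "e' \<notin> C" "e' \<in> region C" using R by (auto simp: region_def)
    obtain x where x: "x \<in> eint e'" using eint_props[OF e'E(1)] by blast
    have "x \<notin> \<Union>C" using eint_sub_Union[OF e'E(1) cyc_sub[OF less.prems] x] e'E(2) by blast
    then have "x \<in> inside (\<Union>C)" using e'E(3) x eint_sub[of e'] unfolding region_def disc_def by blast
    then have m: "\<Union>(pedges R) \<inter> inside (\<Union>(pedges P \<union> pedges Q)) \<noteq> {}"
      using e' x eint_sub PQ(2) by blast
    have m': "\<Union>(pedges R) \<inter> inside (\<Union>(pedges Q \<union> pedges P)) \<noteq> {}" using m by (simp add: Un_commute)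
    have smaller: "card (region (pedges P \<union> pedges R)) < card (region (pedges P \<union> pedges Q))"
      if "bigon p q P Q" "bigon p q P R" "bigon p q Q R"
        "\<Union>(pedges R) \<inter> inside (\<Union>(pedges P \<union> pedges Q)) \<noteq> {}" for P Q
    proof -
      note th = theta[OF that]
      have "pedges Q \<subseteq> region (pedges Q \<union> pedges R)"
        using cyc_region[OF bigon_cyc[OF that(3)]] by blast
      moreover have "pedges Q \<inter> pedges R = {}" using that(3) by (simp add: bigon_def)
      moreover have "pedges Q \<noteq> {}"
      proof -
        have "gpath p q Q" using that(3) by (simp add: bigon_def)
        then show ?thesis using gpath_verts[OF _ R(2), of Q] by (auto simp: gpath_def)
      qed
      ultimately have "region (pedges P \<union> pedges R) \<subset> region (pedges P \<union> pedges Q)"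
        using th(1,2) by blast
      then show ?thesis using finite_region psubset_card_mono by blast
    qed
    have "\<Phi> (pedges P \<union> pedges R)"
      using less.hyps[OF _ bigon_cyc[OF b(1)]] smaller[OF PQ(1) b m] PQ(2) by blast
    moreover have "\<Phi> (pedges Q \<union> pedges R)"
      using less.hyps[OF _ bigon_cyc[OF b(2)]] smaller[OF bigon_sym[OF PQ(1)] b(2,1) m'] PQ(2)
      by (simp add: Un_commute)
    ultimately show ?thesis using chord[OF PQ(1) b m] PQ(2) by simp
  qed
qed

text \<open>Faces have 4 edges, and the length of the outer cycle of a theta is the sum of the
  lengths of the two inner ones minus twice that of \<open>R\<close>.\<close>

lemma cyc_even: "cyc C \<Longrightarrow> even (card C)"
proof (induction rule: cyc_induct)
  case (face F)
  obtain a b c d where s: "square a b c d" "face_edges F = square_edges a b c d" using internal_sq[OF face] .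
  have n: "a \<noteq> b" "b \<noteq> c" "c \<noteq> d" "d \<noteq> a" "a \<noteq> c" "b \<noteq> d" using s(1) adj_ne unfolding square_def by auto
  have "card (pedges [a, b, c, d]) = 3"
    using card_pedges[of "[a, b, c, d]"] s(1) n by (auto simp: square_def)
  moreover have "edg d a \<notin> pedges [a, b, c, d]"
    using s(1) n edg_inject by (auto simp: square_def doubleton_eq_iff)
  moreover have "face_edges F = insert (edg d a) (pedges [a, b, c, d])" using s(2) by (auto simp: square_edges_def)
  ultimately show ?case using finite_pedges by simp
next
  case (chord p q P Q R)
  have "pedges P \<inter> pedges Q = {}" "pedges P \<inter> pedges R = {}" "pedges Q \<inter> pedges R = {}"
    using chord by (auto simp: bigon_def)
  then show ?case using chord by (auto simp: card_Un_disjoint finite_pedges)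
qed

end

locale nq4 = nquad +
  assumes deg4: "\<forall>v\<in>internal_verts G. vdegree G v \<ge> 4"
begin

text \<open>Let \<open>g\<close>, \<open>g1\<close>, \<open>g2\<close> be the terms for the whole
  disc and its halves. Inner vertices of \<open>P\<close> and \<open>Q\<close> keep their terms. At
  \<open>p\<close> and at \<open>q\<close> the sum \<open>g1 + g2\<close> exceeds \<open>g\<close>
  by 2, as \<open>R\<close> has degree 1 there. At inner vertices of \<open>R\<close> it is at most
  0. The bounds for the halves add up to 8, and the excess of 4 from the two ends leaves 4.\<close>

lemma gauss_bonnet: "cyc C \<Longrightarrow> 4 \<le> (\<Sum>x\<in>VG \<inter> \<Union>C. 3 - int (deg (region C) x))"
proof (induction rule: cyc_induct)
  case (face F)
  obtain a b c d where s: "square a b c d" "face_edges F = square_edges a b c d" using internal_sq[OF face] .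
  have n: "a \<noteq> b" "b \<noteq> c" "c \<noteq> d" "d \<noteq> a" "a \<noteq> c" "b \<noteq> d" using s(1) adj_ne unfolding square_def by auto
  have reg: "region (square_edges a b c d) = square_edges a b c d" using face_region[OF face] s(2) by simp
  \<comment> \<open>Each corner has degree 2 and contributes 1, so a single face attains
    equality.\<close>
  have "(\<Sum>x\<in>VG \<inter> \<Union>(face_edges F). 3 - int (deg (region (face_edges F)) x)) = (\<Sum>x\<in>{a, b, c, d}. 1)"
    unfolding s(2) reg square_cyc(2)[OF s(1)]
    by (rule sum.cong) (simp_all add: square_deg[OF s(1)])
  then show ?case using n by simp
next
  case (chord p q P Q R)
  note th = chord(1-4)
  define g g1 g2 where "g x = 3 - int (deg (region (pedges P \<union> pedges Q)) x)"
    and "g1 x = 3 - int (deg (region (pedges P \<union> pedges R)) x)"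
    and "g2 x = 3 - int (deg (region (pedges Q \<union> pedges R)) x)" for x
  have gps: "gpath p q P" "gpath p q Q" "gpath p q R" "p \<noteq> q" "set P \<inter> set Q = {p, q}" "set P \<inter> set R = {p, q}"
    "set Q \<inter> set R = {p, q}" using th by (auto simp: bigon_def)
  define A B I where "A = set P - {p, q}" and "B = set Q - {p, q}" and "I = set R - {p, q}"
  have sets: "set P = {p, q} \<union> A" "set Q = {p, q} \<union> B" "set R = {p, q} \<union> I"
    using gps unfolding A_def B_def I_def by blast+
  have dis: "A \<inter> B = {}" "A \<inter> I = {}" "B \<inter> I = {}" "A \<inter> {p, q} = {}" "B \<inter> {p, q} = {}" "I \<inter> {p, q} = {}"
    using gps unfolding A_def B_def I_def by blast+
  have fin: "finite A" "finite B" "finite I" "finite {p, q}" by (auto simp: A_def B_def I_def)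
  have split3: "sum h ({p, q} \<union> X \<union> ({p, q} \<union> Y)) = sum h {p, q} + sum h X + sum h Y"
    if "finite X" "finite Y" "X \<inter> Y = {}" "X \<inter> {p, q} = {}" "Y \<inter> {p, q} = {}" for h :: "complex \<Rightarrow> int" and X Y
  proof -
    have "{p, q} \<union> X \<union> ({p, q} \<union> Y) = {p, q} \<union> (X \<union> Y)" by blast
    then show ?thesis using that by (simp only:) (subst sum.union_disjoint; auto simp: sum.union_disjoint)
  qed
  have gd: "g1 x + g2 x = g x + 3 - int (deg (pedges R) x)" for x
    using theta_deg[OF th, of x] unfolding g_def g1_def g2_def by linarith
  have deg_R: "deg (pedges R) x = 0" if "x \<in> VG" "x \<notin> set R" for x
  proof -
    have "{e \<in> pedges R. x \<in> e} = {}" using gpath_verts[OF gps(3,4)] that by blast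
    then show ?thesis unfolding deg_def by (simp only: card.empty)
  qed
  have gA: "g1 x = g x" if "x \<in> A" for x
  proof -
    have "x \<in> set P" "x \<noteq> p" "x \<noteq> q" using that by (auto simp: A_def)
    moreover have "deg (pedges R) x = 0"
    proof (rule deg_R)
      show "x \<in> VG" using gps(1) \<open>x \<in> set P\<close> unfolding gpath_def by blast
      show "x \<notin> set R" using that dis(2,4) sets(3) by blast
    qed
    ultimately show ?thesis using theta_deg_far[OF th] theta_deg[OF th, of x] unfolding g_def g1_def by simp
  qed
  have gB: "g2 x = g x" if "x \<in> B" for x
  proof -
    have x: "x \<in> set Q" "x \<noteq> p" "x \<noteq> q" using that by (auto simp: B_def)
    moreover have "deg (pedges R) x = 0"
    proof (rule deg_R)
      show "x \<in> VG" using gps(2) \<open>x \<in> set Q\<close> unfolding gpath_def by blast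
      show "x \<notin> set R" using that dis(3,5) sets(3) by blast
    qed
    moreover have "deg (region (pedges P \<union> pedges R)) x = 0"
      using theta_deg_far[OF bigon_sym[OF th(1)] th(3,2) _ x] th(4) by (simp add: Un_commute)
    ultimately show ?thesis using theta_deg[OF th, of x] unfolding g_def g2_def by simp
  qed
  have gpq: "g1 x + g2 x = g x + 2" if "x \<in> {p, q}" for x
    using gd[of x] gpath_deg_hd[OF gps(3,4)] gpath_deg_last[OF gps(3,4)] that by auto
  \<comment> \<open>The path \<open>R\<close> has degree 2 at \<open>x\<close>, so
    \<open>g1 x + g2 x\<close> equals 4 minus the full degree of \<open>x\<close>.\<close>
  have gI: "g1 x + g2 x \<le> 0" if x: "x \<in> I" for x
  proof -
    have xR: "x \<in> set R" "x \<noteq> p" "x \<noteq> q" using x by (auto simp: I_def)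
    have "x \<in> VG" "x \<in> \<Union>(pedges R) - {p, q}" using gpath_verts[OF gps(3,4)] xR by blast+
    then have xi: "x \<in> VG" "x \<in> inside (\<Union>(pedges P \<union> pedges Q))" using theta(5)[OF th] by blast+
    note cy = bigon_cyc[OF th(1)]
    have "deg EG x = deg (region (pedges P \<union> pedges Q)) x"
      using inside_star[OF cy xi] unfolding deg_def by (metis (no_types, lifting) region_def mem_Collect_eq)
    then have "deg (region (pedges P \<union> pedges Q)) x \<ge> 4"
      using deg4 inside_internal[OF cy xi] vdegree_eq[OF xi(1)] by metis
    then show ?thesis using gd[of x] gpath_deg_mid[OF gps(3) xR] unfolding g_def by linarith
  qed
  have V: "VG \<inter> \<Union>(pedges P \<union> pedges Q) = {p, q} \<union> A \<union> ({p, q} \<union> B)"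
    "VG \<inter> \<Union>(pedges P \<union> pedges R) = {p, q} \<union> A \<union> ({p, q} \<union> I)"
    "VG \<inter> \<Union>(pedges Q \<union> pedges R) = {p, q} \<union> B \<union> ({p, q} \<union> I)"
    using bigon_verts th sets by metis+
  have "8 \<le> sum g1 ({p, q} \<union> A \<union> ({p, q} \<union> I)) + sum g2 ({p, q} \<union> B \<union> ({p, q} \<union> I))"
    using chord(5,6) unfolding V g1_def g2_def by linarith
  also have "\<dots> = (sum g1 {p, q} + sum g2 {p, q}) + sum g1 A + sum g2 B + (sum g1 I + sum g2 I)"
    using split3[OF fin(1,3) dis(2,4,6), of g1] split3[OF fin(2,3) dis(3,5,6), of g2] by linarith
  also have "sum g1 {p, q} + sum g2 {p, q} = sum g {p, q} + 4"
    using gpq[of p] gpq[of q] gps(4) by simp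
  also have "sum g1 A = sum g A" using gA by simp
  also have "sum g2 B = sum g B" using gB by simp
  also have "sum g1 I + sum g2 I \<le> 0"
    unfolding sum.distrib[symmetric] using gI by (intro sum_nonpos) auto
  finally have "4 \<le> sum g {p, q} + sum g A + sum g B" by simp
  also have "\<dots> = sum g ({p, q} \<union> A \<union> ({p, q} \<union> B))" using split3[OF fin(1,2) dis(1,4,5), of g] by simp
  finally show ?case unfolding V g_def .
qed

end

section \<open>Graph distance and squares\<close>

context nquad
begin

text \<open>The two edges of the cycle at \<open>x\<close> count. Hence no term of the inequality
  exceeds 1, and the value 1 occurs exactly at vertices of degree 2 in the disc.\<close>

lemma deg_ge2:
  assumes "cyc C" "x \<in> VG" "x \<in> \<Union>C"
  shows "deg (region C) x \<ge> 2"
proof -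
  obtain q where q: "q \<in> VG" "q \<in> \<Union>C" "x \<noteq> q" using cyc_two_verts[OF assms(1)] by metis
  obtain P Q where PQ: "bigon x q P Q" "C = pedges P \<union> pedges Q"
    using cyc_split[OF assms(1,2) q(1) assms(3) q(2,3)] .
  have g: "gpath x q P" "gpath x q Q" "pedges P \<inter> pedges Q = {}" using PQ by (auto simp: bigon_def)
  have "{e \<in> C. x \<in> e} = {e \<in> pedges P. x \<in> e} \<union> {e \<in> pedges Q. x \<in> e}" using PQ by blast
  moreover have "{e \<in> pedges P. x \<in> e} \<inter> {e \<in> pedges Q. x \<in> e} = {}" using g(3) by blast
  ultimately have "deg C x = deg (pedges P) x + deg (pedges Q) x"
    unfolding deg_def by (simp add: card_Un_disjoint finite_pedges)
  then have "deg C x = 2" using gpath_deg_hd[OF g(1) q(3)] gpath_deg_hd[OF g(2) q(3)] by simp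
  moreover have "deg C x \<le> deg (region C) x"
    unfolding deg_def using cyc_region[OF assms(1)] finite_region by (intro card_mono) auto
  ultimately show ?thesis by simp
qed

text \<open>The square \<open>F\<close> already has two edges at \<open>x\<close>; if the disc has
  no more, every edge of the disc at \<open>x\<close> belongs to \<open>F\<close>.\<close>

lemma corner:
  assumes C: "cyc C" and F: "F \<in> faces G" "F \<subseteq> inside (\<Union>C)" "e \<in> face_edges F"
    and x: "x \<in> VG" "x \<in> e" "deg (region C) x \<le> 2" and e': "e' \<in> region C" "x \<in> e'"
  shows "e' \<in> face_edges F"
proof -
  note Fi = inner_face_internal[OF C F(1,2)]
  obtain a b c d where s: "square a b c d" "face_edges F = square_edges a b c d" using internal_sq[OF Fi(1)] .
  have "x \<in> {a, b, c, d}" using square_cyc(2)[OF s(1)] s(2) x F(3) by blast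
  then have "card {e \<in> face_edges F. x \<in> e} = 2" using square_deg[OF s(1)] s(2) by (simp add: deg_def)
  moreover have "{e \<in> face_edges F. x \<in> e} \<subseteq> {e \<in> region C. x \<in> e}" using Fi(2) by blast
  moreover have "finite {e \<in> region C. x \<in> e}" using finite_region by simp
  ultimately have "{e \<in> face_edges F. x \<in> e} = {e \<in> region C. x \<in> e}"
    using x(3) by (intro card_seteq) (simp_all add: deg_def)
  then show ?thesis using e' by blast
qed

lemma inner_face_at:
  assumes "cyc C" "e \<in> C"
  obtains F where "F \<in> faces G" "F \<subseteq> inside (\<Union>C)" "e \<in> face_edges F"
  using side_face_ex1[OF assms disjI1[OF refl]] by blast

lemma square_next:
  assumes "square a b c d" "adj G a y" "edg a y \<in> square_edges a b c d" "y \<noteq> b"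
  shows "y = d"
proof -
  have ad: "adj G a b" "adj G a d" using assms(1) adj_sym by (auto simp: square_def)
  have "a \<in> edg a y" using edg_mem[OF assms(2)] adj_ne[OF assms(2)] by blast
  then have "edg a y \<in> {edg a b, edg a d}" using square_at(1)[OF assms(1)] assms(3) by blast
  then show ?thesis using edg_inject[OF assms(2) ad(1)] edg_inject[OF assms(2) ad(2)] assms(4)
    by (auto simp: doubleton_eq_iff)
qed

lemma square_next':
  assumes "square a b c d" "adj G b y" "edg b y \<in> square_edges a b c d" "y \<noteq> a"
  shows "y = c"
  by (rule square_next[OF square_flip[OF assms(1)]]) (use assms square_edges_flip in auto)

lemma internal_sq_at:
  assumes F: "F \<in> internal_faces G" and "edg x y \<in> face_edges F" "adj G x y"
  obtains z t where "square x y z t" "face_edges F = square_edges x y z t"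
proof -
  obtain a b c d where "square a b c d" "face_edges F = square_edges a b c d" using internal_sq[OF F] .
  then show ?thesis using square_with_edge[of a b c d x y] assms that by metis
qed

text \<open>At each edge of the family two faces of the family are present, and an edge lies on no
  third face. So these faces are closed under adjacency and exhaust all faces by
  \<open>faces_spread\<close>, yet they do not include the outer face.\<close>

lemma no_closed_surface:
  assumes ne: "\<Q> \<noteq> {}" and faces: "\<And>C. C \<in> \<Q> \<Longrightarrow> \<exists>F\<in>internal_faces G. face_edges F = C"
    and closed: "\<And>C e. C \<in> \<Q> \<Longrightarrow> e \<in> C \<Longrightarrow> \<exists>C'\<in>\<Q>. C' \<noteq> C \<and> e \<in> C'"
  shows False
proof -
  define S where "S = {F \<in> internal_faces G. face_edges F \<in> \<Q>}"
  have SF: "S \<subseteq> faces G" using internal_bounded by (auto simp: S_def)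
  have "S \<noteq> {}"
  proof -
    obtain C where "C \<in> \<Q>" using ne by blast
    then obtain F where "F \<in> internal_faces G" "face_edges F = C" using faces by blast
    then have "F \<in> S" using \<open>C \<in> \<Q>\<close> by (simp add: S_def)
    then show ?thesis by blast
  qed
  moreover have "F' \<in> S" if F: "F \<in> S" "F' \<in> faces G" "e \<in> face_edges F" "e \<in> face_edges F'" for F F' e
  proof -
    have "face_edges F \<in> \<Q>" using F(1) by (simp add: S_def)
    then obtain C' where C': "C' \<in> \<Q>" "C' \<noteq> face_edges F" "e \<in> C'" using closed F(3) by blast
    obtain F1 where F1: "F1 \<in> internal_faces G" "face_edges F1 = C'" using faces[OF C'(1)] by blast
    have F1S: "F1 \<in> S" using F1 C' by (simp add: S_def)
    have FF: "F \<in> faces G" using SF F(1) by blast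
    obtain F2 where F2: "\<And>F''. F'' \<in> faces G \<Longrightarrow> e \<in> face_edges F'' \<Longrightarrow> F'' = F \<or> F'' = F2"
      using two_faces[OF FF F(3)] by metis
    have "F1 = F \<or> F1 = F2" using F2[of F1] F1 C' internal_bounded by blast
    then have "F1 = F2" using F1 C' by blast
    then show ?thesis using F2[OF F(2,4)] F1S F(1) by blast
  qed
  ultimately have "S = faces G" by (rule faces_spread[OF SF])
  then have "outer_face G \<in> S" using outer_faces by simp
  then show False by (simp add: S_def internal_faces_def)
qed

lemma square_edges_neI:
  assumes "square a b c d" "square a' b' c' d'" "x \<in> {a, b, c, d}" "x \<notin> {a', b', c', d'}"
  shows "square_edges a b c d \<noteq> square_edges a' b' c' d'"
  using square_cyc(2)[OF assms(1)] square_cyc(2)[OF assms(2)] assms(3,4) by metis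

section \<open>Distance, geodesics and parity\<close>

definition gd :: "complex \<Rightarrow> complex \<Rightarrow> nat" where
  "gd x y = (LEAST n. (adj G ^^ n) x y)"

text \<open>Connectedness provides some walk, so \<open>LEAST\<close> returns the length of an
  actual one.\<close>

lemma gd_rel:
  assumes "x \<in> VG" "y \<in> VG"
  shows "(adj G ^^ gd x y) x y"
proof -
  have "\<exists>n. (adj G ^^ n) x y" using reachable[OF assms] rtranclp_imp_relpowp by metis
  then show ?thesis unfolding gd_def by (rule LeastI_ex)
qed

lemma gd_le: "(adj G ^^ n) x y \<Longrightarrow> gd x y \<le> n"
  unfolding gd_def by (rule Least_le)

lemma gd_zero: "x \<in> VG \<Longrightarrow> y \<in> VG \<Longrightarrow> gd x y = 0 \<longleftrightarrow> x = y"
  using gd_rel[of x y] gd_le[of 0 x y] by auto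

lemma gd_step:
  assumes "x \<in> VG" "adj G a b"
  shows "gd x b \<le> Suc (gd x a)"
  using gd_le[OF relpowp_Suc_I[OF gd_rel assms(2)]] assms adj_ne by blast

lemma relpowp_adj_sym: "(adj G ^^ n) x y \<Longrightarrow> (adj G ^^ n) y x"
proof (induction n arbitrary: y)
  case (Suc n)
  obtain z where z: "(adj G ^^ n) x z" "adj G z y" using Suc.prems by (rule relpowp_Suc_E)
  show ?case by (rule relpowp_Suc_I2[OF adj_sym[OF z(2)] Suc.IH[OF z(1)]])
qed simp

lemma gd_sym:
  assumes "x \<in> VG" "y \<in> VG"
  shows "gd x y = gd y x"
  using gd_le[OF relpowp_adj_sym[OF gd_rel[OF assms]]] gd_le[OF relpowp_adj_sym[OF gd_rel[OF assms(2,1)]]]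
  by simp

lemma gd_one:
  assumes "x \<in> VG" "y \<in> VG"
  shows "gd x y = 1 \<longleftrightarrow> adj G x y"
proof
  assume "gd x y = 1"
  then have "(adj G ^^ 1) x y" using gd_rel[OF assms] by metis
  then show "adj G x y" by (simp only: relpowp_1)
next
  assume a: "adj G x y"
  then have "gd x y \<le> 1" by (intro gd_le) (simp only: relpowp_1)
  moreover have "gd x y \<noteq> 0" using gd_zero[OF assms] adj_ne[OF a] by blast
  ultimately show "gd x y = 1" by simp
qed

lemma gd_descend:
  assumes "x \<in> VG" "y \<in> VG" "x \<noteq> y"
  obtains z where "z \<in> VG" "adj G y z" "gd x y = Suc (gd x z)"
proof -
  obtain n where n: "gd x y = Suc n" using gd_zero[OF assms(1,2)] assms(3) by (cases "gd x y") auto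
  then have "(adj G ^^ Suc n) x y" using gd_rel[OF assms(1,2)] by simp
  then obtain z where z: "(adj G ^^ n) x z" "adj G z y" by (rule relpowp_Suc_E)
  have "gd x z \<le> n" using gd_le z by blast
  moreover have "gd x y \<le> Suc (gd x z)" using gd_step[OF assms(1) z(2)] .
  ultimately show ?thesis using that[of z] z(2) adj_sym adj_ne n by auto
qed

lemma gdist_gd: "x \<in> VG \<Longrightarrow> y \<in> VG \<Longrightarrow> gdist G x y = enat (gd x y)"
  unfolding gdist_def
proof (rule antisym)
  assume "x \<in> VG" "y \<in> VG"
  then show "(INF n\<in>{n. (adj G ^^ n) x y}. enat n) \<le> enat (gd x y)"
    using gd_rel by (intro INF_lower) simp
  show "enat (gd x y) \<le> (INF n\<in>{n. (adj G ^^ n) x y}. enat n)"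
    using gd_le by (intro INF_greatest) simp
qed

text \<open>A path descending towards \<open>x\<close> one level at each step; it may stop before
  reaching \<open>x\<close>.\<close>

definition geodesic :: "complex \<Rightarrow> complex list \<Rightarrow> bool" where
  "geodesic x P \<longleftrightarrow> P \<noteq> [] \<and> set P \<subseteq> VG \<and> successively (\<lambda>u v. adj G u v \<and> gd x u = Suc (gd x v)) P"

lemma geodesic_Cons:
  "geodesic x (u # P) \<longleftrightarrow> u \<in> VG \<and> (P = [] \<or> geodesic x P \<and> adj G u (hd P) \<and> gd x u = Suc (gd x (hd P)))"
  by (cases P) (auto simp: geodesic_def)

lemma geodesic_append: "geodesic x (X @ u # Y) \<longleftrightarrow> geodesic x (X @ [u]) \<and> geodesic x (u # Y)"
  unfolding geodesic_def successively_append_snoc[of _ X u Y] by auto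

lemma geodesic_below: "geodesic x (u # P) \<Longrightarrow> w \<in> set P \<Longrightarrow> gd x w < gd x u"
proof (induction P arbitrary: u)
  case (Cons y P)
  then show ?case using geodesic_Cons[of x u "y # P"] by fastforce
qed simp

lemma geodesic_inj: "geodesic x P \<Longrightarrow> u \<in> set P \<Longrightarrow> w \<in> set P \<Longrightarrow> gd x u = gd x w \<Longrightarrow> u = w"
proof (induction P)
  case (Cons y P)
  show ?case
  proof (cases "u = y \<or> w = y")
    case True
    then show ?thesis
      using geodesic_below[OF Cons.prems(1), of u] geodesic_below[OF Cons.prems(1), of w] Cons.prems(2-4) by auto
  next
    case False
    then have uw: "u \<in> set P" "w \<in> set P" using Cons.prems(2,3) by auto
    then have "geodesic x P" using Cons.prems(1) geodesic_Cons[of x y P] by auto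
    from Cons.IH[OF this uw Cons.prems(4)] show ?thesis .
  qed
qed simp

lemma geodesic_distinct: "geodesic x P \<Longrightarrow> distinct P"
proof (induction P)
  case (Cons y P)
  have "y \<notin> set P" using geodesic_below[OF Cons.prems] by blast
  then show ?case using Cons geodesic_Cons[of x y P] by auto
qed simp

lemma geodesic_gp: "geodesic x P \<Longrightarrow> gpath (hd P) (last P) P"
  using geodesic_distinct unfolding gpath_def geodesic_def
  by (auto intro: successively_mono)

text \<open>Both vertices descend simultaneously until they coincide, at the latest in
  \<open>x\<close>. A vertex common to the two paths has the same level in both, hence the same
  position, so nothing is shared before the end.\<close>

lemma meet:
  assumes "x \<in> VG" "a \<in> VG" "b \<in> VG" "a \<noteq> b" "gd x a = gd x b"
  obtains z P Q where "geodesic x P" "geodesic x Q" "hd P = a" "hd Q = b" "last P = z" "last Q = z"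
    "set P \<inter> set Q = {z}" "length P = length Q"
proof -
  have "\<exists>z P Q. geodesic x P \<and> geodesic x Q \<and> hd P = a \<and> hd Q = b \<and> last P = z \<and> last Q = z \<and>
    set P \<inter> set Q = {z} \<and> length P = length Q"
    using assms(2-)
  proof (induction "gd x a" arbitrary: a b)
    case 0
    then show ?case using gd_zero[OF assms(1)] by metis
  next
    case (Suc n)
    have "x \<noteq> a" "x \<noteq> b" using Suc gd_zero[OF assms(1,1)] by auto
    obtain a1 where a1: "a1 \<in> VG" "adj G a a1" "gd x a = Suc (gd x a1)"
      using gd_descend[OF assms(1) Suc.prems(1) \<open>x \<noteq> a\<close>] .
    obtain b1 where b1: "b1 \<in> VG" "adj G b b1" "gd x b = Suc (gd x b1)"
      using gd_descend[OF assms(1) Suc.prems(2) \<open>x \<noteq> b\<close>] .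
    show ?case
    proof (cases "a1 = b1")
      case True
      have "geodesic x [a, a1]" "geodesic x [b, a1]" using a1 b1 True Suc.prems by (auto simp: geodesic_Cons)
      then show ?thesis using Suc.prems(3) by (intro exI[of _ a1] exI[of _ "[a, a1]"] exI[of _ "[b, a1]"]) auto
    next
      case False
      have "n = gd x a1" "gd x a1 = gd x b1" using Suc.hyps(2) Suc.prems(4) a1 b1 by simp_all
      from Suc.hyps(1)[OF this(1) a1(1) b1(1) False this(2)] obtain z P Q where
        PQ: "geodesic x P" "geodesic x Q" "hd P = a1" "hd Q = b1" "last P = z" "last Q = z" "set P \<inter> set Q = {z}"
        "length P = length Q" by blast
      have d: "geodesic x (a # P)" "geodesic x (b # Q)" using PQ a1 b1 Suc.prems by (auto simp: geodesic_Cons)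
      have "a \<notin> set Q" "b \<notin> set P"
        using geodesic_below[OF d(1), of b] geodesic_below[OF d(2), of a] Suc.prems(4) by auto
      then have i: "set (a # P) \<inter> set (b # Q) = {z}" using PQ(7) Suc.prems(3) by auto
      have "P \<noteq> []" "Q \<noteq> []" using PQ(1,2) by (simp_all add: geodesic_def)
      then have l: "last (a # P) = z" "last (b # Q) = z" "length (a # P) = length (b # Q)"
        using PQ(5,6,8) by simp_all
      show ?thesis
        by (rule exI[of _ z], rule exI[of _ "a # P"], rule exI[of _ "b # Q"])
          (intro conjI d i l list.sel)
    qed
  qed
  then show ?thesis using that by blast
qed

text \<open>Two descending paths of equal length from \<open>a\<close> and \<open>b\<close> would
  close up with the edge between \<open>a\<close> and \<open>b\<close> to a cycle of odd length,
  against \<open>cyc_even\<close>.\<close>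

lemma bip:
  assumes "x \<in> VG" "adj G a b"
  shows "gd x a \<noteq> gd x b"
proof
  assume eq: "gd x a = gd x b"
  have ab: "a \<in> VG" "b \<in> VG" "a \<noteq> b" using adj_ne[OF assms(2)] by auto
  obtain z P Q where PQ: "geodesic x P" "geodesic x Q" "hd P = a" "hd Q = b" "last P = z" "last Q = z"
    "set P \<inter> set Q = {z}" "length P = length Q" using meet[OF assms(1) ab eq] .
  have ne: "P \<noteq> []" "Q \<noteq> []" using PQ by (auto simp: geodesic_def)
  have inP: "a \<in> set P" "b \<in> set Q" "z \<in> set Q" using ne PQ hd_in_set last_in_set by blast+
  have az: "a \<noteq> z" using geodesic_inj[OF PQ(2) inP(2,3)] eq ab by auto
  have bQ: "gpath b z Q" "gpath a z P" using geodesic_gp[OF PQ(2)] geodesic_gp[OF PQ(1)] PQ by auto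
  have "a \<notin> set Q" using PQ(7) inP az by blast
  then have aQ: "gpath a z (a # Q)"
    using bQ(1) assms(2) ab by (cases Q) (auto simp: gpath_def)
  have len: "length P \<ge> 2" using gpath_len[OF bQ(2) az] .
  have "set P \<inter> set (a # Q) = {a, z}" using PQ(7) inP by auto
  then have b: "bigon a z P (a # Q)" using bigonI[OF bQ(2) aQ az] len PQ(8) by simp
  have "card (pedges P \<union> pedges (a # Q)) = card (pedges P) + card (pedges (a # Q))"
    using b by (intro card_Un_disjoint) (auto simp: bigon_def finite_pedges)
  also have "\<dots> = (length P - 1) + length P"
    using card_pedges[of P] card_pedges[of "a # Q"] bQ aQ PQ(8) by (auto simp: gpath_def)
  finally have "card (pedges P \<union> pedges (a # Q)) = Suc (2 * (length P - 1))" using len by simp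
  then show False using cyc_even[OF bigon_cyc[OF b]] by simp
qed

lemma gd_adj: "x \<in> VG \<Longrightarrow> adj G a b \<Longrightarrow> gd x a = Suc (gd x b) \<or> gd x b = Suc (gd x a)"
  using bip[of x a b] gd_step[of x a b] gd_step[of x b a] adj_sym by fastforce

end

section \<open>4-cycles bound faces\<close>

context nq4
begin

text \<open>Four terms, each at most 1, have sum at least 4, so every corner has degree 2 in the
  disc. The inner face at \<open>edg a b\<close> thus follows the 4-cycle beyond both
  \<open>a\<close> and \<open>b\<close> and is bounded by it.\<close>

lemma square_face:
  assumes s: "square a b c d"
  shows "\<exists>F\<in>internal_faces G. face_edges F = square_edges a b c d"
proof -
  define C where "C = square_edges a b c d"
  define h where "h x = 3 - int (deg (region C) x)" for x
  have C: "cyc C" "VG \<inter> \<Union>C = {a, b, c, d}" using square_cyc[OF s] by (simp_all add: C_def)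
  have ad: "adj G a b" "adj G b c" "adj G c d" "adj G d a" using s by (auto simp: square_def)
  have n: "a \<noteq> b" "b \<noteq> c" "c \<noteq> d" "d \<noteq> a" "a \<noteq> c" "b \<noteq> d" using s adj_ne unfolding square_def by auto
  have h1: "h x \<le> 1" if "x \<in> {a, b, c, d}" for x
    using deg_ge2[OF C(1)] that C(2) unfolding h_def by fastforce
  have "4 \<le> sum h {a, b, c, d}" using gauss_bonnet[OF C(1)] unfolding C(2) h_def .
  also have "sum h {a, b, c, d} = h a + h b + h c + h d" using n by simp
  finally have "h a = 1" "h b = 1" using h1[of a] h1[of b] h1[of c] h1[of d] by auto
  then have dg: "deg (region C) a \<le> 2" "deg (region C) b \<le> 2" by (auto simp: h_def)
  have eC: "edg a b \<in> C" "edg b c \<in> C" "edg a d \<in> C" by (auto simp: C_def square_edges_def edg_sym)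
  obtain F where F: "F \<in> faces G" "F \<subseteq> inside (\<Union>C)" "edg a b \<in> face_edges F" using inner_face_at[OF C(1) eC(1)] .
  have Fi: "F \<in> internal_faces G" using inner_face_internal[OF C(1) F(1,2)] by blast
  obtain z t where zt: "square a b z t" "face_edges F = square_edges a b z t" using internal_sq_at[OF Fi F(3) ad(1)] .
  have V: "a \<in> VG" "b \<in> VG" using adj_ne[OF ad(1)] by auto
  have m: "a \<in> edg a b" "b \<in> edg a b" "b \<in> edg b c" "a \<in> edg a d"
    using edg_mem ad adj_sym V by blast+
  have "edg b c \<in> face_edges F" "edg a d \<in> face_edges F"
    using corner[OF C(1) F V(2) m(2) dg(2) _ m(3)] corner[OF C(1) F V(1) m(1) dg(1) _ m(4)]
      cyc_region[OF C(1)] eC by blast+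
  then have "c = z" "d = t"
    using square_next'[OF zt(1) ad(2)] square_next[OF zt(1) adj_sym[OF ad(4)]] zt(2) n by metis+
  then show ?thesis using Fi zt by blast
qed

text \<open>The three 4-cycles through \<open>a\<close>, \<open>b\<close> and two of
  \<open>x\<close>, \<open>y\<close>, \<open>z\<close> are faces, and every edge lies on two of
  them: a sphere glued from three faces.\<close>

lemma no_K23:
  assumes "adj G a x" "adj G b x" "adj G a y" "adj G b y" "adj G a z" "adj G b z"
    "a \<noteq> b" "x \<noteq> y" "y \<noteq> z" "x \<noteq> z"
  shows False
proof -
  have s: "square a x b y" "square a y b z" "square a x b z" using assms adj_sym by (auto simp: square_def)
  have n: "a \<noteq> x" "a \<noteq> y" "a \<noteq> z" "b \<noteq> x" "b \<noteq> y" "b \<noteq> z" using assms adj_ne by auto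
  have d: "square_edges a x b y \<noteq> square_edges a y b z" "square_edges a x b y \<noteq> square_edges a x b z" "square_edges a y b z \<noteq> square_edges a x b z"
    using square_edges_neI[OF s(1,2), of x] square_edges_neI[OF s(1,3), of y] square_edges_neI[OF s(2,3), of y] n assms(7-10)
    by auto
  show False
  proof (rule no_closed_surface[of "{square_edges a x b y, square_edges a y b z, square_edges a x b z}"])
    show "\<exists>F\<in>internal_faces G. face_edges F = C" if "C \<in> {square_edges a x b y, square_edges a y b z, square_edges a x b z}" for C
      using that square_face s by blast
    show "\<exists>C'\<in>{square_edges a x b y, square_edges a y b z, square_edges a x b z}. C' \<noteq> C \<and> e \<in> C'"
      if Ce: "C \<in> {square_edges a x b y, square_edges a y b z, square_edges a x b z}" "e \<in> C" for C e
    proof -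
      have e: "edg x a = edg a x" "edg y a = edg a y" "edg z a = edg a z"
        "edg x b = edg b x" "edg y b = edg b y" "edg z b = edg b z" by (simp_all add: edg_sym)
      consider "C = square_edges a x b y" | "C = square_edges a y b z" | "C = square_edges a x b z" using Ce(1) by blast
      then show ?thesis
      proof cases
        case 1
        then have "e \<in> square_edges a y b z \<or> e \<in> square_edges a x b z" using Ce(2) by (auto simp: square_edges_def e)
        then show ?thesis using 1 d by blast
      next
        case 2
        then have "e \<in> square_edges a x b y \<or> e \<in> square_edges a x b z" using Ce(2) by (auto simp: square_edges_def e)
        then show ?thesis using 2 d by blast
      next
        case 3
        then have "e \<in> square_edges a x b y \<or> e \<in> square_edges a y b z" using Ce(2) by (auto simp: square_edges_def e)
        then show ?thesis using 3 d by blast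
      qed
    qed
  qed simp
qed

end

section \<open>The quadrangle condition\<close>

context nq4
begin

text \<open>The two paths meet only in their last vertex, which may lie anywhere above
  \<open>x\<close>; with the edges from \<open>v\<close> to \<open>a\<close> and \<open>b\<close>
  they close up to \<open>geo_cycle\<close>.\<close>

definition geo_pair :: "complex \<Rightarrow> complex \<Rightarrow> complex \<Rightarrow> complex list \<Rightarrow> complex list \<Rightarrow> bool" where
  "geo_pair x a b P Q \<longleftrightarrow> geodesic x P \<and> geodesic x Q \<and> hd P = a \<and> hd Q = b \<and> last P = last Q \<and>
     set P \<inter> set Q = {last P}"

definition geo_cycle :: "complex \<Rightarrow> complex list \<Rightarrow> complex list \<Rightarrow> complex set set" where
  "geo_cycle v P Q = pedges (v # P) \<union> pedges (v # Q)"

lemma geo_pair_sym: "geo_pair x a b P Q \<Longrightarrow> geo_pair x b a Q P"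
  unfolding geo_pair_def by (auto simp: Int_commute)

lemma geo_cycle_sym: "geo_cycle v P Q = geo_cycle v Q P"
  unfolding geo_cycle_def by (rule Un_commute)

context
  fixes x v :: complex
  assumes xV: "x \<in> VG"
begin

definition fork :: "complex \<Rightarrow> complex \<Rightarrow> bool" where
  "fork a b \<longleftrightarrow> adj G v a \<and> adj G v b \<and> a \<noteq> b \<and> gd x v = Suc (gd x a) \<and> gd x v = Suc (gd x b)"

lemma fork_sym: "fork a b \<Longrightarrow> fork b a"
  by (auto simp: fork_def)

lemma geo_ne:
  assumes f: "fork a b" and g: "geo_pair x a b P Q"
  shows "a \<in> set P" "b \<in> set Q" "last P \<in> set P" "last P \<in> set Q" "a \<noteq> last P" "b \<noteq> last P"
    "a \<notin> set Q" "b \<notin> set P" "v \<notin> set P" "v \<notin> set Q" "geodesic x (v # P)" "geodesic x (v # Q)"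
proof -
  have d: "geodesic x P" "geodesic x Q" "hd P = a" "hd Q = b" "last P = last Q" "set P \<inter> set Q = {last P}"
    using g by (auto simp: geo_pair_def)
  have ne: "P \<noteq> []" "Q \<noteq> []" using d(1,2) by (auto simp: geodesic_def)
  show in_sets: "a \<in> set P" "b \<in> set Q" "last P \<in> set P" "last P \<in> set Q"
    using hd_in_set[OF ne(1)] hd_in_set[OF ne(2)] last_in_set[OF ne(1)] last_in_set[OF ne(2)] d(3-5) by simp_all
  have ab: "gd x a = gd x b" "a \<noteq> b" using f by (auto simp: fork_def)
  show anQ: "a \<notin> set Q" using geodesic_inj[OF d(2) _ in_sets(2)] ab by blast
  show bnP: "b \<notin> set P" using geodesic_inj[OF d(1) _ in_sets(1)] ab by metis
  show "a \<noteq> last P" using anQ in_sets by blast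
  show "b \<noteq> last P" using bnP in_sets by blast
  show dv: "geodesic x (v # P)" "geodesic x (v # Q)"
    using d f adj_ne by (auto simp: geodesic_Cons fork_def)
  show "v \<notin> set P" using geodesic_below[OF dv(1)] by blast
  show "v \<notin> set Q" using geodesic_below[OF dv(2)] by blast
qed

lemma geo_bigon:
  assumes f: "fork a b" and g: "geo_pair x a b P Q"
  shows "bigon v (last P) (v # P) (v # Q)"
proof -
  note n = geo_ne[OF assms]
  have d: "last P = last Q" "set P \<inter> set Q = {last P}" "P \<noteq> []" "Q \<noteq> []" using g by (auto simp: geo_pair_def geodesic_def)
  have gpath: "gpath v (last P) (v # P)" "gpath v (last P) (v # Q)"
    using geodesic_gp[OF n(11)] geodesic_gp[OF n(12)] d by simp_all
  have "v \<noteq> last P" using n by blast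
  moreover have "set (v # P) \<inter> set (v # Q) = {v, last P}" using d n by auto
  moreover have "length P \<ge> 2" "length Q \<ge> 2"
  proof -
    have "gpath a (last P) P" "gpath b (last P) Q"
      using geodesic_gp[of x P] geodesic_gp[of x Q] g by (auto simp: geo_pair_def)
    then show "length P \<ge> 2" "length Q \<ge> 2" using gpath_len n by blast+
  qed
  ultimately show ?thesis using bigonI[OF gpath] by simp
qed

lemma geo_cyc: "fork a b \<Longrightarrow> geo_pair x a b P Q \<Longrightarrow> cyc (geo_cycle v P Q)"
  unfolding geo_cycle_def using bigon_cyc[OF geo_bigon] .

lemma geo_verts: "fork a b \<Longrightarrow> geo_pair x a b P Q \<Longrightarrow> VG \<inter> \<Union>(geo_cycle v P Q) = insert v (set P \<union> set Q)"
  unfolding geo_cycle_def using bigon_verts[OF geo_bigon] by auto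

text \<open>
  A face at a vertex \<open>y\<close> of degree 2 inside the cycle of two geodesics lets us push the geodesic
  through \<open>y\<close> across the face.
\<close>

lemma geo_reduce:
  assumes f: "fork a b" and g: "geo_pair x a b P Q"
    and y: "y \<in> set P" "y \<noteq> a" "y \<noteq> last P" "deg (region (geo_cycle v P Q)) y \<le> 2"
  obtains P' Q' where "geo_pair x a b P' Q'"
    "card (region (geo_cycle v P' Q')) < card (region (geo_cycle v P Q))"
proof -
  note goal = that
  define C where "C = geo_cycle v P Q"
  note n = geo_ne[OF f g]
  have d: "geodesic x P" "geodesic x Q" "hd P = a" "hd Q = b" "last P = last Q" "set P \<inter> set Q = {last P}"
    using g by (auto simp: geo_pair_def)
  obtain Z Y' where ZY: "P = Z @ y # Y'" using y(1) by (meson split_list)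
  have "Z \<noteq> []" "Y' \<noteq> []" using ZY y d(3) by auto
  then obtain X s t Y where XY: "P = X @ s # y # t # Y"
    using ZY by (metis append.assoc append_Cons append_Nil neq_Nil_conv rev_exhaust)
  have dps: "geodesic x (X @ [s])" "geodesic x (s # y # t # Y)"
    using d(1) geodesic_append[of x X s "y # t # Y"] unfolding XY by blast+
  have st: "adj G s y" "gd x s = Suc (gd x y)" "adj G y t" "gd x y = Suc (gd x t)" "geodesic x (t # Y)"
    using dps(2) by (auto simp: geodesic_Cons)
  have V: "s \<in> VG" "y \<in> VG" "t \<in> VG" using st adj_ne by auto
  note C = geo_cyc[OF f g, folded C_def]
  have pP: "pedges (v # P) = pedges (v # X @ [s]) \<union> {edg s y, edg y t} \<union> pedges (t # Y)"
    using pedges_append[of "v # X" s "y # t # Y"] unfolding XY by auto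
  have eC: "edg s y \<in> C" "edg y t \<in> C" unfolding C_def geo_cycle_def pP by auto
  obtain F where F: "F \<in> faces G" "F \<subseteq> inside (\<Union>C)" "edg s y \<in> face_edges F" using inner_face_at[OF C eC(1)] .
  note Fi = inner_face_internal[OF C F(1,2)]
  obtain t' w where tw: "square s y t' w" "face_edges F = square_edges s y t' w" using internal_sq_at[OF Fi(1) F(3) st(1)] .
  have m: "y \<in> edg s y" "y \<in> edg y t" using edg_mem st V by blast+
  \<comment> \<open>Degree 2 at \<open>y\<close> forces the face at \<open>edg s y\<close> to turn
    into \<open>edg y t\<close>, so its fourth corner \<open>w\<close> is a common neighbour of
    \<open>s\<close> and \<open>t\<close>.\<close>
  have "edg y t \<in> face_edges F" using corner[OF C F V(2) m(1) _ _ m(2)] y(4) cyc_region[OF C] eC(2) unfolding C_def by blast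
  moreover have "t \<noteq> s" using st by auto
  ultimately have "t = t'" using square_next'[OF tw(1) st(3)] tw(2) by blast
  then have sw: "adj G s w" "adj G w t" "w \<noteq> y" and ew: "edg s w \<in> region C" "edg w t \<in> region C"
    using tw Fi(2) adj_sym by (auto simp: square_def square_edges_def edg_sym)
  have wV: "w \<in> VG" using adj_ne sw by blast
  have gw: "gd x w = gd x y"
    \<comment> \<open>\<open>s\<close> is one level above \<open>y\<close> and \<open>t\<close> one
      level below, so their common neighbour \<open>w\<close> can only be on the level of
      \<open>y\<close>.\<close>
    using gd_step[OF xV adj_sym[OF sw(2)]] gd_step[OF xV adj_sym[OF sw(1)]] st by linarith
  have wP: "w \<notin> set P" using geodesic_inj[OF d(1) _ y(1) gw] sw(3) by blast
  have "gd x y < gd x v" using geodesic_below[OF n(11) y(1)] .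
  then have wv: "w \<noteq> v" using gw by auto
  have sP: "s \<in> set P" "t \<in> set P" using XY by auto
  have "s \<noteq> last P"
  proof
    assume "s = last P"
    then have "s = last (t # Y)" by (simp add: XY)
    then have "s \<in> set (y # t # Y)" by (metis last_in_set list.distinct(1) list.set_intros(2))
    then show False using geodesic_below[OF dps(2)] by blast
  qed
  then have sQ: "s \<notin> set Q" using d(6) sP by blast
  \<comment> \<open>This edge lies on the new cycle but not on the old one, which makes the region
    strictly smaller.\<close>
  have swC: "edg s w \<notin> C"
  proof
    assume "edg s w \<in> C"
    then consider "edg s w \<in> pedges (v # P)" | "edg s w \<in> pedges (v # Q)"
      unfolding C_def geo_cycle_def by blast
    then show False
    proof cases
      case 1
      then have "{s, w} \<subseteq> set (v # P)"
        using pedges_props[of "v # P"] geodesic_gp[OF n(11)] edg[OF sw(1)] unfolding gpath_def by metis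
      then show False using wP wv by simp
    next
      case 2
      then have "{s, w} \<subseteq> set (v # Q)"
        using pedges_props[of "v # Q"] geodesic_gp[OF n(12)] edg[OF sw(1)] unfolding gpath_def by metis
      then show False using sQ sP n by auto
    qed
  qed
  have Creg: "pedges (v # X @ [s]) \<subseteq> region C" "pedges (t # Y) \<subseteq> region C" "pedges (v # Q) \<subseteq> region C"
    using cyc_region[OF C] unfolding C_def geo_cycle_def pP by blast+
  have fin: ?thesis if g': "geo_pair x a b P' Q'" and sub: "geo_cycle v P' Q' \<subseteq> region C"
     and e: "edg s w \<in> geo_cycle v P' Q'" for P' Q'
  proof (rule goal[OF g'])
    show "card (region (geo_cycle v P' Q')) < card (region (geo_cycle v P Q))"
      using region_smaller[OF C geo_cyc[OF f g'] sub] e swC unfolding C_def by blast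
  qed
  show ?thesis
  proof (cases "w \<in> set Q")
    case False
    \<comment> \<open>\<open>w\<close> is off \<open>Q\<close> and takes the place of
      \<open>y\<close>.\<close>
    define P' where "P' = X @ s # w # t # Y"
    have "geodesic x (s # w # t # Y)" using st sw gw V wV by (auto simp: geodesic_Cons)
    then have dP': "geodesic x P'" unfolding P'_def using dps(1) geodesic_append[of x X s "w # t # Y"] by blast
    have h: "hd P' = a" using d(3) unfolding P'_def XY by (cases X) simp_all
    have l: "last P' = last P" unfolding P'_def XY by simp
    have "last P' \<in> set P'" using dP' by (intro last_in_set) (simp add: geodesic_def)
    moreover have "set P' \<subseteq> insert w (set P)" unfolding P'_def XY by auto
    ultimately have i: "set P' \<inter> set Q = {last P'}" using d(6) n(4) False unfolding l by blast
    have g': "geo_pair x a b P' Q" unfolding geo_pair_def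
      using dP' d(2,4,5) h l i by simp
    have pP': "pedges (v # P') = pedges (v # X @ [s]) \<union> {edg s w, edg w t} \<union> pedges (t # Y)"
      using pedges_append[of "v # X" s "w # t # Y"] unfolding P'_def by auto
    show ?thesis
      by (rule fin[OF g']) (use Creg ew in \<open>auto simp: geo_cycle_def pP'\<close>)
  next
    case True
    then obtain Q1 Q2 where Q12: "Q = Q1 @ w # Q2" by (meson split_list)
    \<comment> \<open>\<open>w\<close> lies on \<open>Q\<close>, so both paths are cut short there
      and \<open>w\<close> becomes their meeting vertex.\<close>
    define P' Q' where "P' = X @ s # [w]" and "Q' = Q1 @ [w]"
    have "geodesic x (s # [w])" using st sw gw V wV by (auto simp: geodesic_Cons)
    then have dP': "geodesic x P'" unfolding P'_def using dps(1) geodesic_append[of x X s "[w]"] by blast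
    have dQ': "geodesic x Q'" using d(2) geodesic_append[of x Q1 w Q2] unfolding Q'_def Q12 by blast
    have hds: "hd P' = a" "hd Q' = b" using d(3,4) unfolding P'_def XY Q'_def Q12 by (cases X; cases Q1; auto)+
    have "last P \<in> set (t # Y)" unfolding XY by simp
    then have lP: "last P \<notin> set (X @ [s])" using geodesic_distinct[OF d(1)] unfolding XY by auto
    have "set (X @ [s]) \<subseteq> set P" "set Q' \<subseteq> set Q" by (auto simp: XY Q'_def Q12)
    then have "set (X @ [s]) \<inter> set Q' \<subseteq> {last P}" using Int_mono[of "set (X @ [s])" "set P" "set Q'" "set Q"] d(6) by simp
    then have "set (X @ [s]) \<inter> set Q' = {}" using lP by blast
    then have "set P' \<inter> set Q' = {w}" unfolding P'_def Q'_def by auto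
    then have g': "geo_pair x a b P' Q'"
      using dP' dQ' hds by (simp add: geo_pair_def) (simp add: P'_def Q'_def)
    have pP': "pedges (v # P') = pedges (v # X @ [s]) \<union> {edg s w}"
      using pedges_append[of "v # X" s "[w]"] unfolding P'_def by auto
    have "pedges (v # Q') \<subseteq> pedges (v # Q)"
      using pedges_append[of "v # Q1" w Q2] unfolding Q'_def Q12 by auto
    then show ?thesis
      by (intro fin[OF g']) (use Creg ew in \<open>auto simp: geo_cycle_def pP'\<close>)
  qed
qed

text \<open>While an inner vertex of a path has degree 2 in the disc, \<open>geo_reduce\<close>
  shrinks the region. Otherwise only \<open>v\<close>, \<open>a\<close>, \<open>b\<close> and the
  meeting vertex can have positive terms, each at most 1, so all four have degree 2. The face at
  \<open>edg v a\<close> then contains \<open>b\<close> and the successor \<open>a1\<close> of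
  \<open>a\<close> on \<open>P\<close>, and \<open>a1\<close> is the vertex sought.\<close>

lemma geo_quad:
  assumes "fork a b" "geo_pair x a b P Q"
  shows "\<exists>w. adj G a w \<and> adj G b w \<and> gd x a = Suc (gd x w)"
  using assms
proof (induction "card (region (geo_cycle v P Q))" arbitrary: a b P Q rule: less_induct)
  case less
  note f = less.prems(1) and g = less.prems(2)
  define C where "C = geo_cycle v P Q"
  note C = geo_cyc[OF f g, folded C_def]
  note n = geo_ne[OF f g]
  have lastPQ: "last P = last Q" using g by (simp add: geo_pair_def)
  show ?case
  proof (cases "(\<exists>y\<in>set P - {a, last P}. deg (region C) y \<le> 2) \<or> (\<exists>y\<in>set Q - {b, last P}. deg (region C) y \<le> 2)")
    case True
    then consider y where "y \<in> set P" "y \<noteq> a" "y \<noteq> last P" "deg (region C) y \<le> 2"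
      | y where "y \<in> set Q" "y \<noteq> b" "y \<noteq> last P" "deg (region C) y \<le> 2" by blast
    then show ?thesis
    proof cases
      case 1
      obtain P' Q' where "geo_pair x a b P' Q'" "card (region (geo_cycle v P' Q')) < card (region (geo_cycle v P Q))"
        using geo_reduce[OF f g 1[unfolded C_def]] .
      then show ?thesis using less.hyps f by blast
    next
      case (2 y)
      note y = 2[unfolded C_def geo_cycle_sym[of v P Q] lastPQ]
      obtain Q' P' where "geo_pair x b a Q' P'" "card (region (geo_cycle v Q' P')) < card (region (geo_cycle v Q P))"
        using geo_reduce[OF fork_sym[OF f] geo_pair_sym[OF g] y] .
      then show ?thesis using less.hyps[of P' Q' a b] f geo_pair_sym
        by (metis geo_cycle_sym)
    qed
  next
    case False
    define z where "z = last P"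
    define h where "h y = 3 - int (deg (region C) y)" for y
    define K where "K = {v, a, b, z}"
    have ad: "adj G v a" "adj G v b" "a \<noteq> b" "gd x a = gd x b" using f by (auto simp: fork_def)
    have VC: "VG \<inter> \<Union>C = insert v (set P \<union> set Q)" using geo_verts[OF f g] by (simp add: C_def)
    have KV: "K \<subseteq> VG \<inter> \<Union>C" unfolding VC K_def z_def using n by blast
    have h1: "h y \<le> 1" if "y \<in> VG \<inter> \<Union>C" for y using deg_ge2[OF C, of y] that by (auto simp: h_def)
    have h0: "h y \<le> 0" if "y \<in> VG \<inter> \<Union>C - K" for y
    proof -
      have "\<not> deg (region C) y \<le> 2" using that False unfolding VC K_def z_def by blast
      then show ?thesis by (simp add: h_def)
    qed
    have "4 \<le> sum h (VG \<inter> \<Union>C)" using gauss_bonnet[OF C] by (simp add: h_def)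
    also have "sum h (VG \<inter> \<Union>C) = sum h (VG \<inter> \<Union>C - K) + sum h K"
      using finite_V KV by (intro sum.subset_diff) auto
    also have "sum h (VG \<inter> \<Union>C - K) \<le> 0" using h0 by (intro sum_nonpos) blast
    also have "sum h K = h v + h a + h b + h z"
    proof -
      have "v \<noteq> a" "v \<noteq> b" "v \<noteq> last P" using n(1-4,9,10) by blast+
      then show ?thesis using n(5,6) ad(3) unfolding K_def z_def by simp
    qed
    finally have "4 \<le> h v + h a + h b + h z" by simp
    moreover have "h v \<le> 1" "h a \<le> 1" "h b \<le> 1" "h z \<le> 1" using h1 KV unfolding K_def by blast+
    ultimately have "h v = 1" "h a = 1" by linarith+
    then have dg: "deg (region C) v \<le> 2" "deg (region C) a \<le> 2" by (auto simp: h_def)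
    have P1: "P \<noteq> []" "hd P = a" "Q \<noteq> []" "hd Q = b" using g by (auto simp: geo_pair_def geodesic_def)
    then obtain r where r: "P = a # r" by (cases P) auto
    have "r \<noteq> []" using r n(5) by auto
    then obtain a1 Y where Y: "P = a # a1 # Y" using r by (cases r) auto
    obtain q where q: "Q = b # q" using P1 by (cases Q) auto
    have "geodesic x P" using g by (simp add: geo_pair_def)
    then have a1: "adj G a a1" "gd x a = Suc (gd x a1)" unfolding Y by (auto simp: geodesic_Cons)
    have eC: "edg v a \<in> C" "edg a a1 \<in> C" "edg v b \<in> C"
      unfolding C_def geo_cycle_def Y q by auto
    obtain F where F: "F \<in> faces G" "F \<subseteq> inside (\<Union>C)" "edg v a \<in> face_edges F" using inner_face_at[OF C eC(1)] .
    note Fi = inner_face_internal[OF C F(1,2)]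
    obtain c d where cd: "square v a c d" "face_edges F = square_edges v a c d" using internal_sq_at[OF Fi(1) F(3) ad(1)] .
    have V: "v \<in> VG" "a \<in> VG" using adj_ne[OF ad(1)] by auto
    have m: "v \<in> edg v a" "a \<in> edg v a" "a \<in> edg a a1" "v \<in> edg v b"
      using edg_mem ad a1 V by blast+
    have "edg v b \<in> face_edges F" "edg a a1 \<in> face_edges F"
      using corner[OF C F V(1) m(1) dg(1) _ m(4)] corner[OF C F V(2) m(2) dg(2) _ m(3)]
        cyc_region[OF C] eC by blast+
    moreover have "v \<noteq> a1" using n(9) Y by auto
    ultimately have "b = d" "a1 = c"
      using square_next[OF cd(1) ad(2)] square_next'[OF cd(1) a1(1)] cd(2) ad(3) by metis+
    then have "adj G b a1" using cd(1) adj_sym by (auto simp: square_def)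
    then show ?thesis using a1 by blast
  qed
qed

end

lemma quadrangle_condition:
  assumes "x \<in> VG" "adj G v a" "adj G v b" "a \<noteq> b" "gd x v = Suc (gd x a)" "gd x v = Suc (gd x b)"
  obtains w where "w \<in> VG" "adj G a w" "adj G b w" "gd x a = Suc (gd x w)"
proof -
  have V: "a \<in> VG" "b \<in> VG" using assms adj_ne by auto
  have eq: "gd x a = gd x b" using assms by simp
  obtain z P Q where "geodesic x P" "geodesic x Q" "hd P = a" "hd Q = b" "last P = z" "last Q = z"
    "set P \<inter> set Q = {z}" using meet[OF assms(1) V assms(4) eq] by metis
  then have "geo_pair x a b P Q" by (auto simp: geo_pair_def)
  moreover have "fork x v a b" using assms by (auto simp: fork_def)
  ultimately obtain w where w: "adj G a w" "adj G b w" "gd x a = Suc (gd x w)"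
    using geo_quad[OF assms(1)] by blast
  then show ?thesis using that adj_ne by blast
qed

text \<open>The corner is completed to a cube. Seen from \<open>p\<close>, the vertex
  \<open>c\<close> has distance 3 and its neighbours \<open>q\<close> and \<open>r\<close> have
  distance 2, so the quadrangle condition yields an eighth vertex \<open>x\<close> adjacent to
  \<open>p\<close>, \<open>q\<close> and \<open>r\<close>. The six squares are faces that form a
  closed surface.\<close>

lemma no_cube:
  assumes ad: "adj G v a" "adj G v b" "adj G v c" "adj G a p" "adj G b p" "adj G b q" "adj G c q"
      "adj G a r" "adj G c r"
    and ne: "a \<noteq> b" "b \<noteq> c" "a \<noteq> c" "p \<noteq> v" "q \<noteq> v" "r \<noteq> v"
  shows False
proof -
  note sy = ad[THEN adj_sym]
  have V: "v \<in> VG" "a \<in> VG" "b \<in> VG" "c \<in> VG" "p \<in> VG" "q \<in> VG" "r \<in> VG" using ad adj_ne by blast+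
  \<comment> \<open>Otherwise \<open>v\<close> and \<open>p\<close> would have the three common
    neighbours \<open>a\<close>, \<open>b\<close>, \<open>c\<close>; \<open>q\<close> and
    \<open>r\<close> are treated alike.\<close>
  have nc: "\<not> adj G c p" using no_K23[of v a p b c] ad ne adj_sym by blast
  have na: "\<not> adj G a q" using no_K23[of v b q c a] ad ne adj_sym by blast
  have nb: "\<not> adj G b r" using no_K23[of v a r c b] ad ne adj_sym by blast
  have two: "gd u w = 2" if "adj G u m" "adj G m w" "u \<noteq> w" for u w m
  proof -
    have "u \<in> VG" "m \<in> VG" "w \<in> VG" using that adj_ne by blast+
    then show ?thesis
      using gd_adj[of u m w] that gd_one[of u m] gd_zero[of u w] by auto
  qed
  have three: "gd u w = 3" if "adj G u m" "gd w m = 2" "\<not> adj G u w" "w \<in> VG" for u m w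
  proof -
    have uV: "u \<in> VG" using that adj_ne by blast
    then have "gd w u = 3 \<or> gd w u = 1" using gd_adj[OF that(4,1)] that(2) by auto
    then show ?thesis using gd_sym[of u w] gd_one[of u w] uV that by auto
  qed
  have pq: "p \<noteq> q" "q \<noteq> r" "p \<noteq> r" using nc na nb ad by blast+
  have "gd p v = 2" using two[OF sy(4,1)] ne by blast
  then have pc: "gd p c = 3" using three[OF sy(3), of p] nc V gd_sym by metis
  have pq2: "gd p q = 2" "gd p r = 2" using two[OF sy(5) ad(6) pq(1)] two[OF sy(4) ad(8) pq(3)] by auto
  obtain x where x: "x \<in> VG" "adj G q x" "adj G r x" "gd p q = Suc (gd p x)"
    using quadrangle_condition[OF V(5) ad(7) ad(9) pq(2)] pc pq2 by auto
  have px: "adj G p x" using gd_one[OF V(5) x(1)] x(4) pq2 by simp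
  \<comment> \<open>The distance from \<open>v\<close> is even at \<open>v\<close>,
    \<open>p\<close>, \<open>q\<close>, \<open>r\<close> and odd at \<open>a\<close>,
    \<open>b\<close>, \<open>c\<close>, \<open>x\<close>, which separates the two groups.\<close>
  have par: "gd v a = 1" "gd v b = 1" "gd v c = 1" "gd v v = 0" "gd v p = 2" "gd v q = 2" "gd v r = 2"
    using ad two[OF ad(1,4)] two[OF ad(2,6)] two[OF ad(1,8)] ne gd_one gd_zero V by metis+
  have parx: "gd v x = 1 \<or> gd v x = 3" using gd_adj[OF V(1) px] par by auto
  have xa: "x \<noteq> a" "x \<noteq> b" "x \<noteq> c" using na nb nc x px adj_sym by blast+
  have odd: "a \<noteq> v" "a \<noteq> p" "a \<noteq> q" "a \<noteq> r" "b \<noteq> v" "b \<noteq> p" "b \<noteq> q" "b \<noteq> r"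
    "c \<noteq> v" "c \<noteq> p" "c \<noteq> q" "c \<noteq> r" "x \<noteq> v" "x \<noteq> p" "x \<noteq> q" "x \<noteq> r"
    using par parx by auto
  note D = ne pq xa odd
  note D = D D[symmetric]
  have s: "square v a p b" "square v b q c" "square v a r c" "square x p b q" "square x q c r" "square x p a r"
    using ad sy x px D adj_sym by (simp_all add: square_def)
  define \<Q> where "\<Q> = {square_edges v a p b, square_edges v b q c, square_edges v a r c, square_edges x p b q, square_edges x q c r, square_edges x p a r}"
  have d: "square_edges v a p b \<noteq> square_edges v b q c" "square_edges v a p b \<noteq> square_edges v a r c" "square_edges v a p b \<noteq> square_edges x p b q"
     "square_edges v a p b \<noteq> square_edges x p a r" "square_edges v b q c \<noteq> square_edges v a r c" "square_edges v b q c \<noteq> square_edges x p b q"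
     "square_edges v b q c \<noteq> square_edges x q c r" "square_edges v a r c \<noteq> square_edges x p a r" "square_edges v a r c \<noteq> square_edges x q c r"
     "square_edges x p b q \<noteq> square_edges x q c r" "square_edges x p b q \<noteq> square_edges x p a r" "square_edges x q c r \<noteq> square_edges x p a r"
    using square_edges_neI[OF s(1,2), of a] square_edges_neI[OF s(1,3), of p] square_edges_neI[OF s(1,4), of v] square_edges_neI[OF s(1,6), of v]
      square_edges_neI[OF s(2,3), of q] square_edges_neI[OF s(2,4), of v] square_edges_neI[OF s(2,5), of v] square_edges_neI[OF s(3,6), of v]
      square_edges_neI[OF s(3,5), of v] square_edges_neI[OF s(4,5), of p] square_edges_neI[OF s(4,6), of b] square_edges_neI[OF s(5,6), of q] D
    by simp_all
  have es: "edg a v = edg v a" "edg b v = edg v b" "edg c v = edg v c" "edg p a = edg a p" "edg p b = edg b p"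
    "edg q b = edg b q" "edg q c = edg c q" "edg r a = edg a r" "edg r c = edg c r" "edg p x = edg x p"
    "edg q x = edg x q" "edg r x = edg x r" by (rule edg_sym)+
  show False
  proof (rule no_closed_surface[of \<Q>])
    show "\<Q> \<noteq> {}" by (simp add: \<Q>_def)
    show "\<exists>F\<in>internal_faces G. face_edges F = C" if "C \<in> \<Q>" for C
      using that square_face s unfolding \<Q>_def by blast
    show "\<exists>C'\<in>\<Q>. C' \<noteq> C \<and> e \<in> C'" if Ce: "C \<in> \<Q>" "e \<in> C" for C e
    proof -
      have m: "C' \<in> \<Q> \<Longrightarrow> C' \<noteq> C \<Longrightarrow> e \<in> C' \<Longrightarrow> ?thesis" for C' by blast
      consider "C = square_edges v a p b" | "C = square_edges v b q c" | "C = square_edges v a r c" | "C = square_edges x p b q"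
        | "C = square_edges x q c r" | "C = square_edges x p a r" using Ce(1) unfolding \<Q>_def by blast
      then show ?thesis
      proof cases
        case 1
        have "e \<in> square_edges v a p b" using Ce(2) 1 by simp
        then have "e \<in> square_edges v b q c \<or> e \<in> square_edges v a r c \<or> e \<in> square_edges x p b q \<or> e \<in> square_edges x p a r"
          unfolding square_edges_def es insert_iff empty_iff by (elim disjE) simp_all
        then show ?thesis using d 1 m unfolding \<Q>_def by (metis insertI1 insertI2)
      next
        case 2
        have "e \<in> square_edges v b q c" using Ce(2) 2 by simp
        then have "e \<in> square_edges v a p b \<or> e \<in> square_edges v a r c \<or> e \<in> square_edges x p b q \<or> e \<in> square_edges x q c r"
          unfolding square_edges_def es insert_iff empty_iff by (elim disjE) simp_all
        then show ?thesis using d 2 m unfolding \<Q>_def by (metis insertI1 insertI2)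
      next
        case 3
        have "e \<in> square_edges v a r c" using Ce(2) 3 by simp
        then have "e \<in> square_edges v a p b \<or> e \<in> square_edges v b q c \<or> e \<in> square_edges x q c r \<or> e \<in> square_edges x p a r"
          unfolding square_edges_def es insert_iff empty_iff by (elim disjE) simp_all
        then show ?thesis using d 3 m unfolding \<Q>_def by (metis insertI1 insertI2)
      next
        case 4
        have "e \<in> square_edges x p b q" using Ce(2) 4 by simp
        then have "e \<in> square_edges v a p b \<or> e \<in> square_edges v b q c \<or> e \<in> square_edges x q c r \<or> e \<in> square_edges x p a r"
          unfolding square_edges_def es insert_iff empty_iff by (elim disjE) simp_all
        then show ?thesis using d 4 m unfolding \<Q>_def by (metis insertI1 insertI2)
      next
        case 5
        have "e \<in> square_edges x q c r" using Ce(2) 5 by simp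
        then have "e \<in> square_edges v b q c \<or> e \<in> square_edges v a r c \<or> e \<in> square_edges x p b q \<or> e \<in> square_edges x p a r"
          unfolding square_edges_def es insert_iff empty_iff by (elim disjE) simp_all
        then show ?thesis using d 5 m unfolding \<Q>_def by (metis insertI1 insertI2)
      next
        case 6
        have "e \<in> square_edges x p a r" using Ce(2) 6 by simp
        then have "e \<in> square_edges v a p b \<or> e \<in> square_edges v a r c \<or> e \<in> square_edges x p b q \<or> e \<in> square_edges x q c r"
          unfolding square_edges_def es insert_iff empty_iff by (elim disjE) simp_all
        then show ?thesis using d 6 m unfolding \<Q>_def by (metis insertI1 insertI2)
      qed
    qed
  qed
qed

text \<open>Both faces at such an edge are internal, and since an internal face is determined by its
  edges, their squares differ.\<close>

lemma internal_edge_squares: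
  assumes "adj G x y" "edg x y \<notin> face_edges (outer_face G)"
  obtains z t z' t' where "square x y z t" "square x y z' t'" "(z, t) \<noteq> (z', t')"
proof -
  have e: "edg x y \<in> EG" using edg[OF assms(1)] by blast
  obtain p where p: "p \<in> eint (edg x y)" using eint_props[OF e] by blast
  obtain F where F: "F \<in> faces G" "p \<in> \<Union>(face_edges F)"
    using point_on_face[of p] p eint_sub edge_support[OF e] by blast
  have eF: "edg x y \<in> face_edges F" using eint_sub_Union[OF e face_edges_sub p F(2)] .
  obtain F' where F': "F' \<in> faces G" "F' \<noteq> F" "edg x y \<in> face_edges F'" using two_faces[OF F(1) eF] by metis
  have i: "F \<in> internal_faces G" "F' \<in> internal_faces G"
    using F(1) F'(1) eF F'(3) assms(2) by (auto simp: internal_faces_def)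
  obtain z t where zt: "square x y z t" "face_edges F = square_edges x y z t" using internal_sq_at[OF i(1) eF assms(1)] .
  obtain z' t' where zt': "square x y z' t'" "face_edges F' = square_edges x y z' t'" using internal_sq_at[OF i(2) F'(3) assms(1)] .
  have "(z, t) \<noteq> (z', t')" using zt zt' F'(2) internal_inside i by (metis prod.inject)
  then show ?thesis using that zt zt' by blast
qed

text \<open>4-cycles are internal faces, and one of the two faces at this edge is the outer
  one.\<close>

lemma outer_edge_square:
  assumes e: "edg x y \<in> face_edges (outer_face G)" "adj G x y" and s: "square x y z t" "square x y z' t'"
  shows "square_edges x y z t = square_edges x y z' t'"
proof -
  obtain F where F: "F \<in> internal_faces G" "face_edges F = square_edges x y z t" using square_face[OF s(1)] by blast
  obtain F' where F': "F' \<in> internal_faces G" "face_edges F' = square_edges x y z' t'" using square_face[OF s(2)] by blast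
  have m: "edg x y \<in> face_edges F" "edg x y \<in> face_edges F'" using F F' by (auto simp: square_edges_def)
  have "F \<in> faces G" "F' \<in> faces G" "F \<noteq> outer_face G" "F' \<noteq> outer_face G"
    using F(1) F'(1) by (auto simp: internal_faces_def)
  then have "F = F'" using two_faces[OF outer_faces e(1)] m by metis
  then show ?thesis using F F' by simp
qed

lemma boundary_verts_eq: "boundary_verts G = VG \<inter> \<Union>(face_edges (outer_face G))"
  using face_cyc(2)[OF outer_faces] by (simp add: boundary_verts_def)

text \<open>Here topology ends and the metric argument takes over. For \<open>rich\<close>, an edge
  at an internal vertex is not on the outer cycle and so lies on two squares.\<close>

lemma peelable_gd: "peelable VG gd (boundary_verts G)"
proof
  show "finite VG" by (rule finite_V)
  show "boundary_verts G \<subseteq> VG" by (auto simp: boundary_verts_def)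
  show "gd x y = 0 \<longleftrightarrow> x = y" if "x \<in> VG" "y \<in> VG" for x y using gd_zero that .
  show "gd x y = gd y x" if "x \<in> VG" "y \<in> VG" for x y using gd_sym that .
  show "gd x a = Suc (gd x b) \<or> gd x b = Suc (gd x a)" if "x \<in> VG" "a \<in> VG" "b \<in> VG" "gd a b = 1" for x a b
    using gd_adj that gd_one by blast
  show "\<exists>z\<in>VG. gd y z = 1 \<and> gd x y = Suc (gd x z)" if "x \<in> VG" "y \<in> VG" "x \<noteq> y" for x y
    using gd_descend[OF that] gd_one that by metis
  show "\<exists>w\<in>VG. gd a w = 1 \<and> gd b w = 1 \<and> gd x a = Suc (gd x w)"
    if "x \<in> VG" "y \<in> VG" "a \<in> VG" "b \<in> VG" "a \<noteq> b" "gd y a = 1" "gd y b = 1"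
      "gd x y = Suc (gd x a)" "gd x y = Suc (gd x b)" for x y a b
    using quadrangle_condition[of x y a b] that gd_one by metis
  show "x = y \<or> x = z \<or> y = z"
    if "a \<in> VG" "b \<in> VG" "x \<in> VG" "y \<in> VG" "z \<in> VG" "a \<noteq> b" "gd a x = 1" "gd b x = 1" "gd a y = 1"
      "gd b y = 1" "gd a z = 1" "gd b z = 1" for a b x y z
    using no_K23[of a x b y z] that gd_one by blast
  show False
    if "v \<in> VG" "a \<in> VG" "b \<in> VG" "c \<in> VG" "p \<in> VG" "q \<in> VG" "r \<in> VG" "a \<noteq> b" "b \<noteq> c" "a \<noteq> c"
      "gd v a = 1" "gd v b = 1" "gd v c = 1" "p \<noteq> v" "q \<noteq> v" "r \<noteq> v" "gd a p = 1" "gd b p = 1"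
      "gd b q = 1" "gd c q = 1" "gd a r = 1" "gd c r = 1" for v a b c p q r
    by (rule no_cube[of v a b c p q r]) (use that gd_one in blast)+
  show "\<exists>z\<in>VG. \<exists>t\<in>VG. \<exists>z'\<in>VG. \<exists>t'\<in>VG. (z, t) \<noteq> (z', t') \<and> z \<noteq> x \<and> t \<noteq> y \<and> z' \<noteq> x \<and> t' \<noteq> y \<and>
      gd y z = 1 \<and> gd z t = 1 \<and> gd t x = 1 \<and> gd y z' = 1 \<and> gd z' t' = 1 \<and> gd t' x = 1"
    if "x \<in> VG" "y \<in> VG" "x \<notin> boundary_verts G" "gd x y = 1" for x y
  proof -
    have a: "adj G x y" using that gd_one by blast
    then have "x \<in> edg x y" using edg_mem that by blast
    then have "edg x y \<notin> face_edges (outer_face G)" using that(1,3) unfolding boundary_verts_eq by blast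
    then obtain z t z' t' where s: "square x y z t" "square x y z' t'" "(z, t) \<noteq> (z', t')"
      using internal_edge_squares[OF a] by metis
    have V: "z \<in> VG" "t \<in> VG" "z' \<in> VG" "t' \<in> VG" using s adj_ne by (auto simp: square_def)
    have one: "gd u w = 1" if "adj G u w" for u w using that gd_one adj_ne by blast
    have "z \<noteq> x" "t \<noteq> y" "z' \<noteq> x" "t' \<noteq> y" "gd y z = 1" "gd z t = 1" "gd t x = 1"
      "gd y z' = 1" "gd z' t' = 1" "gd t' x = 1"
      using s(1,2) one unfolding square_def by blast+
    then show ?thesis using V s(3) by blast
  qed
qed

end

section \<open>Boundary rigidity\<close>

text \<open>The edges of a 4-cycle as pairs of ends, matching the form of
  \<open>face_boundary\<close>.\<close>

definition quad_pairs :: "'a \<Rightarrow> 'a \<Rightarrow> 'a \<Rightarrow> 'a \<Rightarrow> 'a set set" where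
  "quad_pairs a b c d = {{a, b}, {b, c}, {c, d}, {d, a}}"

lemma image_quad_pairs: "(`) f ` quad_pairs a b c d = quad_pairs (f a) (f b) (f c) (f d)"
  by (simp add: quad_pairs_def)

text \<open>It turns a bijection between the boundaries of faces into one between the faces
  themselves.\<close>

lemma bij_betw_lift:
  assumes f: "inj_on f A" and g: "inj_on g B" and T: "bij_betw T (f ` A) (g ` B)"
  shows "\<exists>h. bij_betw h A B \<and> (\<forall>x\<in>A. T (f x) = g (h x))"
proof (intro exI conjI ballI)
  let ?h = "inv_into B g \<circ> (T \<circ> f)"
  have "bij_betw (T \<circ> f) A (g ` B)"
    using bij_betw_trans[OF inj_on_imp_bij_betw[OF f] T] .
  then show "bij_betw ?h A B"
    using bij_betw_trans bij_betw_inv_into[OF inj_on_imp_bij_betw[OF g]] by blast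
  show "T (f x) = g (?h x)" if "x \<in> A" for x
  proof -
    have "T (f x) \<in> g ` B" using T that by (auto simp: bij_betw_def)
    then show ?thesis by (simp add: f_inv_into_f)
  qed
qed

section \<open>Boundary cycle and faces read off from adjacency\<close>

context nq4
begin

lemma square_unique:
  assumes "square x y z t" "square x y z' t'" "square_edges x y z t = square_edges x y z' t'"
  shows "z = z' \<and> t = t'"
proof
  have e: "edg y z' \<in> square_edges x y z t" "edg x t' \<in> square_edges x y z t"
    unfolding assms(3) by (auto simp: square_edges_def edg_sym)
  have "adj G y z'" "z' \<noteq> x" "adj G x t'" "t' \<noteq> y" using assms(2) adj_sym by (auto simp: square_def)
  then show "z = z'" "t = t'" using square_next'[OF assms(1) _ e(1)] square_next[OF assms(1) _ e(2)] by auto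
qed

lemma boundary_cycle_fe: "boundary_cycle G = ends G ` face_edges (outer_face G)"
  by (simp add: boundary_cycle_def face_boundary_def face_edges_def)

text \<open>A boundary edge lies on one internal face and any other edge on two, and internal faces
  are 4-cycles. The right-hand side involves adjacency only, so isomorphisms preserve it.\<close>

lemma boundary_cycle_iff:
  assumes "adj G x y"
  shows "{x, y} \<in> boundary_cycle G \<longleftrightarrow>
    (\<forall>z t z' t'. square x y z t \<longrightarrow> square x y z' t' \<longrightarrow> z = z' \<and> t = t')"
proof -
  have "{x, y} \<in> boundary_cycle G \<longleftrightarrow> edg x y \<in> face_edges (outer_face G)"
  proof
    assume "{x, y} \<in> boundary_cycle G"
    then obtain e where "e \<in> face_edges (outer_face G)" "ends G e = {x, y}" unfolding boundary_cycle_fe by auto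
    then show "edg x y \<in> face_edges (outer_face G)" using edg_eq[of e x y] face_edges_sub by auto
  next
    assume "edg x y \<in> face_edges (outer_face G)"
    then show "{x, y} \<in> boundary_cycle G" unfolding boundary_cycle_fe using edg[OF assms] by blast
  qed
  also have "\<dots> \<longleftrightarrow> (\<forall>z t z' t'. square x y z t \<longrightarrow> square x y z' t' \<longrightarrow> z = z' \<and> t = t')"
  proof
    assume "edg x y \<in> face_edges (outer_face G)"
    then show "\<forall>z t z' t'. square x y z t \<longrightarrow> square x y z' t' \<longrightarrow> z = z' \<and> t = t'"
      using outer_edge_square[OF _ assms] square_unique by meson
  next
    assume *: "\<forall>z t z' t'. square x y z t \<longrightarrow> square x y z' t' \<longrightarrow> z = z' \<and> t = t'"
    show "edg x y \<in> face_edges (outer_face G)"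
    proof (rule ccontr)
      assume "edg x y \<notin> face_edges (outer_face G)"
      from internal_edge_squares[OF assms this]
      obtain z t z' t' where "square x y z t" "square x y z' t'" "(z, t) \<noteq> (z', t')" .
      then show False using * by blast
    qed
  qed
  finally show ?thesis .
qed

lemma boundary_cycle_pair:
  assumes "p \<in> boundary_cycle G"
  obtains x y where "adj G x y" "p = {x, y}"
proof -
  obtain e where e: "e \<in> face_edges (outer_face G)" "p = ends G e" using assms boundary_cycle_fe by auto
  then obtain x y where "adj G x y" "e = edg x y" using edge_edg face_edges_sub by blast
  then show ?thesis using that e edg by blast
qed

lemma face_boundary_fe: "face_boundary G F = ends G ` face_edges F"
  by (simp add: face_boundary_def face_edges_def)

lemma ends_sqe: "square a b c d \<Longrightarrow> ends G ` square_edges a b c d = quad_pairs a b c d"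
  by (simp add: square_def square_edges_def quad_pairs_def edg)

text \<open>\<open>internal_sq\<close> and \<open>square_face\<close> are the two inclusions; again
  the right-hand side depends on adjacency only.\<close>

lemma face_boundary_range:
  "face_boundary G ` internal_faces G = {quad_pairs a b c d |a b c d. square a b c d}"
proof (intro equalityI subsetI)
  fix X assume "X \<in> face_boundary G ` internal_faces G"
  then obtain F where F: "F \<in> internal_faces G" "X = ends G ` face_edges F" unfolding face_boundary_fe by blast
  obtain a b c d where "square a b c d" "face_edges F = square_edges a b c d" using internal_sq[OF F(1)] .
  then show "X \<in> {quad_pairs a b c d |a b c d. square a b c d}" using F ends_sqe by auto
next
  fix X assume "X \<in> {quad_pairs a b c d |a b c d. square a b c d}"
  then obtain a b c d where s: "square a b c d" "X = quad_pairs a b c d" by blast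
  obtain F where "F \<in> internal_faces G" "face_edges F = square_edges a b c d" using square_face[OF s(1)] by blast
  then show "X \<in> face_boundary G ` internal_faces G"
    using s ends_sqe by (metis face_boundary_fe imageI)
qed

text \<open>Edges are determined by their ends, and an internal face is the inside of its
  edges.\<close>

lemma face_boundary_inj: "inj_on (face_boundary G) (internal_faces G)"
proof (rule inj_onI)
  fix F F' assume F: "F \<in> internal_faces G" "F' \<in> internal_faces G" "face_boundary G F = face_boundary G F'"
  have "inj_on (ends G) EG" using ends_inj by (auto simp: inj_on_def)
  then have "face_edges F = face_edges F'" using F(3) face_edges_sub unfolding face_boundary_fe by (simp add: inj_on_image_eq_iff)
  then show "F = F'" using internal_inside F by metis
qed

lemma boundary_nonempty: "boundary_verts G \<noteq> {}"
  using cyc_two_verts[OF face_cyc(1)[OF outer_faces]] unfolding boundary_verts_eq by blast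

end

theorem theorem1p2:
  fixes Q\<^sub>1 Q\<^sub>2 :: plane_graph and \<phi> :: "complex \<Rightarrow> complex"
  assumes "near_quadrangulation Q\<^sub>1"
    and "near_quadrangulation Q\<^sub>2"
    and "\<forall>v\<in>internal_verts Q\<^sub>1. vdegree Q\<^sub>1 v \<ge> 4"
    and "\<forall>v\<in>internal_verts Q\<^sub>2. vdegree Q\<^sub>2 v \<ge> 4"
    and "bij_betw \<phi> (boundary_verts Q\<^sub>1) (boundary_verts Q\<^sub>2)"
    and "\<forall>u\<in>boundary_verts Q\<^sub>1. \<forall>v\<in>boundary_verts Q\<^sub>1.
           gdist Q\<^sub>1 u v = gdist Q\<^sub>2 (\<phi> u) (\<phi> v)"
  shows "\<exists>\<psi>. graph_iso Q\<^sub>1 Q\<^sub>2 \<psi> \<and>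
             (\<forall>v\<in>boundary_verts Q\<^sub>1. \<psi> v = \<phi> v) \<and>
             carries_boundary_cycle Q\<^sub>1 Q\<^sub>2 \<psi> \<and>
             carries_internal_faces Q\<^sub>1 Q\<^sub>2 \<psi>"
proof -
  interpret A: nq4 Q\<^sub>1
    by unfold_locales (use assms in \<open>auto simp: near_quadrangulation_def\<close>)
  interpret B: nq4 Q\<^sub>2
    by unfold_locales (use assms in \<open>auto simp: near_quadrangulation_def\<close>)
  obtain u where u: "u \<in> boundary_verts Q\<^sub>1" using A.boundary_nonempty by blast
  have sub: "boundary_verts Q\<^sub>1 \<subseteq> verts Q\<^sub>1" "boundary_verts Q\<^sub>2 \<subseteq> verts Q\<^sub>2"
    by (auto simp: boundary_verts_def)
  have dist: "B.gd (\<phi> x) (\<phi> y) = A.gd x y" if "x \<in> boundary_verts Q\<^sub>1" "y \<in> boundary_verts Q\<^sub>1" for x y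
  proof -
    have m: "x \<in> verts Q\<^sub>1" "y \<in> verts Q\<^sub>1" "\<phi> x \<in> verts Q\<^sub>2" "\<phi> y \<in> verts Q\<^sub>2"
      using that sub bij_betwE[OF assms(5)] by blast+
    have "gdist Q\<^sub>1 x y = gdist Q\<^sub>2 (\<phi> x) (\<phi> y)" using assms(6) that by blast
    then show ?thesis using A.gdist_gd[OF m(1,2)] B.gdist_gd[OF m(3,4)] by simp
  qed
  obtain \<psi> where \<psi>: "bij_betw \<psi> (verts Q\<^sub>1) (verts Q\<^sub>2)" "\<forall>x\<in>boundary_verts Q\<^sub>1. \<psi> x = \<phi> x"
    "\<forall>x\<in>verts Q\<^sub>1. \<forall>y\<in>verts Q\<^sub>1. B.gd (\<psi> x) (\<psi> y) = 1 \<longleftrightarrow> A.gd x y = 1"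
    using peelable_rigid[OF A.peelable_gd B.peelable_gd u assms(5) dist] by blast
  have inj: "inj_on \<psi> (verts Q\<^sub>1)" and im: "\<psi> ` verts Q\<^sub>1 = verts Q\<^sub>2" using \<psi>(1) by (auto simp: bij_betw_def)
  have adj: "adj Q\<^sub>1 x y \<longleftrightarrow> adj Q\<^sub>2 (\<psi> x) (\<psi> y)" if "x \<in> verts Q\<^sub>1" "y \<in> verts Q\<^sub>1" for x y
  proof -
    have "\<psi> x \<in> verts Q\<^sub>2" "\<psi> y \<in> verts Q\<^sub>2" using im that by blast+
    then show ?thesis using \<psi>(3) A.gd_one[OF that] B.gd_one[of "\<psi> x" "\<psi> y"] that by blast
  qed
  have eq: "\<psi> x = \<psi> y \<longleftrightarrow> x = y" if "x \<in> verts Q\<^sub>1" "y \<in> verts Q\<^sub>1" for x y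
    using inj_on_eq_iff[OF inj that] .
  have Asq: "{a, b, c, d} \<subseteq> verts Q\<^sub>1" if "A.square a b c d" for a b c d
    using that A.adj_ne unfolding A.square_def by blast
  have Bsq: "{a, b, c, d} \<subseteq> verts Q\<^sub>2" if "B.square a b c d" for a b c d
    using that B.adj_ne unfolding B.square_def by blast
  have square: "A.square a b c d \<longleftrightarrow> B.square (\<psi> a) (\<psi> b) (\<psi> c) (\<psi> d)" if "{a, b, c, d} \<subseteq> verts Q\<^sub>1" for a b c d
    using that adj eq unfolding A.square_def B.square_def by auto
  have lift: "\<exists>x\<in>verts Q\<^sub>1. y = \<psi> x" if "y \<in> verts Q\<^sub>2" for y using im that by blast
  \<comment> \<open>\<open>\<psi>\<close> and its inverse take 4-cycles to 4-cycles, so an edge and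
    its image agree on whether two different squares pass through them.\<close>
  have pair: "{x, y} \<in> boundary_cycle Q\<^sub>1 \<longleftrightarrow> {\<psi> x, \<psi> y} \<in> boundary_cycle Q\<^sub>2" if xy: "adj Q\<^sub>1 x y" for x y
  proof -
    have V: "x \<in> verts Q\<^sub>1" "y \<in> verts Q\<^sub>1" using A.adj_ne[OF xy] by auto
    have xy': "adj Q\<^sub>2 (\<psi> x) (\<psi> y)" using adj[OF V] xy by simp
    show ?thesis unfolding A.boundary_cycle_iff[OF xy] B.boundary_cycle_iff[OF xy']
    proof (intro iffI allI impI)
      fix z t z' t'
      assume *: "\<forall>z t z' t'. A.square x y z t \<longrightarrow> A.square x y z' t' \<longrightarrow> z = z' \<and> t = t'"
        and s: "B.square (\<psi> x) (\<psi> y) z t" "B.square (\<psi> x) (\<psi> y) z' t'"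
      obtain c d c' d' where cd: "c \<in> verts Q\<^sub>1" "d \<in> verts Q\<^sub>1" "c' \<in> verts Q\<^sub>1" "d' \<in> verts Q\<^sub>1"
        "z = \<psi> c" "t = \<psi> d" "z' = \<psi> c'" "t' = \<psi> d'"
        using Bsq[OF s(1)] Bsq[OF s(2)] lift by (metis insert_subset)
      have "A.square x y c d" "A.square x y c' d'"
        using s square[of x y c d] square[of x y c' d'] V cd by simp_all
      then show "z = z' \<and> t = t'" using * cd by blast
    next
      fix z t z' t'
      assume *: "\<forall>z t z' t'. B.square (\<psi> x) (\<psi> y) z t \<longrightarrow> B.square (\<psi> x) (\<psi> y) z' t' \<longrightarrow> z = z' \<and> t = t'"
        and s: "A.square x y z t" "A.square x y z' t'"
      have "B.square (\<psi> x) (\<psi> y) (\<psi> z) (\<psi> t)" "B.square (\<psi> x) (\<psi> y) (\<psi> z') (\<psi> t')"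
        using s square[OF Asq[OF s(1)]] square[OF Asq[OF s(2)]] by simp_all
      then have "\<psi> z = \<psi> z'" "\<psi> t = \<psi> t'" using * by blast+
      then show "z = z' \<and> t = t'" using eq Asq[OF s(1)] Asq[OF s(2)] by simp
    qed
  qed
  have "graph_iso Q\<^sub>1 Q\<^sub>2 \<psi>" using \<psi>(1) adj unfolding graph_iso_def by blast
  moreover have "carries_boundary_cycle Q\<^sub>1 Q\<^sub>2 \<psi>"
    unfolding carries_boundary_cycle_def
  proof (intro equalityI subsetI)
    fix p assume "p \<in> (`) \<psi> ` boundary_cycle Q\<^sub>1"
    then obtain p' where p': "p' \<in> boundary_cycle Q\<^sub>1" "p = \<psi> ` p'" by blast
    obtain x y where xy: "adj Q\<^sub>1 x y" "p' = {x, y}" using A.boundary_cycle_pair[OF p'(1)] .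
    then show "p \<in> boundary_cycle Q\<^sub>2" using pair[OF xy(1)] p' by simp
  next
    fix p assume p: "p \<in> boundary_cycle Q\<^sub>2"
    obtain x' y' where xy': "adj Q\<^sub>2 x' y'" "p = {x', y'}" using B.boundary_cycle_pair[OF p] .
    obtain x y where xy: "x \<in> verts Q\<^sub>1" "y \<in> verts Q\<^sub>1" "x' = \<psi> x" "y' = \<psi> y"
      using lift B.adj_ne[OF xy'(1)] by metis
    then have "adj Q\<^sub>1 x y" using adj xy' by simp
    then have "{x, y} \<in> boundary_cycle Q\<^sub>1" using pair p xy' xy by simp
    moreover have "p = \<psi> ` {x, y}" using xy xy' by simp
    ultimately show "p \<in> (`) \<psi> ` boundary_cycle Q\<^sub>1" by blast
  qed
  moreover have "carries_internal_faces Q\<^sub>1 Q\<^sub>2 \<psi>"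
    unfolding carries_internal_faces_def
  proof (rule bij_betw_lift[OF A.face_boundary_inj B.face_boundary_inj])
    have "inj_on ((`) ((`) \<psi>)) (Pow (Pow (verts Q\<^sub>1)))"
      \<comment> \<open>A face boundary is a set of sets of vertices, so injectivity of
        \<open>\<psi>\<close> is lifted through two power sets.\<close>
      by (intro inj_on_image_Pow inj)
    moreover have "face_boundary Q\<^sub>1 ` internal_faces Q\<^sub>1 \<subseteq> Pow (Pow (verts Q\<^sub>1))"
      by (auto simp: face_boundary_def ends_def)
    ultimately have "inj_on ((`) ((`) \<psi>)) (face_boundary Q\<^sub>1 ` internal_faces Q\<^sub>1)"
      by (rule inj_on_subset)
    moreover have "(`) ((`) \<psi>) ` (face_boundary Q\<^sub>1 ` internal_faces Q\<^sub>1) = face_boundary Q\<^sub>2 ` internal_faces Q\<^sub>2"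
      unfolding A.face_boundary_range B.face_boundary_range
    proof (intro equalityI subsetI)
      fix X assume "X \<in> (`) ((`) \<psi>) ` {quad_pairs a b c d |a b c d. A.square a b c d}"
      then obtain a b c d where s: "A.square a b c d" "X = (`) \<psi> ` quad_pairs a b c d" by blast
      have "B.square (\<psi> a) (\<psi> b) (\<psi> c) (\<psi> d)" using square[OF Asq[OF s(1)]] s(1) by simp
      moreover have "X = quad_pairs (\<psi> a) (\<psi> b) (\<psi> c) (\<psi> d)" unfolding s(2) image_quad_pairs ..
      ultimately show "X \<in> {quad_pairs a b c d |a b c d. B.square a b c d}" by blast
    next
      fix X assume "X \<in> {quad_pairs a b c d |a b c d. B.square a b c d}"
      then obtain a' b' c' d' where s: "B.square a' b' c' d'" "X = quad_pairs a' b' c' d'" by blast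
      obtain a b c d where V: "a \<in> verts Q\<^sub>1" "b \<in> verts Q\<^sub>1" "c \<in> verts Q\<^sub>1" "d \<in> verts Q\<^sub>1"
        "a' = \<psi> a" "b' = \<psi> b" "c' = \<psi> c" "d' = \<psi> d"
        using Bsq[OF s(1)] lift by (metis insert_subset)
      then have "A.square a b c d" using s square[of a b c d] by simp
      moreover have "X = (`) \<psi> ` quad_pairs a b c d" unfolding s(2) image_quad_pairs V(5-8) ..
      ultimately show "X \<in> (`) ((`) \<psi>) ` {quad_pairs a b c d |a b c d. A.square a b c d}" by blast
    qed
    ultimately show "bij_betw ((`) ((`) \<psi>)) (face_boundary Q\<^sub>1 ` internal_faces Q\<^sub>1)
        (face_boundary Q\<^sub>2 ` internal_faces Q\<^sub>2)"
      by (simp add: bij_betw_def)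
  qed
  ultimately show ?thesis using \<psi>(2) by blast
qed

end
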